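(* For every finite subset $X\subset\mathbb{Z}+\tfrac12$, $$\rho(X)=\det\big[K(a,b)\big]_{a,b\in X},\qquad K(a,b)=\big(\Psi_a\,\Psi_b^*\,v_\emptyset,\,v_\emptyset\big),$$ where $\rho$ is the correlation function of the Schur measure and $\Psi_a,\Psi_b^*$ are the conjugated fermion operators.
   Context: Schur measure. Let $x=(x_1,x_2,\dots)$ and $y=(y_1,y_2,\dots)$ be two sets of variables, and put $t_k=\frac1k\sum_i x_i^k$, $t_k'=\frac1k\sum_i y_i^k$ for $k\ge1$. For a partition $\lambda$ let $s_\lambda$ be the Schur function and $\mathfrak{M}(\lambda)=\frac1Z s_\lambda(x)s_\lambda(y)$, where $Z=\sum_\lambda s_\lambda(x)s_\lambda(y)=\prod_{i,j}(1-x_iy_j)^{-1}=\exp\big(\sum_{k\ge1}k\,t_kt_k'\big)$. Schur functions are regarded as polynomials in the $t_k$ (resp. $t'_k$), the treatment is purely algebraic, and all identities are identities of formal power series in the $t_k,t_k'$ (no positivity of $\mathfrak{M}$ is assumed). Correlation functions. $\mathfrak{S}(\lambda)=\{\lambda_i-i+\tfrac12 : i\ge1\}\subset\mathbb{Z}+\tfrac12$, and $\rho(X)=\mathfrak{M}(\{\lambda : X\subset\mathfrak{S}(\lambda)\})=\frac1Z\sum_{\lambda:\,X\subset\mathfrak{S}(\lambda)}s_\lambda(x)s_\lambda(y)$. Infinite wedge space. Let $V$ have basis $\{\underline{k}\}_{k\in\mathbb{Z}+1/2}$. The space $\Lambda^{\frac\infty2}V$ has orthonormal basis $v_S=\underline{s_1}\wedge\underline{s_2}\wedge\cdots$,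 where $S=\{s_1>s_2>\cdots\}\subset\mathbb{Z}+\frac12$ is such that $S_+=S\setminus\{-\frac12,-\frac32,\dots\}$ and $S_-=\{-\frac12,-\frac32,\dots\}\setminus S$ are finite; $(\cdot,\cdot)$ is the inner product. The vacuum is $v_\emptyset=\underline{-\frac12}\wedge\underline{-\frac32}\wedge\underline{-\frac52}\wedge\cdots$. The operator $\psi_k$ is exterior multiplication $f\mapsto\underline{k}\wedge f$ and $\psi_k^*$ is its adjoint. For $n\ne0$ put $\alpha_n=\sum_{k\in\mathbb{Z}+1/2}\psi_{k-n}\psi_k^*$, and for a sequence $s=(s_1,s_2,\dots)$ put $\Gamma_\pm(s)=\exp\big(\sum_{n\ge1}s_n\alpha_{\pm n}\big)$. Finally $G=\Gamma_+(t)\,\Gamma_-(t')^{-1}$, $\Psi_k=G\psi_kG^{-1}$, $\Psi_k^*=G\psi_k^*G^{-1}$. *)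

theory Defs
  imports "HOL-Library.Poly_Mapping" "Jordan_Normal_Form.Determinant"
begin

section \<open>Formal power series in arbitrarily many variables\<close>

text \<open>
  A series assigns a coefficient to each monomial, a monomial being a finitely supported
  map from variables to exponents.
\<close>

typedef ('v, 'a) mfps = "UNIV :: (('v \<Rightarrow>\<^sub>0 nat) \<Rightarrow> 'a) set"
  morphisms mcoeff Mfps ..

lemmas mcoeff_Mfps [simp] = Mfps_inverse[OF UNIV_I]

lemma mfps_eqI: "(\<And>m. mcoeff f m = mcoeff g m) \<Longrightarrow> f = g"
  by (simp add: mcoeff_inject[symmetric] ext)

lemma finite_monomial_decomp: "finite {(p, q). p + q = (m :: 'v \<Rightarrow>\<^sub>0 nat)}"
proof -
  let ?F = "{f :: 'v \<Rightarrow> nat. \<forall>x. (x \<in> Poly_Mapping.keys m \<longrightarrow> f x \<in> {..(\<Sum>k\<in>Poly_Mapping.keys m. Poly_Mapping.lookup m k)}) \<and>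
              (x \<notin> Poly_Mapping.keys m \<longrightarrow> f x = 0)}"
  have fin: "finite ?F"
    by (rule finite_set_of_finite_funs) auto
  have *: "Poly_Mapping.lookup p \<in> ?F" if "p + q = m" for p q
  proof (intro CollectI allI conjI impI)
    fix x
    have le: "Poly_Mapping.lookup p x \<le> Poly_Mapping.lookup m x"
      using that by (auto simp: lookup_add)
    show "Poly_Mapping.lookup p x \<in> {..(\<Sum>k\<in>Poly_Mapping.keys m. Poly_Mapping.lookup m k)}" if "x \<in> Poly_Mapping.keys m"
      using le member_le_sum[OF that, of "Poly_Mapping.lookup m"] by auto
    show "Poly_Mapping.lookup p x = 0" if "x \<notin> Poly_Mapping.keys m"
      using le that by (simp add: in_keys_iff)
  qed
  have "finite (Poly_Mapping.lookup -` ?F)"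
    by (rule finite_vimageI[OF fin]) (simp add: inj_def Poly_Mapping.lookup_inject)
  hence "finite ((Poly_Mapping.lookup -` ?F) \<times> (Poly_Mapping.lookup -` ?F))"
    using finite_cartesian_product by blast
  moreover have "{(p, q). p + q = m} \<subseteq> (Poly_Mapping.lookup -` ?F) \<times> (Poly_Mapping.lookup -` ?F)"
  proof (rule subsetI)
    fix u assume "u \<in> {(p, q). p + q = m}"
    then obtain p q where u: "u = (p, q)" and pq: "p + q = m" by blast
    have "Poly_Mapping.lookup p \<in> ?F" by (rule *[OF pq])
    moreover have "Poly_Mapping.lookup q \<in> ?F" by (rule *[of q p]) (simp add: add.commute pq)
    ultimately show "u \<in> (Poly_Mapping.lookup -` ?F) \<times> (Poly_Mapping.lookup -` ?F)"
      unfolding u by (intro SigmaI vimageI2)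
  qed
  ultimately show ?thesis
    by (rule rev_finite_subset)
qed

instantiation mfps :: (type, comm_ring_1) comm_ring_1
begin

definition "0 = Mfps (\<lambda>_. 0)"
definition "1 = Mfps (\<lambda>m. if m = 0 then 1 else 0)"
definition "f + g = Mfps (\<lambda>m. mcoeff f m + mcoeff g m)"
definition "f - g = Mfps (\<lambda>m. mcoeff f m - mcoeff g m)"
definition "- f = Mfps (\<lambda>m. - mcoeff f m)"
definition "f * g = Mfps (\<lambda>m. \<Sum>(p, q)\<in>{(p, q). p + q = m}. mcoeff f p * mcoeff g q)"

instance
proof
  fix a b c :: "('a, 'b) mfps"
  show "a + b + c = a + (b + c)" "a + b = b + a" "0 + a = a" "- a + a = 0" "a - b = a + - b"
    by (auto intro!: mfps_eqI simp: zero_mfps_def plus_mfps_def minus_mfps_def uminus_mfps_def)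
  show "(a + b) * c = a * c + b * c"
    by (auto intro!: mfps_eqI simp: plus_mfps_def times_mfps_def case_prod_unfold
        distrib_right sum.distrib)
  show "a * b = b * a"
  proof (rule mfps_eqI)
    fix m
    show "mcoeff (a * b) m = mcoeff (b * a) m"
      unfolding times_mfps_def mcoeff_Mfps
      by (rule sum.reindex_bij_witness[of _ prod.swap prod.swap])
        (auto simp: add.commute mult.commute)
  qed
  show "1 * a = a"
  proof (rule mfps_eqI)
    fix m
    have "mcoeff (1 * a) m = (\<Sum>(p, q)\<in>{(0, m)}. mcoeff 1 p * mcoeff a q)"
      unfolding times_mfps_def mcoeff_Mfps
      by (rule sum.mono_neutral_right[OF finite_monomial_decomp])
        (auto simp: one_mfps_def split: if_splits)
    thus "mcoeff (1 * a) m = mcoeff a m"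
      by (simp add: one_mfps_def)
  qed
  show "a * b * c = a * (b * c)"
  proof (rule mfps_eqI)
    fix m
    let ?D = "\<lambda>m :: 'a \<Rightarrow>\<^sub>0 nat. {(p, q). p + q = m}"
    have "mcoeff (a * b * c) m =
        (\<Sum>u\<in>?D m. \<Sum>v\<in>?D (fst u). mcoeff a (fst v) * mcoeff b (snd v) * mcoeff c (snd u))"
      by (simp add: times_mfps_def case_prod_unfold sum_distrib_right)
    also have "\<dots> = (\<Sum>(u, v)\<in>Sigma (?D m) (\<lambda>u. ?D (fst u)).
        mcoeff a (fst v) * mcoeff b (snd v) * mcoeff c (snd u))"
      by (rule sum.Sigma) (use finite_monomial_decomp in blast)+
    also have "\<dots> = (\<Sum>(u, v)\<in>Sigma (?D m) (\<lambda>u. ?D (snd u)).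
        mcoeff a (fst u) * (mcoeff b (fst v) * mcoeff c (snd v)))"
      by (rule sum.reindex_bij_witness[of _
            "\<lambda>(u, v). ((fst u + fst v, snd v), (fst u, fst v))"
            "\<lambda>(u, v). ((fst v, snd v + snd u), (snd v, snd u))"])
        (auto simp: add.assoc mult.assoc)
    also have "\<dots> = (\<Sum>u\<in>?D m. \<Sum>v\<in>?D (snd u).
        mcoeff a (fst u) * (mcoeff b (fst v) * mcoeff c (snd v)))"
      by (rule sum.Sigma[symmetric]) (use finite_monomial_decomp in blast)+
    also have "\<dots> = mcoeff (a * (b * c)) m"
      by (simp add: times_mfps_def case_prod_unfold sum_distrib_left)
    finally show "mcoeff (a * b * c) m = mcoeff (a * (b * c)) m" .
  qed
  show "(0 :: ('a, 'b) mfps) \<noteq> 1"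
  proof
    assume "(0 :: ('a, 'b) mfps) = 1"
    hence "mcoeff (0 :: ('a, 'b) mfps) 0 = mcoeff 1 0" by simp
    thus False by (simp add: one_mfps_def zero_mfps_def)
  qed
qed

end

definition mfps_const :: "'a \<Rightarrow> ('v, 'a::zero) mfps" where
  "mfps_const c = Mfps (\<lambda>m. if m = 0 then c else 0)"

definition mfps_var :: "'v \<Rightarrow> ('v, 'a::zero_neq_one) mfps" where
  "mfps_var v = Mfps (\<lambda>m. if m = Poly_Mapping.single v 1 then 1 else 0)"

text \<open>
  The sum of a family in which each monomial occurs only finitely often, taken coefficientwise.
  Every family that enters \<open>correlation\<close> and \<open>corr_kernel\<close> has this property.
\<close>

definition mfps_sum :: "('i \<Rightarrow> ('v, 'a::comm_monoid_add) mfps) \<Rightarrow> 'i set \<Rightarrow> ('v, 'a) mfps" where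
  "mfps_sum f A = Mfps (\<lambda>m. \<Sum>i\<in>{i \<in> A. mcoeff (f i) m \<noteq> 0}. mcoeff (f i) m)"

definition mfps_inverse :: "('v, 'a::comm_ring_1) mfps \<Rightarrow> ('v, 'a) mfps" where
  "mfps_inverse f = (THE g. f * g = 1)"

text \<open>
  The coefficient ring: formal power series in the two sets of variables. The variable
  $x_{i+1}$ is \<open>Inl i\<close> and $y_{i+1}$ is \<open>Inr i\<close>. The power sums of each set are
  algebraically independent, so series in $t_k, t'_k$ embed into this ring.
\<close>

type_synonym 'a series = "(nat + nat, 'a) mfps"

definition xvar :: "nat \<Rightarrow> 'a::comm_ring_1 series" where "xvar i = mfps_var (Inl i)"
definition yvar :: "nat \<Rightarrow> 'a::comm_ring_1 series" where "yvar i = mfps_var (Inr i)"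

definition power_sum_time :: "(nat \<Rightarrow> 'a::field_char_0 series) \<Rightarrow> nat \<Rightarrow> 'a series" where
  "power_sum_time v k = mfps_const (1 / of_nat k) * mfps_sum (\<lambda>i. v i ^ k) UNIV"

abbreviation "tx \<equiv> power_sum_time xvar"
abbreviation "ty \<equiv> power_sum_time yvar"


section \<open>Partitions, Schur functions and the Schur measure\<close>

text \<open>The part $\lambda_{i+1}$ is \<open>lam i\<close>; rows and columns of diagrams are counted from 0.\<close>

definition partitions :: "(nat \<Rightarrow> nat) set" where
  "partitions = {lam. antimono lam \<and> finite {i. lam i \<noteq> 0}}"

definition diagram :: "(nat \<Rightarrow> nat) \<Rightarrow> (nat \<times> nat) set" where
  "diagram lam = {(i, j). j < lam i}"

text \<open>Semistandard tableaux; the value 0 outside the diagram only makes them unique as functions.\<close>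

definition ssyt :: "(nat \<Rightarrow> nat) \<Rightarrow> (nat \<times> nat \<Rightarrow> nat) set" where
  "ssyt lam = {T.
     (\<forall>i j. (i, Suc j) \<in> diagram lam \<longrightarrow> T (i, j) \<le> T (i, Suc j)) \<and>
     (\<forall>i j. (Suc i, j) \<in> diagram lam \<longrightarrow> T (i, j) < T (Suc i, j)) \<and>
     (\<forall>c. c \<notin> diagram lam \<longrightarrow> T c = 0)}"

definition schur :: "(nat \<Rightarrow> 'a::comm_ring_1 series) \<Rightarrow> (nat \<Rightarrow> nat) \<Rightarrow> 'a series" where
  "schur v lam = mfps_sum (\<lambda>T. \<Prod>c\<in>diagram lam. v (T c)) (ssyt lam)"

definition schur_Z :: "'a::comm_ring_1 series" where
  "schur_Z = mfps_sum (\<lambda>lam. schur xvar lam * schur yvar lam) partitions"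

definition schur_measure :: "(nat \<Rightarrow> nat) \<Rightarrow> 'a::comm_ring_1 series" where
  "schur_measure lam = mfps_inverse schur_Z * (schur xvar lam * schur yvar lam)"

definition half_ints :: "rat set" where
  "half_ints = range (\<lambda>m :: int. of_int m + 1 / 2)"

definition point_config :: "(nat \<Rightarrow> nat) \<Rightarrow> rat set" where
  "point_config lam = {of_nat (lam (i - 1)) - of_nat i + 1 / 2 | i. i \<ge> 1}"

definition correlation :: "rat set \<Rightarrow> 'a::comm_ring_1 series" where
  "correlation X = mfps_sum schur_measure {lam \<in> partitions. X \<subseteq> point_config lam}"


section \<open>The infinite wedge space\<close>

definition neg_half_ints :: "rat set" where
  "neg_half_ints = {k \<in> half_ints. k < 0}"

typedef semi_inf = "{S. S \<subseteq> half_ints \<and> finite (S - neg_half_ints) \<and> finite (neg_half_ints - S)}"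
  morphisms occupied Semi_inf
  by (rule exI[of _ neg_half_ints]) (auto simp: neg_half_ints_def)

text \<open>
  Vectors are formal, possibly infinite, combinations $\sum_S f(S)\, v_S$. Infinite ones are
  needed because $\Gamma_-(t')$ maps a basis vector to an infinite combination.
\<close>

type_synonym 'a wedge = "semi_inf \<Rightarrow> 'a series"

definition wedge_basis :: "semi_inf \<Rightarrow> 'a::comm_ring_1 wedge" where
  "wedge_basis S = (\<lambda>S'. if S' = S then 1 else 0)"

definition vacuum :: "'a::comm_ring_1 wedge" where
  "vacuum = wedge_basis (Semi_inf neg_half_ints)"

definition wedge_inner :: "'a::comm_ring_1 wedge \<Rightarrow> 'a wedge \<Rightarrow> 'a series" where
  "wedge_inner f g = mfps_sum (\<lambda>S. f S * g S) UNIV"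

definition linear_ext :: "(semi_inf \<Rightarrow> 'a::comm_ring_1 wedge) \<Rightarrow> 'a wedge \<Rightarrow> 'a wedge" where
  "linear_ext \<phi> f = (\<lambda>S'. mfps_sum (\<lambda>S. f S * \<phi> S S') UNIV)"

text \<open>The sign moves $\underline{k}$ past the factors of $v_S$ that are larger than $k$.\<close>

definition psi_basis :: "rat \<Rightarrow> semi_inf \<Rightarrow> 'a::comm_ring_1 wedge" where
  "psi_basis k S =
     (if k \<in> occupied S then (\<lambda>_. 0)
      else (\<lambda>S'. (- 1) ^ card {s \<in> occupied S. s > k} *
                 wedge_basis (Semi_inf (insert k (occupied S))) S'))"

definition psi :: "rat \<Rightarrow> 'a::comm_ring_1 wedge \<Rightarrow> 'a wedge" where
  "psi k = linear_ext (psi_basis k)"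

text \<open>The adjoint of \<open>psi k\<close>: its \<open>S\<close>-coordinate is $(f, \psi_k v_S)$.\<close>

definition psi_star :: "rat \<Rightarrow> 'a::comm_ring_1 wedge \<Rightarrow> 'a wedge" where
  "psi_star k f = (\<lambda>S. wedge_inner f (psi k (wedge_basis S)))"

definition alpha :: "int \<Rightarrow> 'a::comm_ring_1 wedge \<Rightarrow> 'a wedge" where
  "alpha n f = (\<lambda>S. mfps_sum (\<lambda>k. psi (k - of_int n) (psi_star k f) S) half_ints)"

definition op_exp :: "('a::field_char_0 wedge \<Rightarrow> 'a wedge) \<Rightarrow> 'a wedge \<Rightarrow> 'a wedge" where
  "op_exp A f = (\<lambda>S. mfps_sum (\<lambda>j. mfps_const (1 / fact j) * (A ^^ j) f S) UNIV)"

definition Gamma_plus :: "(nat \<Rightarrow> 'a::field_char_0 series) \<Rightarrow> 'a wedge \<Rightarrow> 'a wedge" where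
  "Gamma_plus s = op_exp (\<lambda>f S. mfps_sum (\<lambda>n. s n * alpha (int n) f S) {1..})"

definition Gamma_minus :: "(nat \<Rightarrow> 'a::field_char_0 series) \<Rightarrow> 'a wedge \<Rightarrow> 'a wedge" where
  "Gamma_minus s = op_exp (\<lambda>f S. mfps_sum (\<lambda>n. s n * alpha (- int n) f S) {1..})"

definition G_op :: "'a::field_char_0 wedge \<Rightarrow> 'a wedge" where
  "G_op = Gamma_plus tx \<circ> inv_into UNIV (Gamma_minus ty)"

definition Psi :: "rat \<Rightarrow> 'a::field_char_0 wedge \<Rightarrow> 'a wedge" where
  "Psi k = G_op \<circ> psi k \<circ> inv_into UNIV G_op"

definition Psi_star :: "rat \<Rightarrow> 'a::field_char_0 wedge \<Rightarrow> 'a wedge" where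
  "Psi_star k = G_op \<circ> psi_star k \<circ> inv_into UNIV G_op"

definition corr_kernel :: "rat \<Rightarrow> rat \<Rightarrow> 'a::field_char_0 series" where
  "corr_kernel a b = wedge_inner (Psi a (Psi_star b vacuum)) vacuum"

end

theory Submission
  imports Defs
begin

text \<open>
  Operators on the wedge space are row-finite matrices over the power series, which form a ring
  acting on all vectors. The currents satisfy \<open>[cur n, cre k] = cre (k - n)\<close> and
  \<open>[cur n, ann k] = - ann (k + n)\<close>, so \<open>[cur n, cur m]\<close> commutes with all fermions and is a
  scalar; hence \<open>\<Gamma>\<^sub>+\<close> and \<open>\<Gamma>\<^sub>-\<close> commute up to an invertible scalar, which must be the
  vacuum expectation \<open>Z\<close> of \<open>\<Gamma>\<^sub>+ \<Gamma>\<^sub>-\<close>. So \<open>K(a,b) = Z\<inverse> \<langle>\<Gamma>\<^sub>+ \<psi>\<^sub>a \<psi>\<^sub>b\<^sup>* \<Gamma>\<^sub>-\<rangle>\<close>.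

  Wick's theorem follows from the Casimir operator \<open>\<Omega> = \<Sum>\<^sub>k \<psi>\<^sub>k\<^sup>* \<otimes> \<psi>\<^sub>k\<close>: it commutes with
  \<open>\<Gamma> \<otimes> \<Gamma>\<close> and is annihilated by the vacuum on both sides. Evaluating
  \<open>(\<psi>\<^sub>a \<otimes> 1) \<Omega> (1 \<otimes> N)\<close> by moving \<open>\<Omega>\<close> to the left and to the right gives the Laplace
  expansion of the determinant along its first row.

  Finally \<open>\<Gamma>\<^sub>+\<close> of a single variable \<open>x\<close> removes horizontal strips with weight \<open>x\<close> per box.
  Iterating over the variables builds semistandard tableaux, so the vacuum coefficient of
  \<open>\<Gamma>\<^sub>+ v\<^sub>\<lambda>\<close> is the Schur function; \<open>\<Gamma>\<^sub>-\<close> is the transpose of \<open>\<Gamma>\<^sub>+\<close>.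
\<close>

section \<open>Coefficientwise summation of power series\<close>

text \<open>The obstacle is convergence. \<open>Gamma_minus\<close> sends a basis vector to an
  infinite combination, so operators cannot be handled through finite images of basis vectors.
  Moreover \<open>mfps_sum\<close> is a true sum only where each monomial receives finitely many
  contributions; a coefficient that receives infinitely many becomes 0. Hence every exchange of sums
  carries a proof of local finiteness. The matrix ring reduces most of these proofs to two sources:
  only finitely many levels matter in a given row, or the n-th term has order at least n in the
  variables. Even the summability over partitions behind Z and rho is read off from one row of the
  matrix of Gamma_+.

  Z is invertible because it is an exponential: a scalar commutator c of positive order gives
  exp(c), with inverse exp(-c), and the case of no prescribed points identifies exp(c) with the sum
  Z over partitions.

  Conjugated fermions are infinite series of fermions. The Casimir operator leaves them unexpanded,
  since it sees the exponentials only as group-like elements of the tensor square.\<close>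

definition locfin :: "('i \<Rightarrow> ('v, 'a::zero) mfps) \<Rightarrow> 'i set \<Rightarrow> bool" where
  "locfin f I \<longleftrightarrow> (\<forall>m. finite {i \<in> I. mcoeff (f i) m \<noteq> 0})"

lemma locfinI [intro?]: "(\<And>m. finite {i \<in> I. mcoeff (f i) m \<noteq> 0}) \<Longrightarrow> locfin f I"
  by (simp add: locfin_def)

lemma locfinD: "locfin f I \<Longrightarrow> finite {i \<in> I. mcoeff (f i) m \<noteq> 0}"
  by (simp add: locfin_def)

lemma mcoeff_zero [simp]: "mcoeff 0 m = 0" by (simp add: zero_mfps_def)
lemma mcoeff_one: "mcoeff 1 m = (if m = 0 then 1 else 0)" by (simp add: one_mfps_def)
lemma mcoeff_add [simp]: "mcoeff (f + g) m = mcoeff f m + mcoeff g m" by (simp add: plus_mfps_def)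
lemma mcoeff_diff [simp]: "mcoeff (f - g) m = mcoeff f m - mcoeff g m" by (simp add: minus_mfps_def)
lemma mcoeff_uminus [simp]: "mcoeff (- f) m = - mcoeff f m" by (simp add: uminus_mfps_def)
lemma mcoeff_const: "mcoeff (mfps_const c) m = (if m = 0 then c else 0)" by (simp add: mfps_const_def)
lemma mcoeff_mult: "mcoeff (f * g) m = (\<Sum>(p, q)\<in>{(p, q). p + q = m}. mcoeff f p * mcoeff g q)"
  by (simp add: times_mfps_def)
lemma mcoeff_sum: "mcoeff (sum f A) m = (\<Sum>i\<in>A. mcoeff (f i) m)"
  by (induction A rule: infinite_finite_induct) auto

lemma mcoeff_mfps_sum: "mcoeff (mfps_sum f A) m = (\<Sum>i\<in>{i \<in> A. mcoeff (f i) m \<noteq> 0}. mcoeff (f i) m)"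
  by (simp add: mfps_sum_def)

text \<open>The index set of the sum depends on the coefficient; a common finite superset makes
  several such sums comparable term by term.\<close>

lemma mcoeff_mfps_sum_superset:
  assumes "finite F" "F \<subseteq> A" "\<And>i. i \<in> A \<Longrightarrow> mcoeff (f i) m \<noteq> 0 \<Longrightarrow> i \<in> F"
  shows "mcoeff (mfps_sum f A) m = (\<Sum>i\<in>F. mcoeff (f i) m)"
  unfolding mcoeff_mfps_sum
  by (rule sum.mono_neutral_left) (use assms in auto)

lemma mcoeff_mfps_sum_nonzeroD:
  "mcoeff (mfps_sum f A) m \<noteq> 0 \<Longrightarrow> \<exists>i\<in>A. mcoeff (f i) m \<noteq> 0"
  unfolding mcoeff_mfps_sum by (metis (mono_tags, lifting) mem_Collect_eq sum.not_neutral_contains_not_neutral)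

lemma mcoeff_mult_nonzeroD:
  "mcoeff (f * g) m \<noteq> 0 \<Longrightarrow> \<exists>p q. p + q = m \<and> mcoeff f p \<noteq> 0 \<and> mcoeff g q \<noteq> 0"
  unfolding mcoeff_mult
  by (drule sum.not_neutral_contains_not_neutral) (auto, metis mult_zero_left mult_zero_right)

lemma mfps_sum_cong:
  "A = B \<Longrightarrow> (\<And>i. i \<in> B \<Longrightarrow> f i = g i) \<Longrightarrow> mfps_sum f A = mfps_sum g B"
  unfolding mfps_sum_def by (intro arg_cong[where f = Mfps] ext sum.cong) auto

lemma locfin_cong:
  "A = B \<Longrightarrow> (\<And>i. i \<in> B \<Longrightarrow> f i = g i) \<Longrightarrow> locfin f A = locfin g B"
  unfolding locfin_def by (simp cong: conj_cong)

lemma locfin_finite: "finite A \<Longrightarrow> locfin f A"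
  by (simp add: locfin_def)

lemma locfin_subset: "locfin f A \<Longrightarrow> B \<subseteq> A \<Longrightarrow> locfin f B"
  unfolding locfin_def by (auto elim!: finite_subset[rotated])

lemma locfin_support:
  assumes "finite {i \<in> A. f i \<noteq> 0}" shows "locfin f A"
  using assms by (intro locfinI) (erule rev_finite_subset, auto)

lemma locfin_image_dom:
  assumes "locfin f A" "\<And>m i. i \<in> A \<Longrightarrow> mcoeff (g i) m \<noteq> 0 \<Longrightarrow> mcoeff (f i) m \<noteq> 0"
  shows "locfin g A"
proof
  fix m
  show "finite {i \<in> A. mcoeff (g i) m \<noteq> 0}"
    by (rule finite_subset[OF _ locfinD[OF assms(1), of m]]) (use assms(2) in blast)
qed

lemma mfps_sum_finite: "finite A \<Longrightarrow> mfps_sum f A = sum f A"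
  by (rule mfps_eqI) (auto simp: mcoeff_sum intro!: mcoeff_mfps_sum_superset)

lemma mfps_sum_mono_neutral:
  assumes "B \<subseteq> A" "\<And>i. i \<in> A - B \<Longrightarrow> f i = 0"
  shows "mfps_sum f A = mfps_sum f B"
proof (rule mfps_eqI)
  fix m
  have "{i \<in> A. mcoeff (f i) m \<noteq> 0} = {i \<in> B. mcoeff (f i) m \<noteq> 0}"
    using assms by auto (metis DiffI mcoeff_zero)
  thus "mcoeff (mfps_sum f A) m = mcoeff (mfps_sum f B) m"
    by (simp add: mcoeff_mfps_sum)
qed

lemma mfps_sum_single:
  assumes "a \<in> A" "\<And>i. i \<in> A \<Longrightarrow> i \<noteq> a \<Longrightarrow> f i = 0"
  shows "mfps_sum f A = f a"
  using assms by (subst mfps_sum_mono_neutral[of "{a}"]) (auto simp: mfps_sum_finite)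

lemma mfps_sum_zero [simp]: "mfps_sum (\<lambda>_. 0) A = 0"
  by (rule mfps_eqI) (simp add: mcoeff_mfps_sum)

lemma mfps_sum_zero': "(\<And>i. i \<in> A \<Longrightarrow> f i = 0) \<Longrightarrow> mfps_sum f A = 0"
  by (subst mfps_sum_cong[of A A f "\<lambda>_. 0"]) auto

lemma mfps_sum_reindex:
  assumes "inj_on h B" shows "mfps_sum f (h ` B) = mfps_sum (f \<circ> h) B"
proof (rule mfps_eqI)
  fix m
  have "{i \<in> h ` B. mcoeff (f i) m \<noteq> 0} = h ` {i \<in> B. mcoeff (f (h i)) m \<noteq> 0}" by auto
  moreover have "inj_on h {i \<in> B. mcoeff (f (h i)) m \<noteq> 0}"
    using assms by (rule inj_on_subset) auto
  ultimately show "mcoeff (mfps_sum f (h ` B)) m = mcoeff (mfps_sum (f \<circ> h) B) m"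
    by (simp add: mcoeff_mfps_sum sum.reindex)
qed

lemma mfps_sum_bij_betw:
  "bij_betw h B A \<Longrightarrow> mfps_sum f A = mfps_sum (\<lambda>i. f (h i)) B"
  using mfps_sum_reindex[of h B f] by (auto simp: bij_betw_def o_def)

lemma locfin_reindex: "inj_on h B \<Longrightarrow> locfin f (h ` B) \<Longrightarrow> locfin (\<lambda>i. f (h i)) B"
  unfolding locfin_def
proof
  fix m assume "inj_on h B" and fin: "\<forall>m. finite {i \<in> h ` B. mcoeff (f i) m \<noteq> 0}"
  have "finite (h ` {i \<in> B. mcoeff (f (h i)) m \<noteq> 0})"
    by (rule finite_subset[OF _ fin[rule_format, of m]]) auto
  moreover have "inj_on h {i \<in> B. mcoeff (f (h i)) m \<noteq> 0}"
    using \<open>inj_on h B\<close> by (rule inj_on_subset) auto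
  ultimately show "finite {i \<in> B. mcoeff (f (h i)) m \<noteq> 0}"
    by (rule finite_imageD)
qed

lemma locfin_add: "locfin f A \<Longrightarrow> locfin g A \<Longrightarrow> locfin (\<lambda>i. f i + g i :: (_, 'a::comm_ring_1) mfps) A"
  unfolding locfin_def
proof
  fix m assume *: "\<forall>m. finite {i \<in> A. mcoeff (f i) m \<noteq> 0}" "\<forall>m. finite {i \<in> A. mcoeff (g i) m \<noteq> 0}"
  show "finite {i \<in> A. mcoeff (f i + g i) m \<noteq> 0}"
    by (rule finite_subset[OF _ finite_UnI[OF *[rule_format, of m]]]) auto
qed

lemma mfps_sum_add:
  fixes f g :: "'i \<Rightarrow> ('v, 'a::comm_ring_1) mfps"
  assumes "locfin f A" "locfin g A"
  shows "mfps_sum (\<lambda>i. f i + g i) A = mfps_sum f A + mfps_sum g A"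
proof (rule mfps_eqI)
  fix m
  let ?F = "{i \<in> A. mcoeff (f i) m \<noteq> 0} \<union> {i \<in> A. mcoeff (g i) m \<noteq> 0}"
  have F: "finite ?F" using assms by (auto dest: locfinD)
  have "mcoeff (mfps_sum h A) m = (\<Sum>i\<in>?F. mcoeff (h i) m)"
    if "\<And>i. mcoeff (h i) m \<noteq> 0 \<Longrightarrow> mcoeff (f i) m \<noteq> 0 \<or> mcoeff (g i) m \<noteq> 0" for h
    using F that by (intro mcoeff_mfps_sum_superset) auto
  note * = this
  show "mcoeff (mfps_sum (\<lambda>i. f i + g i) A) m = mcoeff (mfps_sum f A + mfps_sum g A) m"
    by (simp add: * sum.distrib) (subst *; auto simp: sum.distrib)
qed

lemma mfps_sum_uminus: "mfps_sum (\<lambda>i. - f i :: ('v, 'a::comm_ring_1) mfps) A = - mfps_sum f A"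
  by (rule mfps_eqI) (simp add: mcoeff_mfps_sum sum_negf)

lemma locfin_uminus: "locfin (\<lambda>i. - f i :: ('v, 'a::comm_ring_1) mfps) A = locfin f A"
  by (simp add: locfin_def)

section \<open>Double sums and products\<close>

lemma locfin_Sigma_inner:
  assumes "locfin (\<lambda>(i, j). f i j) (Sigma A B)" "i \<in> A"
  shows "locfin (f i) (B i)"
proof
  fix m
  have "finite (snd ` {p \<in> Sigma A B. mcoeff (f (fst p) (snd p)) m \<noteq> 0})"
    using assms(1)[THEN locfinD, of m] by (intro finite_imageI) (simp add: case_prod_unfold)
  thus "finite {j \<in> B i. mcoeff (f i j) m \<noteq> 0}"
    by (rule rev_finite_subset) (use assms(2) in force)
qed

lemma locfin_Sigma_outer:
  assumes "locfin (\<lambda>(i, j). f i j) (Sigma A B)"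
  shows "locfin (\<lambda>i. mfps_sum (f i) (B i)) A"
proof
  fix m
  have "finite (fst ` {p \<in> Sigma A B. mcoeff (f (fst p) (snd p)) m \<noteq> 0})"
    using assms(1)[THEN locfinD, of m] by (intro finite_imageI) (simp add: case_prod_unfold)
  thus "finite {i \<in> A. mcoeff (mfps_sum (f i) (B i)) m \<noteq> 0}"
    by (rule rev_finite_subset) (force dest: mcoeff_mfps_sum_nonzeroD)
qed

text \<open>Fubini. Local finiteness is required jointly in both indices, because cancellation
  inside an inner sum could otherwise hide infinitely many contributions.\<close>

lemma mfps_sum_Sigma:
  assumes "locfin (\<lambda>(i, j). f i j) (Sigma A B)"
  shows "mfps_sum (\<lambda>i. mfps_sum (f i) (B i)) A = mfps_sum (\<lambda>(i, j). f i j) (Sigma A B)"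
proof (rule mfps_eqI)
  fix m
  let ?P = "{p \<in> Sigma A B. mcoeff (f (fst p) (snd p)) m \<noteq> 0}"
  have P: "finite ?P" using assms(1)[THEN locfinD, of m] by (simp add: case_prod_unfold)
  let ?F = "fst ` ?P"
  have F: "finite ?F" using P by simp
  have fin2: "finite {j \<in> B i. mcoeff (f i j) m \<noteq> 0}" if "i \<in> A" for i
    using locfin_Sigma_inner[OF assms that] by (rule locfinD)
  have "mcoeff (mfps_sum (\<lambda>i. mfps_sum (f i) (B i)) A) m =
      (\<Sum>i\<in>?F. mcoeff (mfps_sum (f i) (B i)) m)"
    by (rule mcoeff_mfps_sum_superset) (use F in \<open>force dest: mcoeff_mfps_sum_nonzeroD\<close>)+
  also have "\<dots> = (\<Sum>i\<in>?F. \<Sum>j\<in>{j \<in> B i. mcoeff (f i j) m \<noteq> 0}. mcoeff (f i j) m)"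
    by (simp add: mcoeff_mfps_sum)
  also have "\<dots> = (\<Sum>(i, j)\<in>Sigma ?F (\<lambda>i. {j \<in> B i. mcoeff (f i j) m \<noteq> 0}). mcoeff (f i j) m)"
    by (rule sum.Sigma) (use F fin2 in auto)
  also have "\<dots> = mcoeff (mfps_sum (\<lambda>(i, j). f i j) (Sigma A B)) m"
    unfolding mcoeff_mfps_sum by (rule sum.cong) (force simp: case_prod_unfold image_iff)+
  finally show "mcoeff (mfps_sum (\<lambda>i. mfps_sum (f i) (B i)) A) m =
    mcoeff (mfps_sum (\<lambda>(i, j). f i j) (Sigma A B)) m" .
qed

lemma mfps_sum_swap:
  assumes "locfin (\<lambda>(i, j). f i j) (A \<times> B)"
  shows "mfps_sum (\<lambda>i. mfps_sum (f i) B) A = mfps_sum (\<lambda>j. mfps_sum (\<lambda>i. f i j) A) B"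
proof -
  have bij: "bij_betw prod.swap (B \<times> A) (A \<times> B)"
    by (auto simp: bij_betw_def)
  have "locfin (\<lambda>(j, i). f i j) (B \<times> A)"
    using locfin_reindex[of prod.swap "B \<times> A" "\<lambda>(i, j). f i j"] assms bij
    by (simp add: bij_betw_def case_prod_unfold)
  from mfps_sum_Sigma[OF this] mfps_sum_Sigma[OF assms] mfps_sum_bij_betw[OF bij, of "\<lambda>(i, j). f i j"]
  show ?thesis by (simp add: case_prod_unfold)
qed

text \<open>A monomial m has finitely many factorisations p + q = m. Each leaves finitely many i for
  p, and then finitely many j for q, with no uniformity in i.\<close>

lemma locfin_mult:
  fixes f :: "'i \<Rightarrow> ('v, 'a::comm_ring_1) mfps"
  assumes "locfin f A" "\<And>i. i \<in> A \<Longrightarrow> locfin (g i) (B i)"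
  shows "locfin (\<lambda>(i, j). f i * g i j) (Sigma A B)"
proof
  fix m
  let ?S = "\<Union>(p, q)\<in>{(p, q). p + q = m}. Sigma {i \<in> A. mcoeff (f i) p \<noteq> 0} (\<lambda>i. {j \<in> B i. mcoeff (g i j) q \<noteq> 0})"
  have "finite ?S"
    by (intro finite_UN_I finite_monomial_decomp)
       (use assms in \<open>auto dest: locfinD intro!: finite_SigmaI\<close>)
  thus "finite {x \<in> Sigma A B. mcoeff (case x of (i, j) \<Rightarrow> f i * g i j) m \<noteq> 0}"
  proof (rule rev_finite_subset, intro subsetI)
    fix x assume "x \<in> {x \<in> Sigma A B. mcoeff (case x of (i, j) \<Rightarrow> f i * g i j) m \<noteq> 0}"
    then obtain i j where x: "x = (i, j)" "i \<in> A" "j \<in> B i" "mcoeff (f i * g i j) m \<noteq> 0" by auto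
    from mcoeff_mult_nonzeroD[OF x(4)] obtain p q where
      "p + q = m" "mcoeff (f i) p \<noteq> 0" "mcoeff (g i j) q \<noteq> 0" by blast
    thus "x \<in> ?S" using x by auto
  qed
qed

lemma mfps_sum_cmult:
  fixes f :: "'i \<Rightarrow> ('v, 'a::comm_ring_1) mfps"
  assumes "locfin f A"
  shows "mfps_sum (\<lambda>i. c * f i) A = c * mfps_sum f A"
proof (rule mfps_eqI)
  fix m
  let ?D = "{(p, q). p + q = m} :: (('v \<Rightarrow>\<^sub>0 nat) \<times> _) set"
  \<comment> \<open>One finite index set serves all factors q of m at once, so that the two finite
    sums can be exchanged.\<close>
  let ?F = "\<Union>(p, q)\<in>?D. {i \<in> A. mcoeff (f i) q \<noteq> 0}"
  have F: "finite ?F" using assms by (intro finite_UN_I finite_monomial_decomp) (auto dest: locfinD)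
  have "mcoeff (mfps_sum (\<lambda>i. c * f i) A) m = (\<Sum>i\<in>?F. mcoeff (c * f i) m)"
    by (rule mcoeff_mfps_sum_superset) (use F in \<open>auto dest!: mcoeff_mult_nonzeroD\<close>)
  also have "\<dots> = (\<Sum>i\<in>?F. \<Sum>(p, q)\<in>?D. mcoeff c p * mcoeff (f i) q)" by (simp add: mcoeff_mult)
  also have "\<dots> = (\<Sum>(p, q)\<in>?D. \<Sum>i\<in>?F. mcoeff c p * mcoeff (f i) q)"
    unfolding case_prod_unfold by (rule sum.swap)
  also have "\<dots> = (\<Sum>(p, q)\<in>?D. mcoeff c p * mcoeff (mfps_sum f A) q)"
  proof (rule sum.cong[OF refl], unfold split_paired_all prod.case mem_Collect_eq)
    fix p q assume "p + q = m"
    hence "mcoeff (mfps_sum f A) q = (\<Sum>i\<in>?F. mcoeff (f i) q)"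
      using F by (intro mcoeff_mfps_sum_superset) auto
    thus "(\<Sum>i\<in>?F. mcoeff c p * mcoeff (f i) q) = mcoeff c p * mcoeff (mfps_sum f A) q"
      by (simp add: sum_distrib_left)
  qed
  finally show "mcoeff (mfps_sum (\<lambda>i. c * f i) A) m = mcoeff (c * mfps_sum f A) m"
    by (simp add: mcoeff_mult)
qed

section \<open>The ring of row-finite matrices\<close>

lemma locfin_swap:
  assumes "locfin (\<lambda>(i, j). f i j) (A \<times> B)" shows "locfin (\<lambda>(j, i). f i j) (B \<times> A)"
proof -
  have "prod.swap ` (B \<times> A) = A \<times> B" by auto
  thus ?thesis
    using locfin_reindex[of prod.swap "B \<times> A" "\<lambda>(i, j). f i j"] assms
    by (simp add: case_prod_unfold)
qed

lemma locfin_mult_right: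
  fixes f :: "'i \<Rightarrow> ('v, 'a::comm_ring_1) mfps"
  assumes "locfin f A" shows "locfin (\<lambda>i. f i * c i) A"
proof -
  \<comment> \<open>A dummy second index of type \<open>unit\<close> makes this an instance of
    \<open>locfin_mult\<close>.\<close>
  have "locfin (\<lambda>(i, u :: unit). f i * c i) (Sigma A (\<lambda>_. {()}))"
    using locfin_mult[of f A "\<lambda>i _. c i" "\<lambda>_. {()}"] assms by (auto simp: locfin_finite)
  from locfin_Sigma_outer[OF this] show ?thesis by (simp add: mfps_sum_finite)
qed

lemma mfps_sum_cmult_right:
  fixes f :: "'i \<Rightarrow> ('v, 'a::comm_ring_1) mfps"
  assumes "locfin f A" shows "mfps_sum (\<lambda>i. f i * c) A = mfps_sum f A * c"
  using mfps_sum_cmult[OF assms, of c] by (simp add: mult.commute)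

text \<open>
  Row-finiteness (for each monomial) makes products, and the action on arbitrary infinite
  combinations of basis vectors, converge coefficientwise; columns may be infinite.
\<close>

typedef (overloaded) ('i, 'v, 'a::comm_ring_1) lop =
  "{M :: 'i \<Rightarrow> 'i \<Rightarrow> ('v, 'a) mfps. \<forall>S. locfin (M S) UNIV}"
  morphisms ent Lop
  by (rule exI[of _ "\<lambda>_ _. 0"]) (simp add: locfin_def)

lemma locfin_ent: "locfin (ent M S) A"
  using ent[of M] by (auto intro: locfin_subset)

lemma lop_eqI: "(\<And>S T. ent M S T = ent N S T) \<Longrightarrow> M = N"
  by (simp add: ent_inject[symmetric] ext)

lemma ent_Lop: "(\<And>S. locfin (M S) UNIV) \<Longrightarrow> ent (Lop M) = M"
  by (simp add: Lop_inverse)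

text \<open>The family \<open>g\<close> is arbitrary: taken as a column of a third matrix it gives
  associativity of the product, taken as a vector it gives compatibility of the product with the
  action.\<close>

lemma mfps_sum_mult_assoc:
  fixes M N :: "('i, 'v, 'a::comm_ring_1) lop"
  shows "mfps_sum (\<lambda>b. mfps_sum (\<lambda>a. ent M S a * ent N a b) UNIV * g b) UNIV =
    mfps_sum (\<lambda>a. ent M S a * mfps_sum (\<lambda>b. ent N a b * g b) UNIV) UNIV" (is "?L = ?R")
proof -
  have 1: "locfin (\<lambda>(a, b). ent M S a * ent N a b) (UNIV \<times> UNIV)"
    by (rule locfin_mult) (rule locfin_ent)+
  have 2: "locfin (\<lambda>(a, b). ent M S a * (ent N a b * g b)) (UNIV \<times> UNIV)"
    by (rule locfin_mult) (intro locfin_ent locfin_mult_right)+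
  have "?L = mfps_sum (\<lambda>b. mfps_sum (\<lambda>a. ent M S a * (ent N a b * g b)) UNIV) UNIV"
    by (simp add: mfps_sum_cmult_right[symmetric] locfin_ent locfin_mult_right mult.assoc)
  also have "\<dots> = mfps_sum (\<lambda>a. mfps_sum (\<lambda>b. ent M S a * (ent N a b * g b)) UNIV) UNIV"
    by (rule mfps_sum_swap[OF 2, symmetric])
  also have "\<dots> = ?R"
    by (simp add: mfps_sum_cmult locfin_ent locfin_mult_right)
  finally show ?thesis .
qed

instantiation lop :: (type, type, comm_ring_1) ring_1
begin

definition "0 = Lop (\<lambda>_ _. 0)"
definition "1 = Lop (\<lambda>S T. if S = T then 1 else 0)"
definition "M + N = Lop (\<lambda>S T. ent M S T + ent N S T)"
definition "M - N = Lop (\<lambda>S T. ent M S T - ent N S T)"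
definition "- M = Lop (\<lambda>S T. - ent M S T)"
definition "M * N = Lop (\<lambda>S U. mfps_sum (\<lambda>T. ent M S T * ent N T U) UNIV)"

lemma ent_zero [simp]: "ent 0 S T = 0"
  unfolding zero_lop_def by (subst ent_Lop) (auto simp: locfin_def)

lemma ent_one: "ent 1 S T = (if S = T then 1 else 0)"
  unfolding one_lop_def by (subst ent_Lop) (auto intro!: locfin_support)

lemma ent_add [simp]: "ent (M + N) S T = ent M S T + ent N S T"
  unfolding plus_lop_def by (subst ent_Lop) (auto intro!: locfin_add locfin_ent)

lemma ent_uminus [simp]: "ent (- M) S T = - ent M S T"
  unfolding uminus_lop_def by (subst ent_Lop) (auto simp: locfin_uminus locfin_ent)

lemma ent_diff [simp]: "ent (M - N) S T = ent M S T - ent N S T"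
proof -
  have "locfin (\<lambda>T. ent M S T + - ent N S T) UNIV" for S
    by (intro locfin_add locfin_ent) (simp add: locfin_uminus locfin_ent)
  thus ?thesis unfolding minus_lop_def by (subst ent_Lop) auto
qed

lemma ent_mult: "ent (M * N) S U = mfps_sum (\<lambda>T. ent M S T * ent N T U) UNIV"
  unfolding times_lop_def
proof (subst ent_Lop)
  fix S :: 'a
  have "locfin (\<lambda>(a, b). ent M S a * ent N a b) (UNIV \<times> UNIV)"
    by (rule locfin_mult) (rule locfin_ent)+
  from locfin_Sigma_outer[OF locfin_swap[OF this]]
  show "locfin (\<lambda>U. mfps_sum (\<lambda>T. ent M S T * ent N T U) UNIV) UNIV" .
qed simp

instance
proof
  fix L M N :: "('a, 'b, 'c) lop"
  show "L + M + N = L + (M + N)" "L + M = M + L" "0 + L = L" "- L + L = 0" "L - M = L + - M"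
    by (auto intro!: lop_eqI)
  show "L * M * N = L * (M * N)"
    by (rule lop_eqI) (simp add: ent_mult mfps_sum_mult_assoc)
  show "(L + M) * N = L * N + M * N" "L * (M + N) = L * M + L * N"
    by (rule lop_eqI; simp add: ent_mult distrib_right distrib_left mfps_sum_add locfin_ent locfin_mult_right)+
  show "1 * L = L"
  proof (rule lop_eqI)
    fix S T
    show "ent (1 * L) S T = ent L S T"
      unfolding ent_mult by (subst mfps_sum_single[of S]) (auto simp: ent_one)
  qed
  show "L * 1 = L"
  proof (rule lop_eqI)
    fix S T
    show "ent (L * 1) S T = ent L S T"
      unfolding ent_mult by (subst mfps_sum_single[of T]) (auto simp: ent_one)
  qed
  show "(0 :: ('a, 'b, 'c) lop) \<noteq> 1"
  proof
    assume "(0 :: ('a, 'b, 'c) lop) = 1"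
    hence "ent (0 :: ('a, 'b, 'c) lop) undefined undefined = ent 1 undefined undefined" by simp
    thus False by (simp add: ent_one)
  qed
qed

end

lemma ent_sum: "ent (sum f A) S T = (\<Sum>i\<in>A. ent (f i) S T)"
  by (induction A rule: infinite_finite_induct) auto

text \<open>Rows index the output: \<open>ent M S T\<close> is the coefficient of v_S in the image
  of v_T (\<open>appl_basis\<close>).\<close>

definition appl :: "('i, 'v, 'a::comm_ring_1) lop \<Rightarrow> ('i \<Rightarrow> ('v, 'a) mfps) \<Rightarrow> 'i \<Rightarrow> ('v, 'a) mfps" where
  "appl M f S = mfps_sum (\<lambda>T. ent M S T * f T) UNIV"

lemma appl_mult: "appl (M * N) f = appl M (appl N f)"
  by (rule ext) (simp add: appl_def ent_mult mfps_sum_mult_assoc)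

lemma appl_one [simp]: "appl 1 f = f"
proof
  fix S show "appl 1 f S = f S"
    unfolding appl_def by (subst mfps_sum_single[of S]) (auto simp: ent_one)
qed

lemma appl_power: "appl (M ^ n) f = (appl M ^^ n) f"
  by (induction n) (auto simp: appl_mult)

lemma appl_basis: "appl M (\<lambda>S'. if S' = T then 1 else 0) S = ent M S T"
  unfolding appl_def by (subst mfps_sum_single[of T]) auto

definition scal :: "('v, 'a::comm_ring_1) mfps \<Rightarrow> ('i, 'v, 'a) lop" where
  "scal c = Lop (\<lambda>S T. if S = T then c else 0)"

lemma ent_scal: "ent (scal c) S T = (if S = T then c else 0)"
  unfolding scal_def by (subst ent_Lop) (auto intro!: locfin_support)

lemma ent_scal_mult [simp]: "ent (scal c * M) S T = c * ent M S T"
  unfolding ent_mult by (subst mfps_sum_single[of S]) (auto simp: ent_scal)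

lemma ent_mult_scal [simp]: "ent (M * scal c) S T = c * ent M S T"
  unfolding ent_mult by (subst mfps_sum_single[of T]) (auto simp: ent_scal)

lemma scal_commute: "M * scal c = scal c * M" by (rule lop_eqI) simp
lemma scal_mult: "scal (a * b) = scal a * scal b" by (rule lop_eqI) (simp add: ent_scal)
lemma scal_add: "scal (a + b) = scal a + scal b" by (rule lop_eqI) (simp add: ent_scal)
lemma scal_uminus: "scal (- a) = - scal a" by (rule lop_eqI) (simp add: ent_scal)
lemma scal_one [simp]: "scal 1 = 1" by (rule lop_eqI) (simp add: ent_scal ent_one)
lemma scal_zero [simp]: "scal 0 = 0" by (rule lop_eqI) (simp add: ent_scal)

lemma scal_left_commute: "M * (scal c * N) = scal c * (M * N)"
  by (metis mult.assoc scal_commute)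

subsection \<open>Summable families of operators\<close>

definition lop_sum :: "('k \<Rightarrow> ('i, 'v, 'a::comm_ring_1) lop) \<Rightarrow> 'k set \<Rightarrow> ('i, 'v, 'a) lop" where
  "lop_sum f I = Lop (\<lambda>S T. mfps_sum (\<lambda>i. ent (f i) S T) I)"

text \<open>Finiteness jointly in the index and the column, for each row and monomial, makes the sum
  of the family row-finite again.\<close>

definition lop_summable :: "('k \<Rightarrow> ('i, 'v, 'a::comm_ring_1) lop) \<Rightarrow> 'k set \<Rightarrow> bool" where
  "lop_summable f I \<longleftrightarrow> (\<forall>S. locfin (\<lambda>(i, T). ent (f i) S T) (I \<times> UNIV))"

lemma lop_summableD: "lop_summable f I \<Longrightarrow> locfin (\<lambda>(i, T). ent (f i) S T) (I \<times> UNIV)"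
  by (simp add: lop_summable_def)

lemma lop_summable_finite_rows:
  assumes "\<And>S. finite {i \<in> I. \<exists>T. ent (f i) S T \<noteq> 0}" shows "lop_summable f I"
  unfolding lop_summable_def
proof (intro allI locfinI)
  fix S m
  have "finite (SIGMA i:{i \<in> I. \<exists>T. ent (f i) S T \<noteq> 0}. {T. mcoeff (ent (f i) S T) m \<noteq> 0})"
    using assms locfinD[OF locfin_ent[of _ S UNIV]] by (intro finite_SigmaI) auto
  thus "finite {p \<in> I \<times> UNIV. mcoeff (case p of (i, T) \<Rightarrow> ent (f i) S T) m \<noteq> 0}"
    by (rule rev_finite_subset) (auto, metis mcoeff_zero)
qed

lemma ent_lop_sum:
  assumes "lop_summable f I"
  shows "ent (lop_sum f I) S T = mfps_sum (\<lambda>i. ent (f i) S T) I"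
  unfolding lop_sum_def
  by (subst ent_Lop) (use locfin_Sigma_outer[OF locfin_swap[OF lop_summableD[OF assms]]] in auto)

lemma locfin_ent_summable:
  assumes "lop_summable f I" shows "locfin (\<lambda>i. ent (f i) S T) I"
  using locfin_Sigma_inner[OF locfin_swap[OF lop_summableD[OF assms, of S]], of T] by simp

lemma lop_summable_finite: "finite I \<Longrightarrow> lop_summable f I"
  by (rule lop_summable_finite_rows) auto

lemma lop_sum_finite: "finite I \<Longrightarrow> lop_sum f I = sum f I"
  by (rule lop_eqI) (simp add: ent_lop_sum lop_summable_finite mfps_sum_finite ent_sum)

lemma lop_sum_cong: "I = J \<Longrightarrow> (\<And>i. i \<in> J \<Longrightarrow> f i = g i) \<Longrightarrow> lop_sum f I = lop_sum g J"
  unfolding lop_sum_def by (intro arg_cong[where f = Lop] ext mfps_sum_cong) auto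

lemma lop_summable_reindex:
  assumes "inj_on h J" "lop_summable f (h ` J)" shows "lop_summable (\<lambda>j. f (h j)) J"
  unfolding lop_summable_def
proof
  fix S
  have inj: "inj_on (\<lambda>(j, T). (h j, T :: 'c)) (J \<times> UNIV)" using assms(1) by (auto simp: inj_on_def)
  have eq: "(\<lambda>(j, T). (h j, T)) ` (J \<times> UNIV) = h ` J \<times> UNIV" by auto
  show "locfin (\<lambda>(i, T). ent (f (h i)) S T) (J \<times> UNIV)"
    using locfin_reindex[OF inj, of "\<lambda>(i, T). ent (f i) S T"] lop_summableD[OF assms(2)]
    unfolding eq by (simp add: case_prod_unfold)
qed

lemma lop_sum_bij_betw: "bij_betw h J I \<Longrightarrow> lop_sum f I = lop_sum (\<lambda>j. f (h j)) J"
  unfolding lop_sum_def by (intro arg_cong[where f = Lop] ext mfps_sum_bij_betw)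

lemma lop_summable_bij_betw: "bij_betw h J I \<Longrightarrow> lop_summable f I \<Longrightarrow> lop_summable (\<lambda>j. f (h j)) J"
  by (auto simp: bij_betw_def intro: lop_summable_reindex)

lemma lop_sum_mono_neutral:
  "J \<subseteq> I \<Longrightarrow> (\<And>i. i \<in> I - J \<Longrightarrow> f i = 0) \<Longrightarrow> lop_sum f I = lop_sum f J"
  unfolding lop_sum_def by (intro arg_cong[where f = Lop] ext mfps_sum_mono_neutral) auto

lemma lop_sum_single:
  "a \<in> I \<Longrightarrow> (\<And>i. i \<in> I \<Longrightarrow> i \<noteq> a \<Longrightarrow> f i = 0) \<Longrightarrow> lop_sum f I = f a"
  by (subst lop_sum_mono_neutral[of "{a}"]) (auto simp: lop_sum_finite)

lemma lop_summable_subset: "lop_summable f I \<Longrightarrow> J \<subseteq> I \<Longrightarrow> lop_summable f J"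
  unfolding lop_summable_def by (blast intro: locfin_subset)

lemma lop_summable_add:
  assumes "lop_summable f I" "lop_summable g I" shows "lop_summable (\<lambda>i. f i + g i) I"
  unfolding lop_summable_def
proof
  fix S
  show "locfin (\<lambda>(i, T). ent (f i + g i) S T) (I \<times> UNIV)"
    using locfin_add[OF assms[THEN lop_summableD, of S]] by (simp add: case_prod_unfold)
qed

lemma lop_sum_add:
  "lop_summable f I \<Longrightarrow> lop_summable g I \<Longrightarrow> lop_sum (\<lambda>i. f i + g i) I = lop_sum f I + lop_sum g I"
  by (rule lop_eqI) (simp add: ent_lop_sum lop_summable_add mfps_sum_add locfin_ent_summable)

lemma lop_summable_uminus: "lop_summable f I \<Longrightarrow> lop_summable (\<lambda>i. - f i) I"
  unfolding lop_summable_def by (simp add: locfin_uminus case_prod_unfold)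

lemma lop_sum_uminus: "lop_summable f I \<Longrightarrow> lop_sum (\<lambda>i. - f i) I = - lop_sum f I"
  by (rule lop_eqI) (simp add: ent_lop_sum lop_summable_uminus mfps_sum_uminus)

lemma lop_summable_diff: "lop_summable f I \<Longrightarrow> lop_summable g I \<Longrightarrow> lop_summable (\<lambda>i. f i - g i) I"
  using lop_summable_add[of f I "\<lambda>i. - g i"] by (simp add: lop_summable_uminus)

lemma lop_sum_diff:
  "lop_summable f I \<Longrightarrow> lop_summable g I \<Longrightarrow> lop_sum (\<lambda>i. f i - g i) I = lop_sum f I - lop_sum g I"
  using lop_sum_add[of f I "\<lambda>i. - g i"] by (simp add: lop_summable_uminus lop_sum_uminus)

lemma lop_summable_mult:
  assumes "lop_summable f I" "\<And>i. i \<in> I \<Longrightarrow> lop_summable (g i) (J i)"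
  shows "lop_summable (\<lambda>(i, j). f i * g i j) (Sigma I J)"
  unfolding lop_summable_def
proof (intro allI locfinI)
  fix S m
  let ?h = "\<lambda>(p, q). (\<lambda>(i, T). ent (f i) S T) p * (\<lambda>p (j, U). ent (g (fst p) j) (snd p) U) p q"
  have "locfin ?h (Sigma (I \<times> UNIV) (\<lambda>p. J (fst p) \<times> UNIV))"
    by (rule locfin_mult) (auto intro!: lop_summableD assms)
  from locfinD[OF this, of m]
  \<comment> \<open>Finitely many paths from S through T to U contribute to m; forgetting the middle
    index T leaves a finite set that covers all contributing products.\<close>
  have "finite ((\<lambda>((i, T), (j, U)). ((i, j), U)) `
      {x \<in> Sigma (I \<times> UNIV) (\<lambda>p. J (fst p) \<times> UNIV). mcoeff (?h x) m \<noteq> 0})"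
    by (rule finite_imageI)
  thus "finite {p \<in> Sigma I J \<times> UNIV. mcoeff (case p of (ij, U) \<Rightarrow> ent (case ij of (i, j) \<Rightarrow> f i * g i j) S U) m \<noteq> 0}"
  proof (rule rev_finite_subset, intro subsetI)
    fix p assume p: "p \<in> {p \<in> Sigma I J \<times> UNIV. mcoeff (case p of (ij, U) \<Rightarrow> ent (case ij of (i, j) \<Rightarrow> f i * g i j) S U) m \<noteq> 0}"
    obtain i j U where "p = ((i, j), U)" by (metis surj_pair)
    with p have ij: "p = ((i, j), U)" "i \<in> I" "j \<in> J i" "mcoeff (ent (f i * g i j) S U) m \<noteq> 0" by auto
    then obtain T where "mcoeff (ent (f i) S T * ent (g i j) T U) m \<noteq> 0"
      unfolding ent_mult using mcoeff_mfps_sum_nonzeroD by blast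
    hence "((i, T), (j, U)) \<in> {x \<in> Sigma (I \<times> UNIV) (\<lambda>p. J (fst p) \<times> UNIV). mcoeff (?h x) m \<noteq> 0}"
      using ij by auto
    thus "p \<in> (\<lambda>((i, T), (j, U)). ((i, j), U)) `
      {x \<in> Sigma (I \<times> UNIV) (\<lambda>p. J (fst p) \<times> UNIV). mcoeff (?h x) m \<noteq> 0}"
      unfolding ij(1) by (rule rev_image_eqI) simp
  qed
qed

lemma lop_summable_left: "lop_summable f I \<Longrightarrow> lop_summable (\<lambda>i. M * f i) I"
proof -
  assume "lop_summable f I"
  hence *: "lop_summable (\<lambda>(u, i). M * f i) ({()} \<times> I)"
    by (intro lop_summable_mult) (auto simp: lop_summable_finite)
  have "bij_betw (\<lambda>i. ((), i)) I ({()} \<times> I)" by (auto simp: bij_betw_def inj_on_def)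
  from lop_summable_bij_betw[OF this *] show ?thesis by simp
qed

lemma lop_summable_right: "lop_summable f I \<Longrightarrow> lop_summable (\<lambda>i. f i * M) I"
proof -
  assume "lop_summable f I"
  hence *: "lop_summable (\<lambda>(i, u). f i * M) (I \<times> {()})"
    by (intro lop_summable_mult) (auto simp: lop_summable_finite)
  have "bij_betw (\<lambda>i. (i, ())) I (I \<times> {()})" by (auto simp: bij_betw_def inj_on_def)
  from lop_summable_bij_betw[OF this *] show ?thesis by simp
qed

lemma lop_sum_right:
  assumes "lop_summable f I" shows "lop_sum f I * M = lop_sum (\<lambda>i. f i * M) I"
proof (rule lop_eqI)
  fix S U
  have 1: "locfin (\<lambda>(T, i). ent (f i) S T * ent M T U) (UNIV \<times> I)"
    using locfin_mult_right[OF locfin_swap[OF lop_summableD[OF assms, of S]], of "\<lambda>(T, i). ent M T U"]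
    by (simp add: case_prod_unfold)
  have "ent (lop_sum f I * M) S U = mfps_sum (\<lambda>T. mfps_sum (\<lambda>i. ent (f i) S T * ent M T U) I) UNIV"
    by (simp add: ent_mult ent_lop_sum assms mfps_sum_cmult_right[symmetric] locfin_ent_summable)
  also have "\<dots> = mfps_sum (\<lambda>i. mfps_sum (\<lambda>T. ent (f i) S T * ent M T U) UNIV) I"
    by (rule mfps_sum_swap[OF 1])
  finally show "ent (lop_sum f I * M) S U = ent (lop_sum (\<lambda>i. f i * M) I) S U"
    by (simp add: ent_lop_sum lop_summable_right assms ent_mult)
qed

lemma lop_sum_left:
  assumes "lop_summable f I" shows "M * lop_sum f I = lop_sum (\<lambda>i. M * f i) I"
proof (rule lop_eqI)
  fix S U
  have 1: "locfin (\<lambda>(T, i). ent M S T * ent (f i) T U) (UNIV \<times> I)"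
    by (rule locfin_mult) (intro locfin_ent locfin_ent_summable assms)+
  have "ent (M * lop_sum f I) S U = mfps_sum (\<lambda>T. mfps_sum (\<lambda>i. ent M S T * ent (f i) T U) I) UNIV"
    by (simp add: ent_mult ent_lop_sum assms mfps_sum_cmult[symmetric] locfin_ent_summable)
  also have "\<dots> = mfps_sum (\<lambda>i. mfps_sum (\<lambda>T. ent M S T * ent (f i) T U) UNIV) I"
    by (rule mfps_sum_swap[OF 1])
  finally show "ent (M * lop_sum f I) S U = ent (lop_sum (\<lambda>i. M * f i) I) S U"
    by (simp add: ent_lop_sum lop_summable_left assms ent_mult)
qed

lemma lop_summable_inner:
  assumes "lop_summable (\<lambda>(i, j). f i j) (Sigma I J)" "i \<in> I"
  shows "lop_summable (f i) (J i)"
proof -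
  have "lop_summable (\<lambda>(i, j). f i j) (Pair i ` J i)"
    by (rule lop_summable_subset[OF assms(1)]) (use assms(2) in auto)
  from lop_summable_reindex[OF _ this] show ?thesis by (simp add: inj_on_def)
qed

lemma lop_sum_Sigma:
  assumes "lop_summable (\<lambda>(i, j). f i j) (Sigma I J)"
  shows "lop_summable (\<lambda>i. lop_sum (f i) (J i)) I"
    and "lop_sum (\<lambda>i. lop_sum (f i) (J i)) I = lop_sum (\<lambda>(i, j). f i j) (Sigma I J)"
proof -
  show *: "lop_summable (\<lambda>i. lop_sum (f i) (J i)) I"
    unfolding lop_summable_def
  proof (intro allI locfinI)
    fix S m
    have "finite ((\<lambda>((i, j), T). (i, T)) ` {p \<in> Sigma I J \<times> UNIV. mcoeff (case p of (ij, T) \<Rightarrow> ent (case ij of (i, j) \<Rightarrow> f i j) S T) m \<noteq> 0})"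
      by (rule finite_imageI, rule locfinD[OF lop_summableD[OF assms]])
    thus "finite {p \<in> I \<times> UNIV. mcoeff (case p of (i, T) \<Rightarrow> ent (lop_sum (f i) (J i)) S T) m \<noteq> 0}"
    proof (rule rev_finite_subset, intro subsetI)
      fix p assume p: "p \<in> {p \<in> I \<times> UNIV. mcoeff (case p of (i, T) \<Rightarrow> ent (lop_sum (f i) (J i)) S T) m \<noteq> 0}"
      obtain i T where i: "p = (i, T)" by (metis surj_pair)
      with p have iI: "i \<in> I" and "mcoeff (ent (lop_sum (f i) (J i)) S T) m \<noteq> 0" by auto
      then obtain j where "j \<in> J i" "mcoeff (ent (f i j) S T) m \<noteq> 0"
        by (subst (asm) ent_lop_sum[OF lop_summable_inner[OF assms]]) (auto dest: mcoeff_mfps_sum_nonzeroD)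
      thus "p \<in> (\<lambda>((i, j), T). (i, T)) ` {p \<in> Sigma I J \<times> UNIV. mcoeff (case p of (ij, T) \<Rightarrow> ent (case ij of (i, j) \<Rightarrow> f i j) S T) m \<noteq> 0}"
        using iI i by (intro image_eqI[of _ _ "((i, j), T)"]) auto
    qed
  qed
  show "lop_sum (\<lambda>i. lop_sum (f i) (J i)) I = lop_sum (\<lambda>(i, j). f i j) (Sigma I J)"
  proof (rule lop_eqI)
    fix S T
    have "ent (lop_sum (\<lambda>i. lop_sum (f i) (J i)) I) S T = mfps_sum (\<lambda>i. mfps_sum (\<lambda>j. ent (f i j) S T) (J i)) I"
      unfolding ent_lop_sum[OF *]
      by (rule mfps_sum_cong[OF refl]) (simp add: ent_lop_sum lop_summable_inner[OF assms])
    also have "\<dots> = mfps_sum (\<lambda>(i, j). ent (f i j) S T) (Sigma I J)"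
      by (rule mfps_sum_Sigma) (use locfin_ent_summable[OF assms, of S T] in \<open>simp add: case_prod_unfold\<close>)
    finally show "ent (lop_sum (\<lambda>i. lop_sum (f i) (J i)) I) S T = ent (lop_sum (\<lambda>(i, j). f i j) (Sigma I J)) S T"
      unfolding ent_lop_sum[OF assms] by (simp add: case_prod_unfold)
  qed
qed

lemma lop_sum_mult:
  assumes "lop_summable f I" "lop_summable g J"
  shows "lop_sum f I * lop_sum g J = lop_sum (\<lambda>(i, j). f i * g j) (I \<times> J)"
proof -
  have "lop_sum f I * lop_sum g J = lop_sum (\<lambda>i. f i * lop_sum g J) I"
    by (rule lop_sum_right[OF assms(1)])
  also have "\<dots> = lop_sum (\<lambda>i. lop_sum (\<lambda>j. f i * g j) J) I"
    by (simp add: lop_sum_left assms(2))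
  also have "\<dots> = lop_sum (\<lambda>(i, j). f i * g j) (I \<times> J)"
    by (rule lop_sum_Sigma(2)[OF lop_summable_mult]) (use assms in auto)
  finally show ?thesis .
qed

section \<open>Order of vanishing and exponentials\<close>

text \<open>The restriction to V expresses vanishing when chosen variables are set to zero: all of
  them for convergence, a single one for the differential equation in \<open>one_var_cre\<close>,
  and those of index at least N for the limit of infinitely many variables.\<close>

definition degv :: "'v set \<Rightarrow> ('v \<Rightarrow>\<^sub>0 nat) \<Rightarrow> nat" where
  "degv V m = (\<Sum>v\<in>Poly_Mapping.keys m \<inter> V. Poly_Mapping.lookup m v)"

lemma degv_superset:
  "finite K \<Longrightarrow> Poly_Mapping.keys m \<subseteq> K \<Longrightarrow> degv V m = (\<Sum>v\<in>K \<inter> V. Poly_Mapping.lookup m v)"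
  unfolding degv_def by (rule sum.mono_neutral_left) (auto simp: in_keys_iff)

lemma degv_add: "degv V (p + q) = degv V p + degv V q"
proof -
  let ?K = "Poly_Mapping.keys p \<union> Poly_Mapping.keys q"
  have "degv V m = (\<Sum>v\<in>?K \<inter> V. Poly_Mapping.lookup m v)" if "Poly_Mapping.keys m \<subseteq> ?K" for m
    using that by (intro degv_superset) auto
  thus ?thesis using Poly_Mapping.keys_add[of p q]
    by (simp add: lookup_add sum.distrib)
qed

lemma degv_zero [simp]: "degv V 0 = 0" by (simp add: degv_def)

lemma degv_single: "degv V (Poly_Mapping.single v k) = (if v \<in> V then k else 0)"
  by (auto simp: degv_def)

lemma degv_UNIV: "degv V m \<le> degv UNIV m"
  unfolding degv_def by (rule sum_mono2) auto

definition ord_ge :: "'v set \<Rightarrow> nat \<Rightarrow> ('v, 'a::zero) mfps \<Rightarrow> bool" where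
  "ord_ge V d f \<longleftrightarrow> (\<forall>m. mcoeff f m \<noteq> 0 \<longrightarrow> d \<le> degv V m)"

lemma ord_geD: "ord_ge V d f \<Longrightarrow> mcoeff f m \<noteq> 0 \<Longrightarrow> d \<le> degv V m" by (simp add: ord_ge_def)
lemma ord_ge_0 [simp]: "ord_ge V 0 f" by (simp add: ord_ge_def)
lemma ord_ge_zero [simp]: "ord_ge V d 0" by (simp add: ord_ge_def)
lemma ord_ge_mono: "ord_ge V d f \<Longrightarrow> e \<le> d \<Longrightarrow> ord_ge V e f" by (force simp: ord_ge_def)
lemma ord_ge_UNIV: "ord_ge V d f \<Longrightarrow> ord_ge UNIV d f"
  unfolding ord_ge_def using degv_UNIV order_trans by blast
lemma ord_ge_uminus: "ord_ge V d f \<Longrightarrow> ord_ge V d (- f :: (_, 'a::comm_ring_1) mfps)" by (simp add: ord_ge_def)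
lemma ord_ge_add: "ord_ge V d f \<Longrightarrow> ord_ge V d g \<Longrightarrow> ord_ge V d (f + g :: (_, 'a::comm_ring_1) mfps)"
  unfolding ord_ge_def by (metis add_0 mcoeff_add)
lemma ord_ge_mult:
  "ord_ge V d f \<Longrightarrow> ord_ge V e g \<Longrightarrow> ord_ge V (d + e) (f * g :: (_, 'a::comm_ring_1) mfps)"
  unfolding ord_ge_def
  by (auto dest!: mcoeff_mult_nonzeroD simp: degv_add intro!: add_mono)
lemma ord_ge_power: "ord_ge V d f \<Longrightarrow> ord_ge V (d * n) (f ^ n :: (_, 'a::comm_ring_1) mfps)"
  by (induction n) (auto intro: ord_ge_mult)
lemma ord_ge_mfps_sum: "(\<And>i. i \<in> A \<Longrightarrow> ord_ge V d (f i)) \<Longrightarrow> ord_ge V d (mfps_sum f A)"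
  unfolding ord_ge_def by (auto dest!: mcoeff_mfps_sum_nonzeroD)

definition op_ord :: "'v set \<Rightarrow> nat \<Rightarrow> ('i, 'v, 'a::comm_ring_1) lop \<Rightarrow> bool" where
  "op_ord V d M \<longleftrightarrow> (\<forall>S T. ord_ge V d (ent M S T))"

lemma op_ordD: "op_ord V d M \<Longrightarrow> ord_ge V d (ent M S T)" by (simp add: op_ord_def)
lemma op_ord_0 [simp]: "op_ord V 0 M" by (simp add: op_ord_def)
lemma op_ord_mono: "op_ord V d M \<Longrightarrow> e \<le> d \<Longrightarrow> op_ord V e M" by (auto simp: op_ord_def intro: ord_ge_mono)
lemma op_ord_UNIV: "op_ord V d M \<Longrightarrow> op_ord UNIV d M" by (auto simp: op_ord_def intro: ord_ge_UNIV)
lemma op_ord_uminus: "op_ord V d M \<Longrightarrow> op_ord V d (- M)" by (simp add: op_ord_def ord_ge_uminus)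
lemma op_ord_add: "op_ord V d M \<Longrightarrow> op_ord V d N \<Longrightarrow> op_ord V d (M + N)"
  by (simp add: op_ord_def ord_ge_add)
lemma op_ord_diff: "op_ord V d M \<Longrightarrow> op_ord V d N \<Longrightarrow> op_ord V d (M - N)"
  using op_ord_add[of V d M "- N"] op_ord_uminus[of V d N] by simp
lemma op_ord_mult: "op_ord V d M \<Longrightarrow> op_ord V e N \<Longrightarrow> op_ord V (d + e) (M * N)"
  unfolding op_ord_def ent_mult by (blast intro: ord_ge_mfps_sum ord_ge_mult)
lemma op_ord_left: "op_ord V e N \<Longrightarrow> op_ord V e (M * N)"
  using op_ord_mult[of V 0 M e N] by simp
lemma op_ord_right: "op_ord V e M \<Longrightarrow> op_ord V e (M * N)"
  using op_ord_mult[of V e M 0 N] by simp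
lemma op_ord_power: "op_ord V d M \<Longrightarrow> op_ord V (d * n) (M ^ n)"
  by (induction n) (auto intro: op_ord_mult)
lemma op_ord_scal: "ord_ge V d c \<Longrightarrow> op_ord V d (scal c)"
  by (simp add: op_ord_def ent_scal)
lemma op_ord_lop_sum: "lop_summable f I \<Longrightarrow> (\<And>i. i \<in> I \<Longrightarrow> op_ord V d (f i)) \<Longrightarrow> op_ord V d (lop_sum f I)"
  unfolding op_ord_def by (auto simp: ent_lop_sum intro!: ord_ge_mfps_sum)

text \<open>A monomial of total degree d is reached only by the terms with index at most d.\<close>

lemma lop_summable_ord:
  assumes "\<And>i::nat. i \<in> I \<Longrightarrow> op_ord UNIV i (f i)" shows "lop_summable f I"
  unfolding lop_summable_def
proof (intro allI locfinI)
  fix S m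
  have "finite (SIGMA i:{..degv UNIV m}. {T. mcoeff (ent (f i) S T) m \<noteq> 0})"
    using locfinD[OF locfin_ent[of _ S UNIV]] by (intro finite_SigmaI) auto
  thus "finite {p \<in> I \<times> UNIV. mcoeff (case p of (i, T) \<Rightarrow> ent (f i) S T) m \<noteq> 0}"
    by (rule rev_finite_subset) (auto dest!: ord_geD[OF op_ordD[OF assms]])
qed

lemma mcoeff_const_mult [simp]: "mcoeff (mfps_const c * f) m = c * mcoeff (f :: ('v, 'a::comm_ring_1) mfps) m"
proof -
  have "mcoeff (mfps_const c * f) m = (\<Sum>(p, q)\<in>{(0, m)}. mcoeff (mfps_const c :: ('v, 'a) mfps) p * mcoeff f q)"
    unfolding mcoeff_mult
    by (rule sum.mono_neutral_right) (auto simp: mcoeff_const finite_monomial_decomp split: if_splits)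
  thus ?thesis by (simp add: mcoeff_const)
qed

lemma mfps_const_mult: "mfps_const (a * b) = mfps_const a * (mfps_const b :: ('v, 'a::comm_ring_1) mfps)"
  by (rule mfps_eqI) (simp add: mcoeff_const)
lemma mfps_const_one [simp]: "mfps_const 1 = (1 :: ('v, 'a::comm_ring_1) mfps)"
  by (rule mfps_eqI) (simp add: mcoeff_const mcoeff_one)
lemma mfps_const_add: "mfps_const (a + b) = mfps_const a + (mfps_const b :: ('v, 'a::comm_ring_1) mfps)"
  by (rule mfps_eqI) (simp add: mcoeff_const)
lemma mfps_const_zero [simp]: "mfps_const 0 = (0 :: ('v, 'a::comm_ring_1) mfps)"
  by (rule mfps_eqI) (simp add: mcoeff_const)
lemma mfps_of_nat: "of_nat n = (mfps_const (of_nat n) :: ('v, 'a::comm_ring_1) mfps)"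
  by (induction n) (auto simp: mfps_const_add)

definition cs :: "'a::comm_ring_1 \<Rightarrow> ('i, 'v, 'a) lop" where "cs c = scal (mfps_const c)"

lemma cs_mult: "cs (a * b) = cs a * cs b" by (simp add: cs_def mfps_const_mult scal_mult)
lemma cs_mult_mult: "cs a * (cs b * M) = cs (a * b) * M" by (simp add: cs_mult mult.assoc)
lemma cs_add: "cs (a + b) = cs a + cs b" by (simp add: cs_def mfps_const_add scal_add)
lemma cs_one [simp]: "cs 1 = 1" by (simp add: cs_def)
lemma cs_zero [simp]: "cs 0 = 0" by (simp add: cs_def)
lemma cs_of_nat: "of_nat n = cs (of_nat n)"
  by (induction n) (auto simp: cs_add)
lemma cs_left_commute: "M * (cs c * N) = cs c * (M * N)" by (simp add: cs_def scal_left_commute)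
lemma ent_cs_mult [simp]: "ent (cs c * M) S T = mfps_const c * ent M S T" by (simp add: cs_def)

subsection \<open>The exponential of an operator of positive order\<close>

definition exp_term :: "('i, 'v, 'a::field_char_0) lop \<Rightarrow> nat \<Rightarrow> ('i, 'v, 'a) lop" where
  "exp_term A j = cs (1 / fact j) * A ^ j"

definition lexp :: "('i, 'v, 'a::field_char_0) lop \<Rightarrow> ('i, 'v, 'a) lop" where
  "lexp A = lop_sum (exp_term A) UNIV"

lemma op_ord_exp_term: "op_ord V (Suc 0) A \<Longrightarrow> op_ord V j (exp_term A j)"
  unfolding exp_term_def by (rule op_ord_left) (use op_ord_power[of V "Suc 0" A j] in simp)

lemma summable_exp_term: "op_ord UNIV (Suc 0) A \<Longrightarrow> lop_summable (exp_term A) I"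
  by (rule lop_summable_ord) (rule op_ord_exp_term)

lemma exp_term_0 [simp]: "exp_term A 0 = 1" by (simp add: exp_term_def)

lemma exp_term_Suc: "of_nat (Suc n) * exp_term A (Suc n) = A * exp_term A n"
proof -
  have "of_nat (Suc n) * exp_term A (Suc n) = cs (of_nat (Suc n) * (1 / fact (Suc n))) * A ^ Suc n"
    unfolding cs_of_nat exp_term_def cs_mult_mult ..
  also have "of_nat (Suc n) * (1 / fact (Suc n)) = (1 / fact n :: 'c)"
    by (simp add: field_simps del: of_nat_Suc)
  finally show ?thesis by (simp add: exp_term_def cs_left_commute)
qed

lemma of_nat_mult_left_commute: "M * (of_nat n * N) = of_nat n * (M * N)" for M :: "'r::ring_1"
  by (metis mult.assoc mult_of_nat_commute)

lemma of_nat_mult_cancel: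
  fixes M N :: "('i, 'v, 'a::field_char_0) lop"
  assumes "of_nat (Suc n) * M = of_nat (Suc n) * N" shows "M = N"
proof -
  have "cs (1 / of_nat (Suc n)) * (of_nat (Suc n) * M) = M" for M :: "('i, 'v, 'a) lop"
    unfolding cs_of_nat cs_mult_mult by (simp del: of_nat_Suc)
  thus ?thesis using assms by metis
qed

text \<open>The binomial theorem for divided powers. In the induction step A contributes the factor
  i and B the factor n + 1 - i to the i-th product; their sum n + 1 is cancelled, which uses
  characteristic 0.\<close>

lemma exp_term_add:
  assumes comm: "A * B = B * A"
  shows "exp_term (A + B) n = (\<Sum>i\<le>n. exp_term A i * exp_term B (n - i))"
proof (induction n)
  case (Suc n)
  have AB: "exp_term A i * B = B * exp_term A i" for i
    unfolding exp_term_def by (metis comm power_commuting_commutes mult.assoc cs_left_commute)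
  let ?t = "\<lambda>i. exp_term A i * exp_term B (Suc n - i)"
  have "of_nat (Suc n) * exp_term (A + B) (Suc n) = (A + B) * (\<Sum>i\<le>n. exp_term A i * exp_term B (n - i))"
    by (simp only: exp_term_Suc Suc.IH)
  also have "\<dots> = (\<Sum>i\<le>n. A * exp_term A i * exp_term B (n - i)) + (\<Sum>i\<le>n. exp_term A i * (B * exp_term B (n - i)))"
    by (simp add: distrib_right sum_distrib_left mult.assoc[symmetric] AB sum.distrib)
  also have "(\<Sum>i\<le>n. A * exp_term A i * exp_term B (n - i)) = (\<Sum>i\<le>n. of_nat (Suc i) * ?t (Suc i))"
    by (simp add: exp_term_Suc[symmetric] mult.assoc del: of_nat_Suc)
  also have "\<dots> = (\<Sum>i\<le>Suc n. of_nat i * ?t i)"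
    by (subst sum.atMost_Suc_shift) (simp del: of_nat_Suc)
  also have "(\<Sum>i\<le>n. exp_term A i * (B * exp_term B (n - i))) = (\<Sum>i\<le>n. of_nat (Suc n - i) * ?t i)"
    by (rule sum.cong[OF refl]) (simp add: exp_term_Suc[symmetric] Suc_diff_le of_nat_mult_left_commute del: of_nat_Suc)
  also have "\<dots> = (\<Sum>i\<le>Suc n. of_nat (Suc n - i) * ?t i)"
    by simp
  also have "(\<Sum>i\<le>Suc n. of_nat i * ?t i) + (\<Sum>i\<le>Suc n. of_nat (Suc n - i) * ?t i) = (\<Sum>i\<le>Suc n. of_nat (Suc n) * ?t i)"
    unfolding sum.distrib[symmetric] distrib_right[symmetric] of_nat_add[symmetric]
    by (rule sum.cong) auto
  finally have "of_nat (Suc n) * exp_term (A + B) (Suc n) = of_nat (Suc n) * (\<Sum>i\<le>Suc n. ?t i)"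
    by (simp only: sum_distrib_left)
  thus ?case by (rule of_nat_mult_cancel)
qed simp

lemma lexp_add:
  assumes "A * B = B * A" "op_ord UNIV (Suc 0) A" "op_ord UNIV (Suc 0) B"
  shows "lexp (A + B) = lexp A * lexp B"
proof -
  have s: "lop_summable (\<lambda>(i, j). exp_term A i * exp_term B j) (UNIV \<times> UNIV)"
    by (rule lop_summable_mult) (intro summable_exp_term assms)+
  have bij: "bij_betw (\<lambda>(n, i). (i, n - i)) (Sigma UNIV (\<lambda>n. {..n})) (UNIV \<times> (UNIV :: nat set))"
    by (rule bij_betwI[where g = "\<lambda>(i, j). (i + j, i)"]) auto
  have s': "lop_summable (\<lambda>(n, i). exp_term A i * exp_term B (n - i)) (Sigma UNIV (\<lambda>n. {..n}))"
    using lop_summable_bij_betw[OF bij s] by (simp add: case_prod_unfold)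
  have "lexp A * lexp B = lop_sum (\<lambda>(i, j). exp_term A i * exp_term B j) (UNIV \<times> UNIV)"
    unfolding lexp_def by (intro lop_sum_mult summable_exp_term assms)
  also have "\<dots> = lop_sum (\<lambda>(n, i). exp_term A i * exp_term B (n - i)) (Sigma UNIV (\<lambda>n. {..n}))"
    unfolding lop_sum_bij_betw[OF bij] by (simp add: case_prod_unfold)
  also have "\<dots> = lop_sum (\<lambda>n. lop_sum (\<lambda>i. exp_term A i * exp_term B (n - i)) {..n}) UNIV"
    by (rule lop_sum_Sigma(2)[OF s', symmetric])
  also have "\<dots> = lexp (A + B)"
    unfolding lexp_def by (rule lop_sum_cong) (simp_all add: lop_sum_finite exp_term_add assms)
  finally show ?thesis by simp
qed

lemma lexp_zero [simp]: "lexp 0 = 1"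
  unfolding lexp_def by (subst lop_sum_single[of 0]) (auto simp: exp_term_def power_0_left)

lemma lexp_minus:
  assumes "op_ord UNIV (Suc 0) A" shows "lexp A * lexp (- A) = 1" "lexp (- A) * lexp A = 1"
  using lexp_add[of A "- A"] lexp_add[of "- A" A] assms by (simp_all add: op_ord_uminus)

text \<open>The intertwiner \<open>T\<close> may be singular, so this also applies to the Casimir
  operator.\<close>

lemma lexp_intertwine:
  assumes "A * T = T * B" "op_ord UNIV (Suc 0) A" "op_ord UNIV (Suc 0) B"
  shows "lexp A * T = T * lexp B"
proof -
  have pow: "A ^ j * T = T * B ^ j" for j
  proof (induction j)
    case (Suc j)
    have "A ^ Suc j * T = A * (A ^ j * T)" by (simp add: mult.assoc)
    also have "\<dots> = (A * T) * B ^ j" by (simp add: Suc mult.assoc)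
    finally show ?case by (simp add: assms mult.assoc)
  qed simp
  have "exp_term A j * T = T * exp_term B j" for j
    by (simp add: exp_term_def mult.assoc pow cs_left_commute)
  thus ?thesis unfolding lexp_def
    by (subst lop_sum_left lop_sum_right; simp add: summable_exp_term assms)+
qed

lemma lexp_scal:
  assumes "ord_ge UNIV (Suc 0) c" shows "\<exists>e. lexp (scal c :: ('i, 'v, 'a::field_char_0) lop) = scal e"
proof -
  have "scal c ^ j = (scal (c ^ j) :: ('i, 'v, 'a) lop)" for j
    by (induction j) (auto simp: scal_mult)
  hence *: "exp_term (scal c) j = (scal (mfps_const (1 / fact j) * c ^ j) :: ('i, 'v, 'a) lop)" for j
    by (simp add: exp_term_def cs_def scal_mult)
  have "lexp (scal c) = (scal (mfps_sum (\<lambda>j. mfps_const (1 / fact j) * c ^ j) UNIV) :: ('i, 'v, 'a) lop)"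
    unfolding lexp_def
    by (rule lop_eqI) (simp add: ent_lop_sum[OF summable_exp_term[OF op_ord_scal[OF assms]]] * ent_scal)
  thus ?thesis by blast
qed

text \<open>The termwise derivative of the exponential series in the direction \<open>C\<close>. At
  j = 0 the factor \<open>of_nat j\<close> cancels the truncated exponent
  \<open>0 - Suc 0\<close>.\<close>

lemma lexp_shift:
  assumes "op_ord UNIV (Suc 0) B"
  shows "lop_summable (\<lambda>j. cs (1 / fact j) * (of_nat j * (C * B ^ (j - Suc 0)))) UNIV"
    and "lop_sum (\<lambda>j. cs (1 / fact j) * (of_nat j * (C * B ^ (j - Suc 0)))) UNIV = C * lexp B"
proof -
  let ?f = "\<lambda>j. cs (1 / fact j) * (of_nat j * (C * B ^ (j - Suc 0)))"
  have "op_ord UNIV (j - Suc 0) (?f j)" for j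
    by (intro op_ord_left) (use op_ord_power[OF assms, of "j - Suc 0"] in simp)
  note ord = this
  show "lop_summable ?f UNIV"
    unfolding lop_summable_def
  proof (intro allI locfinI)
    fix S m
    \<comment> \<open>The j-th term has order only j - 1, so the index may exceed the degree by
      one.\<close>
    have "finite (SIGMA i:{..degv UNIV m + 1}. {T. mcoeff (ent (?f i) S T) m \<noteq> 0})"
      using locfinD[OF locfin_ent[of _ S UNIV]] by (intro finite_SigmaI) auto
    thus "finite {p \<in> UNIV \<times> UNIV. mcoeff (case p of (i, T) \<Rightarrow> ent (?f i) S T) m \<noteq> 0}"
    proof (rule rev_finite_subset, intro subsetI)
      fix p assume p: "p \<in> {p \<in> UNIV \<times> UNIV. mcoeff (case p of (i, T) \<Rightarrow> ent (?f i) S T) m \<noteq> 0}"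
      obtain i T where i: "p = (i, T)" by (metis surj_pair)
      with p have nz: "mcoeff (ent (?f i) S T) m \<noteq> 0" by simp
      from ord_geD[OF op_ordD[OF ord] this] show "p \<in> (SIGMA i:{..degv UNIV m + 1}. {T. mcoeff (ent (?f i) S T) m \<noteq> 0})"
        using i nz by simp
    qed
  qed
  have f: "?f (Suc j) = C * exp_term B j" for j
  proof -
    have "?f (Suc j) = cs ((1 / fact (Suc j)) * of_nat (Suc j)) * (C * B ^ j)"
      unfolding cs_of_nat cs_mult_mult by simp
    also have "(1 / fact (Suc j)) * of_nat (Suc j) = (1 / fact j :: 'c)"
      by (simp add: field_simps del: of_nat_Suc)
    finally show ?thesis by (simp add: exp_term_def cs_left_commute)
  qed
  have "lop_sum ?f UNIV = lop_sum ?f (UNIV - {0})"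
    by (rule lop_sum_mono_neutral) auto
  also have "\<dots> = lop_sum (\<lambda>j. ?f (Suc j)) UNIV"
    by (rule lop_sum_bij_betw, rule bij_betwI[where g = "\<lambda>j. j - 1"]) auto
  also have "\<dots> = C * lexp B"
    unfolding f lexp_def by (simp add: lop_sum_left summable_exp_term assms)
  finally show "lop_sum ?f UNIV = C * lexp B" .
qed

text \<open>Since \<open>C\<close> commutes with \<open>B\<close>, the commutator of
  \<open>A\<close> with \<open>B ^ j\<close> is j times \<open>C * B ^ (j - 1)\<close>, as for a
  derivation.\<close>

lemma lexp_commutator:
  assumes C: "A * B - B * A = C" "C * B = B * C" and B: "op_ord UNIV (Suc 0) B"
  shows "A * lexp B = lexp B * A + C * lexp B"
proof -
  have pow: "A * B ^ j = B ^ j * A + of_nat j * (C * B ^ (j - Suc 0))" for j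
  proof (induction j)
    case (Suc j)
    have CB: "C * B ^ k * B = C * B ^ Suc k" for k by (simp add: mult.assoc power_commutes)
    have "A * B ^ Suc j = (A * B ^ j) * B" by (simp add: mult.assoc power_commutes)
    also have "\<dots> = B ^ j * (A * B) + of_nat j * (C * B ^ (j - Suc 0) * B)"
      by (simp add: Suc distrib_right mult.assoc)
    also have "A * B = B * A + C" using C(1) by (simp add: algebra_simps)
    also have "of_nat j * (C * B ^ (j - Suc 0) * B) = of_nat j * (C * B ^ j)"
      by (cases j) (simp_all add: CB del: of_nat_Suc power_Suc)
    also have "B ^ j * (B * A + C) = B ^ Suc j * A + C * B ^ j"
      using power_commuting_commutes[of B C j] C(2)
      by (simp add: distrib_left mult.assoc power_commutes[symmetric])
    finally show ?case by (simp add: distrib_right)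
  qed simp
  have "A * lexp B = lop_sum (\<lambda>j. exp_term B j * A + cs (1 / fact j) * (of_nat j * (C * B ^ (j - Suc 0)))) UNIV"
    unfolding lexp_def
    by (simp add: lop_sum_left summable_exp_term B exp_term_def cs_left_commute pow distrib_left mult.assoc)
  also have "\<dots> = lop_sum (\<lambda>j. exp_term B j * A) UNIV + C * lexp B"
    by (subst lop_sum_add) (simp_all add: lexp_shift B lop_summable_right summable_exp_term)
  finally show ?thesis by (simp add: lexp_def lop_sum_right summable_exp_term B)
qed

subsection \<open>The Euler derivation\<close>

text \<open>The operator given by the sum of v d/dv over v in V. It rescales each monomial, so it
  acts coefficientwise and preserves supports.\<close>

definition euler :: "'v set \<Rightarrow> ('v, 'a::comm_ring_1) mfps \<Rightarrow> ('v, 'a) mfps" where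
  "euler V f = Mfps (\<lambda>m. of_nat (degv V m) * mcoeff f m)"

lemma mcoeff_euler [simp]: "mcoeff (euler V f) m = of_nat (degv V m) * mcoeff f m"
  by (simp add: euler_def)

lemma euler_diff: "euler V (f - g) = euler V f - euler V g"
  by (rule mfps_eqI) (simp add: right_diff_distrib)
lemma euler_zero [simp]: "euler V 0 = 0" by (rule mfps_eqI) simp
lemma euler_const_mult: "euler V (mfps_const c * f) = mfps_const c * euler V f"
  by (rule mfps_eqI) simp

lemma euler_mult: "euler V (f * g) = euler V f * g + f * euler V g"
proof (rule mfps_eqI)
  fix m
  show "mcoeff (euler V (f * g)) m = mcoeff (euler V f * g + f * euler V g) m"
    unfolding mcoeff_euler mcoeff_add mcoeff_mult sum_distrib_left sum.distrib[symmetric]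
    by (rule sum.cong) (auto simp: degv_add algebra_simps)
qed

lemma euler_mfps_sum:
  assumes "locfin f A" shows "euler V (mfps_sum f A) = mfps_sum (\<lambda>i. euler V (f i)) A"
proof (rule mfps_eqI)
  fix m
  let ?F = "{i \<in> A. mcoeff (f i) m \<noteq> 0}"
  have "mcoeff (mfps_sum (\<lambda>i. euler V (f i)) A) m = (\<Sum>i\<in>?F. mcoeff (euler V (f i)) m)"
    by (rule mcoeff_mfps_sum_superset) (use assms in \<open>auto dest: locfinD\<close>)
  thus "mcoeff (euler V (mfps_sum f A)) m = mcoeff (mfps_sum (\<lambda>i. euler V (f i)) A) m"
    by (simp add: mcoeff_mfps_sum sum_distrib_left)
qed

lemma locfin_euler: "locfin f A \<Longrightarrow> locfin (\<lambda>i. euler V (f i)) A"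
  by (erule locfin_image_dom) auto

definition leuler :: "'v set \<Rightarrow> ('i, 'v, 'a::comm_ring_1) lop \<Rightarrow> ('i, 'v, 'a) lop" where
  "leuler V M = Lop (\<lambda>S T. euler V (ent M S T))"

lemma ent_leuler [simp]: "ent (leuler V M) S T = euler V (ent M S T)"
  unfolding leuler_def by (subst ent_Lop) (auto intro!: locfin_euler locfin_ent)

lemma leuler_diff: "leuler V (M - N) = leuler V M - leuler V N" by (rule lop_eqI) (simp add: euler_diff)
lemma leuler_cs: "leuler V (cs c * M) = cs c * leuler V M" by (rule lop_eqI) (simp add: euler_const_mult)

lemma leuler_mult: "leuler V (M * N) = leuler V M * N + M * leuler V N"
proof (rule lop_eqI)
  fix S U
  have "locfin (\<lambda>T. euler V (ent M S T) * ent N T U) UNIV" "locfin (\<lambda>T. ent M S T * euler V (ent N T U)) UNIV"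
    by (intro locfin_mult_right locfin_euler locfin_ent)+
  thus "ent (leuler V (M * N)) S U = ent (leuler V M * N + M * leuler V N) S U"
    by (simp add: ent_mult euler_mfps_sum euler_mult mfps_sum_add locfin_mult_right locfin_ent)
qed

lemma leuler_scal: "leuler V (scal c) = scal (euler V c)"
  by (rule lop_eqI) (simp add: ent_scal)

lemma leuler_lop_sum:
  assumes "lop_summable f I"
  shows "lop_summable (\<lambda>i. leuler V (f i)) I" "leuler V (lop_sum f I) = lop_sum (\<lambda>i. leuler V (f i)) I"
proof -
  show *: "lop_summable (\<lambda>i. leuler V (f i)) I"
    unfolding lop_summable_def
  proof
    fix S
    show "locfin (\<lambda>(i, T). ent (leuler V (f i)) S T) (I \<times> UNIV)"
      by (rule locfin_image_dom[OF lop_summableD[OF assms, of S]]) auto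
  qed
  show "leuler V (lop_sum f I) = lop_sum (\<lambda>i. leuler V (f i)) I"
    by (rule lop_eqI) (simp add: ent_lop_sum assms * euler_mfps_sum locfin_ent_summable)
qed

text \<open>The chain rule for the exponential; it needs the derivative of \<open>B\<close> to
  commute with \<open>B\<close>, since otherwise the derivative of \<open>B ^ j\<close> does not
  collapse to one product.\<close>

lemma leuler_lexp:
  fixes B :: "('i, 'v, 'a::field_char_0) lop"
  assumes B: "op_ord UNIV (Suc 0) B" and comm: "leuler V B * B = B * leuler V B"
  shows "leuler V (lexp B) = leuler V B * lexp B"
proof -
  have one: "leuler V (1 :: ('i, 'v, 'a) lop) = 0" for V :: "'v set"
    by (rule lop_eqI, rule mfps_eqI) (auto simp: ent_one mcoeff_one)
  have pow: "leuler V (B ^ j) = of_nat j * (leuler V B * B ^ (j - Suc 0))" for j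
  proof (induction j)
    case (Suc j)
    have "leuler V (B ^ Suc j) = leuler V B * B ^ j + B * (of_nat j * (leuler V B * B ^ (j - Suc 0)))"
      by (simp add: leuler_mult Suc)
    also have "B * (of_nat j * (leuler V B * B ^ (j - Suc 0))) = of_nat j * (leuler V B * B ^ j)"
    proof (cases j)
      case (Suc k)
      have "B * (leuler V B * B ^ k) = leuler V B * B ^ Suc k"
        by (simp add: mult.assoc[symmetric] comm)
      thus ?thesis by (simp add: Suc of_nat_mult_left_commute del: of_nat_Suc)
    qed simp
    finally show ?case by (simp add: distrib_right)
  qed (simp add: one)
  have "leuler V (lexp B) = lop_sum (\<lambda>j. cs (1 / fact j) * (of_nat j * (leuler V B * B ^ (j - Suc 0)))) UNIV"
    unfolding lexp_def by (simp add: leuler_lop_sum summable_exp_term B exp_term_def leuler_cs pow)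
  thus ?thesis by (simp add: lexp_shift B)
qed

text \<open>In characteristic 0 the Euler derivation kills only the part of degree zero in V, and
  that part is absent by the order condition.\<close>

lemma leuler_zero_imp:
  fixes M :: "('i, 'v, 'a::field_char_0) lop"
  assumes "leuler V M = 0" "op_ord V (Suc 0) M" shows "M = 0"
proof (rule lop_eqI, rule mfps_eqI)
  fix S T m
  have "of_nat (degv V m) * mcoeff (ent M S T) m = mcoeff (ent (leuler V M) S T) m" by simp
  also have "\<dots> = 0" unfolding assms by simp
  finally show "mcoeff (ent M S T) m = mcoeff (ent 0 S T) m"
    using op_ordD[OF assms(2), of S T] by (auto dest: ord_geD)
qed

section \<open>Fermions and currents\<close>

type_synonym 'a wop = "(semi_inf, nat + nat, 'a) lop"

text \<open>Levels are labelled by integers, j standing for j + 1/2; the vacuum then occupies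
  exactly the negative integers.\<close>

definition half :: "int \<Rightarrow> rat" where "half j = of_int j + 1 / 2"

lemma half_inject [simp]: "half j = half k \<longleftrightarrow> j = k" by (simp add: half_def)
lemma half_less [simp]: "half j < half k \<longleftrightarrow> j < k" by (simp add: half_def)
lemma inj_half: "inj half" by (simp add: inj_def)
lemma half_diff: "half k - of_int n = half (k - n)" by (simp add: half_def)
lemma half_ints_eq: "half_ints = range half" by (simp add: half_ints_def half_def)

lemma half_neg: "half j < 0 \<longleftrightarrow> j < 0"
proof
  assume "half j < 0"
  hence "of_int j < (0 :: rat)" by (simp add: half_def)
  thus "j < 0" by simp
next
  assume "j < 0"
  hence "of_int j \<le> (of_int (- 1) :: rat)" by (subst of_int_le_iff) simp
  thus "half j < 0" by (simp add: half_def)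
qed

lemma neg_half_ints_eq: "neg_half_ints = half ` {..<0}"
  by (auto simp: neg_half_ints_def half_ints_eq half_neg)

definition occ :: "semi_inf \<Rightarrow> int set" where "occ S = {j. half j \<in> occupied S}"

definition of_occ :: "int set \<Rightarrow> semi_inf" where "of_occ J = Semi_inf (half ` J)"

lemma occupied_eq: "occupied S = half ` occ S"
  using occupied[of S] by (auto simp: occ_def half_ints_eq)

lemma finite_occ: "finite (occ S \<inter> {0..})" "finite ({..<0} - occ S)"
proof -
  have "half ` (occ S \<inter> {0..}) \<subseteq> occupied S - neg_half_ints"
    by (auto simp: occupied_eq neg_half_ints_eq)
  moreover have "finite (occupied S - neg_half_ints)" using occupied[of S] by simp
  ultimately show "finite (occ S \<inter> {0..})"
    by (meson finite_imageD finite_subset inj_half inj_on_subset subset_UNIV)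
  have "half ` ({..<0} - occ S) \<subseteq> neg_half_ints - occupied S"
    by (auto simp: occupied_eq neg_half_ints_eq)
  moreover have "finite (neg_half_ints - occupied S)" using occupied[of S] by simp
  ultimately show "finite ({..<0} - occ S)"
    by (meson finite_imageD finite_subset inj_half inj_on_subset subset_UNIV)
qed

lemma occ_of_occ:
  assumes "finite (J \<inter> {0..})" "finite ({..<0} - J)" shows "occ (of_occ J) = J"
proof -
  have "half ` J - neg_half_ints = half ` (J \<inter> {0..})" "neg_half_ints - half ` J = half ` ({..<0} - J)"
    by (force simp: neg_half_ints_eq)+
  hence "occupied (of_occ J) = half ` J"
    unfolding of_occ_def using assms by (subst Semi_inf_inverse) (auto simp: half_ints_eq)
  thus ?thesis by (auto simp: occ_def)
qed

lemma of_occ_occ [simp]: "of_occ (occ S) = S"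
  by (simp add: of_occ_def occupied_eq[symmetric] occupied_inverse)

lemma occ_inject: "occ S = occ T \<longleftrightarrow> S = T"
  by (metis of_occ_occ)

definition ins :: "int \<Rightarrow> semi_inf \<Rightarrow> semi_inf" where "ins k S = of_occ (insert k (occ S))"
definition del :: "int \<Rightarrow> semi_inf \<Rightarrow> semi_inf" where "del k S = of_occ (occ S - {k})"
definition vac :: semi_inf where "vac = of_occ {..<0}"

lemma occ_ins [simp]: "occ (ins k S) = insert k (occ S)"
  unfolding ins_def
proof (rule occ_of_occ)
  have "insert k (occ S) \<inter> {0..} \<subseteq> insert k (occ S \<inter> {0..})" by auto
  thus "finite (insert k (occ S) \<inter> {0..})" by (rule finite_subset) (simp add: finite_occ)
  show "finite ({..<0} - insert k (occ S))" by (rule finite_subset[OF _ finite_occ(2)[of S]]) auto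
qed

lemma occ_del [simp]: "occ (del k S) = occ S - {k}"
  unfolding del_def
proof (rule occ_of_occ)
  show "finite ((occ S - {k}) \<inter> {0..})" by (rule finite_subset[OF _ finite_occ(1)[of S]]) auto
  have "{..<0} - (occ S - {k}) \<subseteq> insert k ({..<0} - occ S)" by auto
  thus "finite ({..<0} - (occ S - {k}))" by (rule finite_subset) (simp add: finite_occ)
qed

lemma occ_vac [simp]: "occ vac = {..<0}"
  proof -
  have "{..<0} \<inter> {0..} = ({} :: int set)" by auto
  thus ?thesis unfolding vac_def by (intro occ_of_occ) auto
qed

lemma semi_inf_eqI: "occ S = occ T \<Longrightarrow> S = T" by (simp add: occ_inject)

lemma ins_del [simp]: "k \<in> occ S \<Longrightarrow> ins k (del k S) = S" by (rule semi_inf_eqI) auto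
lemma del_ins [simp]: "k \<notin> occ S \<Longrightarrow> del k (ins k S) = S" by (rule semi_inf_eqI) auto

lemma finite_above: "finite {s \<in> occ S. k < s}"
proof -
  have "{s \<in> occ S. k < s} \<subseteq> (occ S \<inter> {0..}) \<union> {k..0}" by auto
  thus ?thesis by (rule finite_subset) (simp add: finite_occ)
qed

lemma finite_below: "finite {s. s < k \<and> s \<notin> occ S}"
proof -
  have "{s. s < k \<and> s \<notin> occ S} \<subseteq> ({..<0} - occ S) \<union> {0..k}" by auto
  thus ?thesis by (rule finite_subset) (simp add: finite_occ)
qed

text \<open>Induction on the finite symmetric difference \<open>?F S\<close> with the vacuum. Single
  insertions and deletions change the charge, so every charge sector is reached.\<close>

lemma semi_inf_induct:
  assumes "P vac" "\<And>S k. k \<notin> occ S \<Longrightarrow> P S \<Longrightarrow> P (ins k S)" "\<And>S k. k \<in> occ S \<Longrightarrow> P S \<Longrightarrow> P (del k S)"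
  shows "P S"
proof -
  let ?F = "\<lambda>S. (occ S \<inter> {0..}) \<union> ({..<0} - occ S)"
  have "\<forall>S. ?F S = F \<longrightarrow> P S" if "finite F" for F
    using that
  proof (induction F rule: finite_induct)
    case empty
    show ?case
    proof (intro allI impI)
      fix S assume "?F S = {}"
      hence "occ S = occ vac" by (force simp: set_eq_iff)
      thus "P S" using assms(1) occ_inject by metis
    qed
  next
    case (insert k F)
    show ?case
    proof (intro allI impI)
      fix S assume S: "?F S = insert k F"
      show "P S"
      proof (cases "k \<in> occ S")
        case True
        hence "k \<ge> 0" using S by auto
        hence "?F (del k S) = ?F S - {k}" by auto
        hence "?F (del k S) = F" using S insert.hyps by auto
        hence "P (ins k (del k S))" using insert.IH by (intro assms(2)) auto
        thus ?thesis using True by simp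
      next
        case False
        hence "k < 0" using S by auto
        hence "?F (ins k S) = ?F S - {k}" by auto
        hence "?F (ins k S) = F" using S insert.hyps by auto
        hence "P (del k (ins k S))" using insert.IH by (intro assms(3)) auto
        thus ?thesis using False by simp
      qed
    qed
  qed
  thus ?thesis using finite_occ[of S] by blast
qed

definition sg :: "int \<Rightarrow> semi_inf \<Rightarrow> 'r::ring_1" where "sg k S = (- 1) ^ card {s \<in> occ S. k < s}"

lemma sg_ins_self [simp]: "sg k (ins k S) = sg k S"
  unfolding sg_def by (rule arg_cong[where f = "\<lambda>A. (- 1) ^ card A"]) auto
lemma sg_del_self [simp]: "sg k (del k S) = sg k S"
  unfolding sg_def by (rule arg_cong[where f = "\<lambda>A. (- 1) ^ card A"]) auto
lemma sg_sq [simp]: "sg k S * sg k S = 1"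
  by (simp add: sg_def power_add[symmetric] mult_2[symmetric])
lemma sg_sq_left [simp]: "sg k S * (sg k S * x) = x" for x :: "'r::ring_1"
  by (simp add: mult.assoc[symmetric])

lemma sg_ins: "l \<notin> occ S \<Longrightarrow> sg k (ins l S) = (if k < l then - sg k S else sg k S)"
proof -
  assume l: "l \<notin> occ S"
  have "{s \<in> occ (ins l S). k < s} = (if k < l then insert l {s \<in> occ S. k < s} else {s \<in> occ S. k < s})"
    by auto
  thus ?thesis using l by (simp add: sg_def finite_above)
qed

lemma sg_del: "l \<in> occ S \<Longrightarrow> sg k (del l S) = (if k < l then - sg k S else sg k S :: 'r::ring_1)"
proof -
  assume "l \<in> occ S"
  hence "sg k S = (if k < l then - sg k (del l S) else sg k (del l S) :: 'r)"
    using sg_ins[of l "del l S" k] by simp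
  thus ?thesis by (cases "k < l") simp_all
qed

lemma sg_top: "(\<And>s. s \<in> occ S \<Longrightarrow> s \<le> k) \<Longrightarrow> sg k S = 1"
proof -
  assume "\<And>s. s \<in> occ S \<Longrightarrow> s \<le> k"
  hence "{s \<in> occ S. k < s} = {}" by force
  thus ?thesis by (simp only: sg_def) simp
qed

section \<open>Matrices of the fermion operators and the anticommutation relations\<close>

lemma psi_apply:
  "psi (half k) f S = (if k \<in> occ S then sg k S * f (del k S) else (0 :: 'a::comm_ring_1 series))"
proof -
  have basis: "psi_basis (half k) T S = (if k \<notin> occ T \<and> S = ins k T then sg k T else (0 :: 'a series))" for T
  proof -
    have 1: "half k \<in> occupied T \<longleftrightarrow> k \<in> occ T" by (simp add: occ_def)
    have "{s \<in> occupied T. s > half k} = half ` {s \<in> occ T. k < s}" by (auto simp: occupied_eq)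
    hence 2: "card {s \<in> occupied T. s > half k} = card {s \<in> occ T. k < s}"
      by (simp add: card_image inj_on_subset[OF inj_half])
    have 3: "Semi_inf (insert (half k) (occupied T)) = ins k T"
      by (simp add: ins_def of_occ_def occupied_eq)
    show ?thesis unfolding psi_basis_def 1 2 3 by (simp add: wedge_basis_def sg_def)
  qed
  show ?thesis
  proof (cases "k \<in> occ S")
    case True
    have "psi (half k) f S = f (del k S) * psi_basis (half k) (del k S) S"
      unfolding psi_def linear_ext_def
      by (rule mfps_sum_single) (auto simp: basis)
    thus ?thesis using True by (simp add: basis mult.commute)
  next
    case False
    thus ?thesis unfolding psi_def linear_ext_def by (auto simp: basis intro!: mfps_sum_zero')
  qed
qed

lemma psi_star_apply:
  "psi_star (half k) f S = (if k \<notin> occ S then sg k S * f (ins k S) else (0 :: 'a::comm_ring_1 series))"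
proof (cases "k \<in> occ S")
  case False
  have "psi_star (half k) f S = f (ins k S) * psi (half k) (wedge_basis S) (ins k S)"
    unfolding psi_star_def wedge_inner_def
    by (rule mfps_sum_single) (auto simp: psi_apply wedge_basis_def)
  thus ?thesis using False by (simp add: psi_apply wedge_basis_def mult.commute)
next
  case True
  thus ?thesis unfolding psi_star_def wedge_inner_def
    by (auto simp: psi_apply wedge_basis_def intro!: mfps_sum_zero')
qed

text \<open>As rows index the output, row S looks back at the state \<open>del k S\<close> from
  which S was created.\<close>

definition cre :: "int \<Rightarrow> 'a::comm_ring_1 wop" where
  "cre k = Lop (\<lambda>S T. if k \<in> occ S \<and> T = del k S then sg k S else 0)"

definition ann :: "int \<Rightarrow> 'a::comm_ring_1 wop" where
  "ann k = Lop (\<lambda>S T. if k \<notin> occ S \<and> T = ins k S then sg k S else 0)"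

lemma ent_cre: "ent (cre k) S T = (if k \<in> occ S \<and> T = del k S then sg k S else 0)"
  unfolding cre_def by (subst ent_Lop) (auto intro!: locfin_support)

lemma ent_ann: "ent (ann k) S T = (if k \<notin> occ S \<and> T = ins k S then sg k S else 0)"
  unfolding ann_def by (subst ent_Lop) (auto intro!: locfin_support)

lemma appl_cre [simp]: "appl (cre k) f S = (if k \<in> occ S then sg k S * f (del k S) else 0)"
  unfolding appl_def
  by (subst mfps_sum_single[of "del k S"]) (auto simp: ent_cre)

lemma appl_ann [simp]: "appl (ann k) f S = (if k \<notin> occ S then sg k S * f (ins k S) else 0)"
  unfolding appl_def
  by (subst mfps_sum_single[of "ins k S"]) (auto simp: ent_ann)

lemma appl_psi: "psi (half k) f = appl (cre k) f" by (rule ext) (simp add: psi_apply)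
lemma appl_psi_star: "psi_star (half k) f = appl (ann k) f" by (rule ext) (simp add: psi_star_apply)

lemma ent_cre_mult: "ent (cre k * M) S T = (if k \<in> occ S then sg k S * ent M (del k S) T else 0)"
  unfolding ent_mult by (subst mfps_sum_single[of "del k S"]) (auto simp: ent_cre)

lemma ent_ann_mult: "ent (ann k * M) S T = (if k \<notin> occ S then sg k S * ent M (ins k S) T else 0)"
  unfolding ent_mult by (subst mfps_sum_single[of "ins k S"]) (auto simp: ent_ann)

lemma del_neq: "k \<in> occ T \<Longrightarrow> T \<noteq> del k S" and ins_neq: "k \<notin> occ T \<Longrightarrow> T \<noteq> ins k S"
  by auto

lemma ent_mult_cre: "ent (M * cre k) S T = (if k \<notin> occ T then sg k T * ent M S (ins k T) else 0)"
  unfolding ent_mult by (subst mfps_sum_single[of "ins k T"]) (auto simp: ent_cre mult.commute dest: del_neq)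

lemma ent_mult_ann: "ent (M * ann k) S T = (if k \<in> occ T then sg k T * ent M S (del k T) else 0)"
  unfolding ent_mult by (subst mfps_sum_single[of "del k T"]) (auto simp: ent_ann mult.commute dest: ins_neq)

lemma ins_ins: "ins k (ins l S) = ins l (ins k S)" by (rule semi_inf_eqI) auto
lemma del_del: "del k (del l S) = del l (del k S)" by (rule semi_inf_eqI) auto
lemma ins_del_commute: "k \<noteq> l \<Longrightarrow> ins k (del l S) = del l (ins k S)" by (rule semi_inf_eqI) auto

lemma cre_cre: "cre k * cre l = - (cre l * cre k :: 'a::comm_ring_1 wop)"
proof (cases "k = l")
  case True
  have "cre k * cre k = (0 :: 'a wop)" by (rule lop_eqI) (simp add: ent_cre_mult ent_cre)
  thus ?thesis using True by simp
next
  case False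
  show ?thesis
    by (rule lop_eqI) (use False in \<open>auto simp: ent_cre_mult ent_cre sg_del del_del[of k l]\<close>)
qed

lemma ann_ann: "ann k * ann l = - (ann l * ann k :: 'a::comm_ring_1 wop)"
proof (cases "k = l")
  case True
  have "ann k * ann k = (0 :: 'a wop)" by (rule lop_eqI) (simp add: ent_ann_mult ent_ann)
  thus ?thesis using True by simp
next
  case False
  show ?thesis
    by (rule lop_eqI) (use False in \<open>auto simp: ent_ann_mult ent_ann sg_ins ins_ins[of k l]\<close>)
qed

lemma ann_cre: "ann k * cre l = (if k = l then 1 else 0) - cre l * ann k"
proof (cases "k = l")
  case True
  show ?thesis
    by (rule lop_eqI) (use True in \<open>auto simp: ent_ann_mult ent_cre_mult ent_ann ent_cre ent_one\<close>)
next
  case False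
  show ?thesis
    by (rule lop_eqI) (use False in \<open>auto simp: ent_ann_mult ent_cre_mult ent_ann ent_cre sg_ins sg_del ins_del_commute[of k l]\<close>)
qed

section \<open>Currents and their commutators\<close>

definition cur_term :: "int \<Rightarrow> int \<Rightarrow> 'a::comm_ring_1 wop" where "cur_term n k = cre (k - n) * ann k"

definition cur :: "int \<Rightarrow> 'a::comm_ring_1 wop" where "cur n = lop_sum (cur_term n) UNIV"

text \<open>In row S a nonzero term needs \<open>k - n\<close> occupied and \<open>k\<close> empty.
  Far below both levels are occupied, far above both are empty. For n = 0 infinitely many terms
  would contribute to the diagonal.\<close>

lemma summable_cur_term:
  assumes "n \<noteq> 0" shows "lop_summable (cur_term n) I"
proof (rule lop_summable_finite_rows)
  fix S
  have "{i \<in> I. \<exists>T. ent (cur_term n i) S T \<noteq> 0} \<subseteq>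
     {s. s < 0 \<and> s \<notin> occ S} \<union> (\<lambda>k. k + n) ` {s \<in> occ S. - 1 < s} \<union> {0..n}"
  proof (intro subsetI)
    fix k assume "k \<in> {i \<in> I. \<exists>T. ent (cur_term n i) S T \<noteq> 0}"
    hence "k - n \<in> occ S" "k \<notin> occ S"
      using assms by (auto simp: cur_term_def ent_cre_mult ent_ann split: if_splits)
    thus "k \<in> {s. s < 0 \<and> s \<notin> occ S} \<union> (\<lambda>k. k + n) ` {s \<in> occ S. - 1 < s} \<union> {0..n}"
      by (cases "k < 0"; cases "k - n < 0") (auto intro!: rev_image_eqI[of "k - n"])
  qed
  thus "finite {i \<in> I. \<exists>T. ent (cur_term n i) S T \<noteq> 0}"
    by (rule finite_subset) (auto intro: finite_above finite_below)
qed

lemma appl_lop_sum: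
  assumes "lop_summable F I" shows "appl (lop_sum F I) f S = mfps_sum (\<lambda>i. appl (F i) f S) I"
proof -
  have "locfin (\<lambda>(T, i). ent (F i) S T * f T) (UNIV \<times> I)"
    using locfin_mult_right[OF locfin_swap[OF lop_summableD[OF assms, of S]], of "\<lambda>(T, i). f T"]
    by (simp add: case_prod_unfold)
  from mfps_sum_swap[OF this] show ?thesis
    unfolding appl_def by (simp add: ent_lop_sum assms mfps_sum_cmult_right[symmetric] locfin_ent_summable)
qed

lemma appl_alpha: "n \<noteq> 0 \<Longrightarrow> alpha n f = appl (cur n) f"
proof
  fix S assume n: "n \<noteq> 0"
  have "alpha n f S = mfps_sum (\<lambda>k. psi (half k - of_int n) (psi_star (half k) f) S) UNIV"
    unfolding alpha_def half_ints_eq by (subst mfps_sum_reindex[OF inj_half]) (simp add: o_def)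
  thus "alpha n f S = appl (cur n) f S"
    unfolding cur_def appl_lop_sum[OF summable_cur_term[OF n]]
    by (simp add: half_diff appl_psi appl_psi_star cur_term_def appl_mult del: appl_cre appl_ann)
qed

text \<open>Moving \<open>cre j\<close> through the two fermions of a current term produces two
  signs that cancel, and one contraction, at k = j.\<close>

lemma cur_cre:
  assumes "n \<noteq> 0" shows "cur n * cre j = (cre j * cur n + cre (j - n) :: 'a::comm_ring_1 wop)"
proof -
  have "cur_term n k * cre j - cre j * cur_term n k = ((if k = j then cre (j - n) else 0) :: 'a wop)" for k
  proof -
    have "cre (k - n) * cre j * ann k = (- (cre j * cre (k - n) * ann k) :: 'a wop)"
      by (subst cre_cre) simp
    thus ?thesis by (auto simp: cur_term_def mult.assoc ann_cre right_diff_distrib)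
  qed
  hence "cur n * cre j - cre j * cur n = (lop_sum (\<lambda>k. if k = j then cre (j - n) else 0) UNIV :: 'a wop)"
    unfolding cur_def
    by (simp add: lop_sum_left lop_sum_right summable_cur_term assms lop_sum_diff[symmetric]
        lop_summable_left lop_summable_right)
  also have "\<dots> = cre (j - n)" by (subst lop_sum_single[of j]) auto
  finally show ?thesis by (simp add: algebra_simps)
qed

lemma cur_ann:
  assumes "n \<noteq> 0" shows "cur n * ann j = (ann j * cur n - ann (j + n) :: 'a::comm_ring_1 wop)"
proof -
  have "ann j * cur_term n k - cur_term n k * ann j = ((if k = j + n then ann (j + n) else 0) :: 'a wop)" for k
  proof -
    have "cre (k - n) * (ann k * ann j) = (- (cre (k - n) * (ann j * ann k)) :: 'a wop)"
      by (subst ann_ann) simp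
    moreover have "ann j * (cre (k - n) * ann k) = ((if j = k - n then ann k else 0) - cre (k - n) * (ann j * ann k) :: 'a wop)"
      by (simp add: mult.assoc[symmetric] ann_cre left_diff_distrib)
    ultimately show ?thesis by (auto simp: cur_term_def mult.assoc)
  qed
  hence "ann j * cur n - cur n * ann j = (lop_sum (\<lambda>k. if k = j + n then ann (j + n) else 0) UNIV :: 'a wop)"
    unfolding cur_def
    by (simp add: lop_sum_left lop_sum_right summable_cur_term assms lop_sum_diff[symmetric]
        lop_summable_left lop_summable_right)
  also have "\<dots> = ann (j + n)" by (subst lop_sum_single[of "j + n"]) auto
  finally show ?thesis by (simp add: algebra_simps)
qed

text \<open>A form of Schur's lemma: the occupation projections separate basis vectors, so M is
  diagonal, and commuting with the creators makes its diagonal constant along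
  \<open>semi_inf_induct\<close>.\<close>

lemma scal_if_commutes:
  fixes M :: "'a::comm_ring_1 wop"
  assumes cre: "\<And>k. M * cre k = cre k * M" and ann: "\<And>k. M * ann k = ann k * M"
  shows "M = scal (ent M vac vac)"
proof -
  have off: "ent M S T = 0" if "S \<noteq> T" for S T
  proof -
    from that have "occ S \<noteq> occ T" by (simp add: occ_inject)
    then obtain k where k: "(k \<in> occ S) \<noteq> (k \<in> occ T)" by auto
    \<comment> \<open>The product \<open>cre k * ann k\<close> projects onto the states that contain
      k. If k lies in only one of S and T, exactly one side retains the entry (S, T).\<close>
    have "ent (cre k * (ann k * M)) S T = ent (M * cre k * ann k) S T"
      by (simp add: cre) (simp add: ann mult.assoc)
    thus ?thesis using k
      by (auto simp: ent_cre_mult ent_ann_mult ent_mult_ann ent_mult_cre split: if_splits)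
  qed
  have del: "ent M (del k S) (del k S) = ent M S S" if "k \<in> occ S" for k S
  proof -
    have "ent (M * cre k) S (del k S) = ent (cre k * M) S (del k S)" by (simp add: cre)
    hence "sg k S * ent M S S = sg k S * ent M (del k S) (del k S)"
      using that by (simp add: ent_mult_cre ent_cre_mult)
    hence "sg k S * (sg k S * ent M S S) = sg k S * (sg k S * ent M (del k S) (del k S))" by (rule arg_cong)
    thus ?thesis unfolding sg_sq_left by (rule sym)
  qed
  have diag: "ent M S S = ent M vac vac" for S
  proof (induction S rule: semi_inf_induct)
    case (2 S k)
    hence "ent M (ins k S) (ins k S) = ent M S S" using del[of k "ins k S", symmetric] by simp
    thus ?case using 2(2) by (rule trans)
  next
    case (3 S k)
    show ?case using del[OF 3(1)] 3(2) by (rule trans)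
  qed (rule refl)
  show ?thesis
  proof (rule lop_eqI)
    fix S T
    show "ent M S T = ent (scal (ent M vac vac)) S T"
      using off[of S T] diag[of S] by (cases "S = T") (simp_all add: ent_scal)
  qed
qed

text \<open>The Jacobi identity, where \<open>c1\<close>, \<open>c2\<close> are the commutators of
  \<open>a\<close>, \<open>b\<close> with \<open>c\<close>, and \<open>d\<close> is the common value
  of both double commutators.\<close>

lemma commutator_commutes:
  fixes a b c :: "'r::ring_1"
  assumes "a * c = c * a + c1" "b * c = c * b + c2" "a * c2 = c2 * a + d" "b * c1 = c1 * b + d"
  shows "(a * b - b * a) * c = c * (a * b - b * a)"
proof -
  have "a * b * c = c * a * b + c1 * b + c2 * a + d"
    unfolding mult.assoc[of a] assms(2) distrib_left assms(3)
    by (simp add: mult.assoc[symmetric] assms(1) distrib_right)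
  moreover have "b * a * c = c * b * a + c2 * a + c1 * b + d"
    unfolding mult.assoc[of b] assms(1) distrib_left assms(4)
    by (simp add: mult.assoc[symmetric] assms(2) distrib_right)
  ultimately show ?thesis by (simp add: algebra_simps)
qed

lemma cur_commutator:
  assumes "n \<noteq> 0" "m \<noteq> 0"
  shows "\<exists>c. cur n * cur m - cur m * cur n = (scal c :: 'a::comm_ring_1 wop)"
proof -
  have eq: "k - m - n = k - n - m" "k + m + n = k + n + m" for k :: int by simp_all
  have "(cur n * cur m - cur m * cur n) * cre k = (cre k * (cur n * cur m - cur m * cur n) :: 'a wop)" for k
    by (rule commutator_commutes[OF cur_cre[OF assms(1)] cur_cre[OF assms(2)] cur_cre[OF assms(1)]])
      (unfold eq(1), rule cur_cre[OF assms(2)])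
  moreover have "(cur n * cur m - cur m * cur n) * ann k = (ann k * (cur n * cur m - cur m * cur n) :: 'a wop)" for k
    \<comment> \<open>Each commutator with an annihilator has a minus sign, so the double commutator
      is \<open>+ ann (k + n + m)\<close>.\<close>
    by (rule commutator_commutes[where ?c1.0 = "- ann (k + n)" and ?c2.0 = "- ann (k + m)" and d = "ann (k + n + m)"])
      (simp_all add: cur_ann assms eq(2))
  ultimately have "cur n * cur m - cur m * cur n = (scal (ent (cur n * cur m - cur m * cur n) vac vac) :: 'a wop)"
    by (rule scal_if_commutes)
  thus ?thesis by blast
qed

text \<open>No particle can be lowered, because all levels below an occupied one are occupied. The
  vacuum of every charge c is covered, since the recursion on the rows of a partition changes the
  charge.\<close>

lemma ent_cur_vacuum_column:
  assumes "n > 0" "occ S = {..<c}" shows "ent (cur n) T S = 0"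
proof -
  have "ent (cur_term n k) T S = 0" for k
  proof (cases "k \<in> occ S")
    case True
    hence "k - n \<in> occ (del k S)" using assms by simp
    hence "del k S \<noteq> del (k - n) T" by (rule del_neq)
    thus ?thesis by (simp add: cur_term_def ent_mult_ann ent_cre)
  qed (simp add: cur_term_def ent_mult_ann)
  moreover have "n \<noteq> 0" using assms(1) by simp
  ultimately show ?thesis unfolding cur_def
    by (subst ent_lop_sum[OF summable_cur_term]) (auto intro: mfps_sum_zero')
qed

lemma ent_cur_vacuum_row:
  assumes "n < 0" "occ S = {..<c}" shows "ent (cur n) S T = 0"
proof -
  have "ent (cur_term n k) S T = 0" for k
  proof (cases "k - n \<in> occ S")
    case True
    hence "k \<in> occ (del (k - n) S)" using assms by simp
    thus ?thesis by (simp add: cur_term_def ent_cre_mult ent_ann)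
  qed (simp add: cur_term_def ent_cre_mult)
  moreover have "n \<noteq> 0" using assms(1) by simp
  ultimately show ?thesis unfolding cur_def
    by (subst ent_lop_sum[OF summable_cur_term]) (auto intro: mfps_sum_zero')
qed

text \<open>A scalar is determined by its vacuum entry, and both products annihilate the
  vacuum.\<close>

lemma cur_pos_commute:
  assumes "n > 0" "m > 0" shows "cur n * cur m = (cur m * cur n :: 'a::comm_ring_1 wop)"
proof -
  from assms obtain c where c: "cur n * cur m - cur m * cur n = (scal c :: 'a wop)"
    using cur_commutator[of n m] by auto
  have "ent (cur i * cur j) vac vac = (0 :: 'a series)" if "j > 0" for i j
    unfolding ent_mult using that by (intro mfps_sum_zero') (simp add: ent_cur_vacuum_column[of _ _ 0])
  hence "ent (scal c :: 'a wop) vac vac = 0" unfolding c[symmetric] using assms by simp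
  hence "c = 0" by (simp add: ent_scal)
  thus ?thesis using c by simp
qed

section \<open>Vertex operators and the correlation kernel\<close>

text \<open>The n-th time counts as degree n. This makes the sum over n converge whatever the
  operators, and gives the Hamiltonian the positive order that its exponential requires.\<close>

definition time_seq :: "(nat \<Rightarrow> ('v, 'a::comm_ring_1) mfps) \<Rightarrow> bool" where
  "time_seq s \<longleftrightarrow> (\<forall>n. ord_ge UNIV n (s n))"

text \<open>The exponent of Gamma_+ for \<epsilon> = 1 and of Gamma_- for \<epsilon> = -1.\<close>

definition ham :: "int \<Rightarrow> (nat \<Rightarrow> 'a::comm_ring_1 series) \<Rightarrow> 'a wop" where
  "ham \<epsilon> s = lop_sum (\<lambda>n. scal (s n) * cur (\<epsilon> * int n)) {1..}"

lemma summable_time_seq: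
  assumes "time_seq s" shows "lop_summable (\<lambda>n. scal (s n) * F n) I"
  by (rule lop_summable_ord) (use assms in \<open>auto simp: time_seq_def intro!: op_ord_right op_ord_scal\<close>)

lemma op_ord_ham:
  assumes "time_seq s" shows "op_ord UNIV (Suc 0) (ham \<epsilon> s)"
  unfolding ham_def
proof (rule op_ord_lop_sum[OF summable_time_seq[OF assms]])
  fix n :: nat assume "n \<in> {1..}"
  thus "op_ord UNIV (Suc 0) (scal (s n) * cur (\<epsilon> * int n))"
    using assms by (intro op_ord_right op_ord_scal) (auto simp: time_seq_def intro: ord_ge_mono[of _ n])
qed

lemma appl_scal_mult: "appl (scal c * M) f S = c * appl M f S"
  by (simp add: appl_def mfps_sum_cmult[symmetric] locfin_mult_right locfin_ent mult.assoc)

lemma appl_ham: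
  assumes "time_seq s" "\<epsilon> \<noteq> 0"
  shows "appl (ham \<epsilon> s) f = (\<lambda>S. mfps_sum (\<lambda>n. s n * alpha (\<epsilon> * int n) f S) {1..})"
proof
  fix S
  show "appl (ham \<epsilon> s) f S = mfps_sum (\<lambda>n. s n * alpha (\<epsilon> * int n) f S) {1..}"
    unfolding ham_def appl_lop_sum[OF summable_time_seq[OF assms(1)]]
    by (rule mfps_sum_cong) (use assms(2) in \<open>auto simp: appl_scal_mult appl_alpha\<close>)
qed

lemma op_exp_appl:
  assumes "op_ord UNIV (Suc 0) M" shows "op_exp (appl M) = appl (lexp M)"
proof (intro ext)
  fix f S
  show "op_exp (appl M) f S = appl (lexp M) f S"
    unfolding op_exp_def lexp_def appl_lop_sum[OF summable_exp_term[OF assms]]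
    by (simp add: exp_term_def cs_def appl_scal_mult appl_power)
qed

lemma Gamma_plus_appl: "time_seq s \<Longrightarrow> Gamma_plus s = appl (lexp (ham 1 s))"
  unfolding Gamma_plus_def
  using appl_ham[of s 1] by (subst op_exp_appl[symmetric]) (auto simp: op_ord_ham intro!: arg_cong[where f = op_exp])

lemma Gamma_minus_appl: "time_seq s \<Longrightarrow> Gamma_minus s = appl (lexp (ham (- 1) s))"
  unfolding Gamma_minus_def
  using appl_ham[of s "- 1"] by (subst op_exp_appl[symmetric]) (auto simp: op_ord_ham intro!: arg_cong[where f = op_exp])

text \<open>Both products become sums over the same pairs (n, m), the second after a swap of the
  index pair, so that scalar commutators can be collected termwise.\<close>

lemma ham_commutator:
  fixes s s' :: "nat \<Rightarrow> 'a::comm_ring_1 series"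
  assumes "time_seq s" "time_seq s'"
  shows "\<exists>c. ord_ge UNIV (Suc 0) c \<and> ham 1 s * ham (- 1) s' - ham (- 1) s' * ham 1 s = scal c"
proof -
  let ?C = "ham 1 s * ham (- 1) s' - ham (- 1) s' * ham 1 s"
  have "\<exists>c. cur (1 * int n) * cur (- 1 * int m) - cur (- 1 * int m) * cur (1 * int n) = (scal c :: 'a wop)"
    if "n \<ge> 1" "m \<ge> 1" for n m
    using that by (intro cur_commutator) auto
  then obtain c where c: "\<And>n m. n \<ge> 1 \<Longrightarrow> m \<ge> 1 \<Longrightarrow>
      cur (1 * int n) * cur (- 1 * int m) - cur (- 1 * int m) * cur (1 * int n) = (scal (c n m) :: 'a wop)"
    by metis
  let ?f = "\<lambda>n. scal (s n) * cur (1 * int n) :: 'a wop" and ?g = "\<lambda>n. scal (s' n) * cur (- 1 * int n) :: 'a wop"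
  have sf: "lop_summable ?f {1..}" and sg: "lop_summable ?g {1..}" by (intro summable_time_seq assms)+
  have s1: "lop_summable (\<lambda>(n, m). ?f n * ?g m) ({1..} \<times> {1..})"
    by (rule lop_summable_mult) (intro sf sg)+
  have "lop_summable (\<lambda>(m, n). ?g m * ?f n) ({1..} \<times> {1..})"
    by (rule lop_summable_mult) (intro sf sg)+
  moreover have bij: "bij_betw prod.swap ({1..} \<times> {1..}) ({1..} \<times> {1..} :: (nat \<times> nat) set)"
    by (auto simp: bij_betw_def)
  ultimately have s2: "lop_summable (\<lambda>(n, m). ?g m * ?f n) ({1..} \<times> {1..})"
    using lop_summable_bij_betw[OF bij, of "\<lambda>(m, n). ?g m * ?f n"] by (simp add: case_prod_unfold)
  have "ham (- 1) s' * ham 1 s = lop_sum (\<lambda>(m, n). ?g m * ?f n) ({1..} \<times> {1..})"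
    unfolding ham_def by (rule lop_sum_mult[OF sg sf])
  also have "\<dots> = lop_sum (\<lambda>(n, m). ?g m * ?f n) ({1..} \<times> {1..})"
    by (subst lop_sum_bij_betw[OF bij]) (simp add: case_prod_unfold)
  finally have "?C = lop_sum (\<lambda>(n, m). ?f n * ?g m) ({1..} \<times> {1..}) - lop_sum (\<lambda>(n, m). ?g m * ?f n) ({1..} \<times> {1..})"
    unfolding ham_def[of 1] ham_def[of "- 1"] lop_sum_mult[OF sf sg] by simp
  also have "\<dots> = lop_sum (\<lambda>p. (case p of (n, m) \<Rightarrow> ?f n * ?g m) - (case p of (n, m) \<Rightarrow> ?g m * ?f n)) ({1..} \<times> {1..})"
    by (rule lop_sum_diff[symmetric]) (rule s1 s2)+
  also have "\<dots> = lop_sum (\<lambda>(n, m). scal (s n * s' m * c n m)) ({1..} \<times> {1..})"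
  proof (rule lop_sum_cong[OF refl], clarify)
    fix n m :: nat assume "1 \<le> n" "1 \<le> m"
    have "?f n * ?g m - ?g m * ?f n = scal (s n) * (scal (s' m) *
        (cur (1 * int n) * cur (- 1 * int m) - cur (- 1 * int m) * cur (1 * int n)))"
      by (simp only: mult.assoc right_diff_distrib scal_left_commute[of "cur (1 * int n)" "s' m"]
          scal_left_commute[of "cur (- 1 * int m)" "s n"] scal_left_commute[of "scal (s' m)" "s n"])
    thus "(?f n * ?g m) - (?g m * ?f n) = scal (s n * s' m * c n m)"
      using c[OF \<open>1 \<le> n\<close> \<open>1 \<le> m\<close>] by (simp only: scal_mult mult.assoc)
  qed
  finally have eq: "?C = lop_sum (\<lambda>(n, m). scal (s n * s' m * c n m)) ({1..} \<times> {1..})" .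
  have sum: "lop_summable (\<lambda>(n, m). scal (s n * s' m * c n m) :: 'a wop) ({1..} \<times> {1..})"
  proof -
    have "lop_summable (\<lambda>(n, m). (scal (s n) * 1) * (scal (s' m) * scal (c n m)) :: 'a wop) ({1..} \<times> {1..})"
      by (rule lop_summable_mult) (intro summable_time_seq assms)+
    thus ?thesis by (simp add: scal_mult mult.assoc)
  qed
  have C: "?C = scal (mfps_sum (\<lambda>(n, m). s n * s' m * c n m) ({1..} \<times> {1..}))"
    unfolding eq
  proof (rule lop_eqI, unfold ent_lop_sum[OF sum] ent_scal)
    fix S T
    show "mfps_sum (\<lambda>i. ent (case i of (n, m) \<Rightarrow> scal (s n * s' m * c n m)) S T) ({1..} \<times> {1..}) =
      (if S = T then mfps_sum (\<lambda>(n, m). s n * s' m * c n m) ({1..} \<times> {1..}) else 0)"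
      by (cases "S = T") (simp_all add: case_prod_unfold ent_scal)
  qed
  \<comment> \<open>The order of the scalar is inherited by looking at one diagonal entry.\<close>
  have "ord_ge UNIV (Suc 0) (ent ?C vac vac)"
    using assms by (intro op_ordD op_ord_diff op_ord_right op_ord_ham)
  thus ?thesis unfolding C by (auto simp: ent_scal)
qed

text \<open>With [A, B] = c central, A exp(B) = exp(B) (A + c), hence exp(A) exp(B) = exp(B) exp(A)
  exp(c). The scalars \<open>e\<close> and \<open>e'\<close> are exp(c) and exp(-c).\<close>

lemma lexp_ham_commute:
  fixes s s' :: "nat \<Rightarrow> 'a::field_char_0 series"
  assumes "time_seq s" "time_seq s'"
  obtains e e' where "e * e' = 1"
    "lexp (ham 1 s) * lexp (ham (- 1) s') = scal e * (lexp (ham (- 1) s') * lexp (ham 1 s))"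
proof -
  obtain c where c: "ord_ge UNIV (Suc 0) c" "ham 1 s * ham (- 1) s' - ham (- 1) s' * ham 1 s = scal c"
    using ham_commutator[OF assms] by blast
  let ?A = "ham 1 s" and ?B = "ham (- 1) s'"
  have ordc: "op_ord UNIV (Suc 0) (scal c :: 'a wop)" by (rule op_ord_scal[OF c(1)])
  have "?A * lexp ?B = lexp ?B * ?A + scal c * lexp ?B"
    by (rule lexp_commutator[OF c(2)]) (simp_all add: scal_commute op_ord_ham assms)
  hence "?A * lexp ?B = lexp ?B * (?A + scal c)" by (simp add: distrib_left scal_commute)
  hence "lexp ?A * lexp ?B = lexp ?B * lexp (?A + scal c)"
    by (rule lexp_intertwine) (intro op_ord_ham assms op_ord_add ordc)+
  also have "lexp (?A + scal c) = lexp ?A * lexp (scal c)"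
    by (rule lexp_add) (intro scal_commute op_ord_ham assms ordc)+
  finally have 1: "lexp ?A * lexp ?B = lexp ?B * lexp ?A * lexp (scal c)" by (simp add: mult.assoc)
  obtain e where e: "lexp (scal c) = (scal e :: 'a wop)" using lexp_scal[OF c(1)] by blast
  obtain e' where e': "lexp (scal (- c)) = (scal e' :: 'a wop)"
    using lexp_scal[OF ord_ge_uminus[OF c(1)]] by blast
  have "scal e * scal e' = (1 :: 'a wop)"
    using lexp_minus(1)[OF ordc] by (simp add: e e'[unfolded scal_uminus])
  hence "ent (scal e * scal e' :: 'a wop) vac vac = ent 1 vac vac" by simp
  hence "e * e' = 1" by (simp add: ent_scal ent_one mult.commute)
  moreover have "lexp ?A * lexp ?B = scal e * (lexp ?B * lexp ?A)"
    unfolding 1 e by (rule scal_commute)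
  ultimately show ?thesis by (rule that)
qed

text \<open>A zero column means that A annihilates v_S, so only the term j = 0 of the exponential
  acts on v_S.\<close>

lemma ent_lexp_column:
  assumes "op_ord UNIV (Suc 0) A" "\<And>T. ent A T S = 0"
  shows "ent (lexp A) T S = ent 1 T S"
proof -
  have "ent (exp_term A j) T S = 0" if "j \<noteq> 0" for j
  proof -
    from that obtain i where "j = Suc i" by (cases j) auto
    hence "ent (A ^ j) T S = 0"
      unfolding \<open>j = Suc i\<close> power_Suc2 ent_mult by (auto simp: assms(2) intro: mfps_sum_zero')
    thus ?thesis by (simp add: exp_term_def)
  qed
  thus ?thesis
    unfolding lexp_def ent_lop_sum[OF summable_exp_term[OF assms(1)]]
    by (subst mfps_sum_single[of 0]) auto
qed

lemma ent_lexp_row: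
  assumes "op_ord UNIV (Suc 0) A" "\<And>T. ent A S T = 0"
  shows "ent (lexp A) S T = ent 1 S T"
proof -
  have "ent (exp_term A j) S T = 0" if "j \<noteq> 0" for j
  proof -
    from that obtain i where "j = Suc i" by (cases j) auto
    hence "ent (A ^ j) S T = 0"
      unfolding \<open>j = Suc i\<close> power_Suc ent_mult by (auto simp: assms(2) intro: mfps_sum_zero')
    thus ?thesis by (simp add: exp_term_def)
  qed
  thus ?thesis
    unfolding lexp_def ent_lop_sum[OF summable_exp_term[OF assms(1)]]
    by (subst mfps_sum_single[of 0]) auto
qed

lemma ent_mult_trivial_row:
  assumes "\<And>T. ent M S T = ent 1 S T" shows "ent (M * N) S U = ent N S U"
proof -
  have "ent (M * N) S U = ent (1 * N) S U" unfolding ent_mult assms ..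
  thus ?thesis by simp
qed

lemma ent_mult_trivial_column:
  assumes "\<And>T. ent N T S = ent 1 T S" shows "ent (M * N) U S = ent M U S"
proof -
  have "ent (M * N) U S = ent (M * 1) U S" unfolding ent_mult assms ..
  thus ?thesis by simp
qed

lemma ham_vacuum_column:
  assumes "time_seq s" "occ S = {..<c}" shows "ent (ham 1 s) T S = 0"
  unfolding ham_def ent_lop_sum[OF summable_time_seq[OF assms(1)]]
  by (rule mfps_sum_zero') (simp add: ent_cur_vacuum_column[OF _ assms(2)])

lemma ham_vacuum_row:
  assumes "time_seq s" "occ S = {..<c}" shows "ent (ham (- 1) s) S T = 0"
  unfolding ham_def ent_lop_sum[OF summable_time_seq[OF assms(1)]]
  by (rule mfps_sum_zero') (simp add: ent_cur_vacuum_row[OF _ assms(2)])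

lemma inv_appl: "M * M' = 1 \<Longrightarrow> M' * M = 1 \<Longrightarrow> inv_into UNIV (appl M) = appl M'"
  by (rule inv_unique_comp) (auto simp: fun_eq_iff appl_mult[symmetric])

lemma ord_ge_var: "v \<in> V \<Longrightarrow> ord_ge V (Suc 0) (mfps_var v)"
  by (auto simp: ord_ge_def mfps_var_def degv_single split: if_splits)

lemma time_seq_power_sum_time:
  assumes "\<And>i. ord_ge UNIV (Suc 0) (v i)" shows "time_seq (power_sum_time v)"
  unfolding time_seq_def power_sum_time_def
proof
  fix n
  have "ord_ge UNIV n (mfps_sum (\<lambda>i. v i ^ n) UNIV)"
    using ord_ge_power[OF assms, of n] by (intro ord_ge_mfps_sum) simp
  from ord_ge_mult[OF ord_ge_0 this]
  show "ord_ge UNIV n (mfps_const (1 / of_nat n) * mfps_sum (\<lambda>i. v i ^ n) UNIV)" by simp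
qed

lemma time_seq_tx: "time_seq (tx :: nat \<Rightarrow> 'a::field_char_0 series)" and time_seq_ty: "time_seq (ty :: nat \<Rightarrow> 'a::field_char_0 series)"
  by (intro time_seq_power_sum_time; simp add: xvar_def yvar_def ord_ge_var)+

abbreviation gp :: "'a::field_char_0 wop" where "gp \<equiv> lexp (ham 1 tx)"
abbreviation gm :: "'a::field_char_0 wop" where "gm \<equiv> lexp (ham (- 1) ty)"

text \<open>The expectation is not normalised: \<open>vev 1\<close> is the partition
  function.\<close>

definition vev :: "'a::field_char_0 wop \<Rightarrow> 'a series" where "vev M = ent (gp * M * gm) vac vac"

text \<open>The conjugated product is \<open>gp * ?gm' * (cre i * ann j) * gm * ?gp'\<close>.
  Exchanging the first two factors costs the scalar \<open>e'\<close>; the outer \<open>?gm'\<close>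
  and \<open>?gp'\<close> then act trivially on the vacuum row and column.\<close>

lemma corr_kernel_vev:
  obtains z where "vev 1 * z = (1 :: 'a::field_char_0 series)"
    "\<And>i j. corr_kernel (half i) (half j) = z * (vev (cre i * ann j) :: 'a series)"
proof -
  obtain e e' :: "'a series" where e: "e * e' = 1" "gp * gm = scal e * (gm * gp)"
    using lexp_ham_commute[OF time_seq_tx time_seq_ty] by blast
  let ?gp' = "lexp (- ham 1 tx) :: 'a wop" and ?gm' = "lexp (- ham (- 1) ty) :: 'a wop"
  note op = op_ord_ham[OF time_seq_tx] and om = op_ord_ham[OF time_seq_ty]
  note inv = lexp_minus[OF op] lexp_minus[OF om]
  have inv': "gp * (?gp' * M) = M" "?gp' * (gp * M) = M" "gm * (?gm' * M) = M" "?gm' * (gm * M) = M" for M :: "'a wop"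
    by (simp_all add: mult.assoc[symmetric] inv)
  have G: "G_op = appl (gp * ?gm')"
    unfolding G_op_def Gamma_plus_appl[OF time_seq_tx] Gamma_minus_appl[OF time_seq_ty] inv_appl[OF inv(3,4)]
    by (rule ext) (simp add: appl_mult)
  have G': "inv_into UNIV G_op = appl (gm * ?gp')"
    unfolding G by (rule inv_appl) (simp_all add: mult.assoc inv' inv)
  have col: "ent ?gp' T vac = ent 1 T vac" "ent gp T vac = ent 1 T vac" for T
    by (rule ent_lexp_column; simp add: op op_ord_uminus ham_vacuum_column[OF time_seq_tx, of _ 0])+
  have row: "ent ?gm' vac T = ent 1 vac T" "ent gm vac T = ent 1 vac T" for T
    by (rule ent_lexp_row; simp add: om op_ord_uminus ham_vacuum_row[OF time_seq_ty, of _ 0])+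
  \<comment> \<open>Multiplication by \<open>?gm'\<close> on both sides converts the relation of
    \<open>gp\<close> with \<open>gm\<close> into one of \<open>gp\<close> with the inverse of
    \<open>gm\<close>.\<close>
  have "?gm' * (gp * gm) * ?gm' = ?gm' * (scal e * (gm * gp)) * ?gm'" by (simp only: e)
  hence "?gm' * gp = scal e * (gp * ?gm')"
    by (simp add: mult.assoc inv inv' scal_left_commute)
  hence "scal e' * (?gm' * gp) = scal (e' * e) * (gp * ?gm')" by (simp add: scal_mult mult.assoc)
  hence swap: "gp * ?gm' = scal e' * (?gm' * gp)" using e(1) by (simp add: mult.commute)
  \<comment> \<open>In the order \<open>gm * gp\<close> each factor meets the side of the vacuum
    that it fixes, so only the scalar is left.\<close>
  have "vev 1 = ent (scal e * (gm * gp)) vac vac" by (simp add: vev_def e(2))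
  also have "\<dots> = e" by (simp add: ent_mult_trivial_row[OF row(2)] col(2) ent_one)
  finally have "vev 1 * e' = 1" using e(1) by simp
  moreover have "corr_kernel (half i) (half j) = e' * vev (cre i * ann j)" for i j
  proof -
    have vacuum: "vacuum = (\<lambda>S'. if S' = vac then 1 else (0 :: 'a series))"
      by (simp add: vacuum_def wedge_basis_def vac_def of_occ_def neg_half_ints_eq)
    have "Psi (half i) (Psi_star (half j) vacuum) = appl (gp * ?gm' * (cre i * ann j) * gm * ?gp') vacuum"
      unfolding Psi_def Psi_star_def G' unfolding G o_def appl_psi appl_psi_star
      by (simp only: appl_mult[symmetric] mult.assoc inv')
    also have "gp * ?gm' * (cre i * ann j) * gm * ?gp' = scal e' * (?gm' * ((gp * (cre i * ann j) * gm) * ?gp'))"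
      unfolding swap by (simp add: mult.assoc)
    finally have "corr_kernel (half i) (half j) =
        appl (scal e' * (?gm' * ((gp * (cre i * ann j) * gm) * ?gp'))) vacuum vac"
      unfolding corr_kernel_def wedge_inner_def
      by (subst mfps_sum_single[of vac]) (auto simp: vacuum)
    also have "\<dots> = e' * vev (cre i * ann j)"
      unfolding vacuum appl_basis ent_scal_mult ent_mult_trivial_row[OF row(1)]
        ent_mult_trivial_column[OF col(1)] vev_def ..
    finally show ?thesis .
  qed
  ultimately show ?thesis by (rule that)
qed

section \<open>Wick's theorem\<close>

text \<open>\<open>lift1\<close> and \<open>lift2\<close> are M \<otimes> 1 and 1 \<otimes> M in the
  ungraded tensor square: fermions in different factors commute, so signs arise only within one
  factor.\<close>

definition lift1 :: "('i, 'v, 'a::comm_ring_1) lop \<Rightarrow> ('i \<times> 'j, 'v, 'a) lop" where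
  "lift1 M = Lop (\<lambda>(S, T) (S', T'). if T = T' then ent M S S' else 0)"

definition lift2 :: "('j, 'v, 'a::comm_ring_1) lop \<Rightarrow> ('i \<times> 'j, 'v, 'a) lop" where
  "lift2 M = Lop (\<lambda>(S, T) (S', T'). if S = S' then ent M T T' else 0)"

lemma ent_lift1: "ent (lift1 M) (S, T) (S', T') = (if T = T' then ent M S S' else 0)"
proof -
  have "locfin (\<lambda>p. case p of (S', T') \<Rightarrow> if T = T' then ent M S S' else 0) UNIV" for S T
  proof
    fix m
    have "finite ((\<lambda>S'. (S', T)) ` {S' \<in> UNIV. mcoeff (ent M S S') m \<noteq> 0})"
      by (intro finite_imageI locfinD locfin_ent)
    thus "finite {p \<in> UNIV. mcoeff (case p of (S', T') \<Rightarrow> if T = T' then ent M S S' else 0) m \<noteq> 0}"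
      by (rule rev_finite_subset) (auto split: if_splits)
  qed
  thus ?thesis unfolding lift1_def by (subst ent_Lop) auto
qed

lemma ent_lift2: "ent (lift2 M) (S, T) (S', T') = (if S = S' then ent M T T' else 0)"
proof -
  have "locfin (\<lambda>p. case p of (S', T') \<Rightarrow> if S = S' then ent M T T' else 0) UNIV" for S T
  proof
    fix m
    have "finite ((\<lambda>T'. (S, T')) ` {T' \<in> UNIV. mcoeff (ent M T T') m \<noteq> 0})"
      by (intro finite_imageI locfinD locfin_ent)
    thus "finite {p \<in> UNIV. mcoeff (case p of (S', T') \<Rightarrow> if S = S' then ent M T T' else 0) m \<noteq> 0}"
      by (rule rev_finite_subset) (auto split: if_splits)
  qed
  thus ?thesis unfolding lift2_def by (subst ent_Lop) auto
qed

lemma ent_lift1_mult: "ent (lift1 M * N) (S, T) U = mfps_sum (\<lambda>S'. ent M S S' * ent N (S', T) U) UNIV"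
proof -
  have "ent (lift1 M * N) (S, T) U = mfps_sum (\<lambda>p. ent (lift1 M) (S, T) p * ent N p U) (range (\<lambda>S'. (S', T)))"
    unfolding ent_mult by (rule mfps_sum_mono_neutral) (auto simp: ent_lift1 image_iff)
  thus ?thesis by (simp add: mfps_sum_reindex inj_def o_def ent_lift1)
qed

lemma ent_lift2_mult: "ent (lift2 M * N) (S, T) U = mfps_sum (\<lambda>T'. ent M T T' * ent N (S, T') U) UNIV"
proof -
  have "ent (lift2 M * N) (S, T) U = mfps_sum (\<lambda>p. ent (lift2 M) (S, T) p * ent N p U) (range (\<lambda>T'. (S, T')))"
    unfolding ent_mult by (rule mfps_sum_mono_neutral) (auto simp: ent_lift2 image_iff)
  thus ?thesis by (simp add: mfps_sum_reindex inj_def o_def ent_lift2)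
qed

lemma lop_pair_eqI: "(\<And>S T S' T'. ent M (S, T) (S', T') = ent N (S, T) (S', T')) \<Longrightarrow> M = N"
  by (rule lop_eqI) auto

lemma lift1_mult: "lift1 (M * N) = lift1 M * lift1 N"
  by (rule lop_pair_eqI, unfold ent_lift1_mult ent_lift1) (auto simp: ent_mult)
lemma lift2_mult: "lift2 (M * N) = lift2 M * lift2 N"
  by (rule lop_pair_eqI, unfold ent_lift2_mult ent_lift2) (auto simp: ent_mult)
lemma lift1_one [simp]: "lift1 1 = 1" by (rule lop_pair_eqI) (simp add: ent_lift1 ent_one)
lemma lift2_one [simp]: "lift2 1 = 1" by (rule lop_pair_eqI) (simp add: ent_lift2 ent_one)
lemma lift1_zero [simp]: "lift1 0 = 0" by (rule lop_pair_eqI) (simp add: ent_lift1)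
lemma lift2_zero [simp]: "lift2 0 = 0" by (rule lop_pair_eqI) (simp add: ent_lift2)
lemma lift1_add: "lift1 (M + N) = lift1 M + lift1 N" by (rule lop_pair_eqI) (simp add: ent_lift1)
lemma lift2_add: "lift2 (M + N) = lift2 M + lift2 N" by (rule lop_pair_eqI) (simp add: ent_lift2)
lemma lift1_diff: "lift1 (M - N) = lift1 M - lift1 N" by (rule lop_pair_eqI) (simp add: ent_lift1)
lemma lift2_uminus: "lift2 (- N) = - lift2 N" by (rule lop_pair_eqI) (simp add: ent_lift2)
lemma lift1_scal_mult: "lift1 (scal c * M) = scal c * lift1 M" by (rule lop_pair_eqI) (simp add: ent_lift1)
lemma lift2_scal_mult: "lift2 (scal c * M) = scal c * lift2 M" by (rule lop_pair_eqI) (simp add: ent_lift2)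

lemma ent_lift_lift: "ent (lift1 M * lift2 N) (S, T) (S', T') = ent M S S' * ent N T T'"
  unfolding ent_lift1_mult by (subst mfps_sum_single[of S']) (auto simp: ent_lift2)

lemma lift_commute: "lift2 N * lift1 M = lift1 M * lift2 N"
proof (rule lop_pair_eqI)
  fix S S' T T'
  show "ent (lift2 N * lift1 M) (S, T) (S', T') = ent (lift1 M * lift2 N) (S, T) (S', T')"
    unfolding ent_lift_lift ent_lift2_mult
    by (subst mfps_sum_single[of T']) (auto simp: ent_lift1 mult.commute)
qed

lemma lift_left_commute: "lift2 N * (lift1 M * X) = lift1 M * (lift2 N * X)"
  by (simp add: mult.assoc[symmetric] lift_commute)

lemma summable_lift1:
  assumes "lop_summable f I" shows "lop_summable (\<lambda>i. lift1 (f i)) I"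
  unfolding lop_summable_def
proof (intro allI locfinI)
  fix p :: "'b \<times> 'e" and m
  obtain S T where p: "p = (S, T)" by (metis surj_pair)
  have "finite ((\<lambda>(i, S'). (i, (S', T))) ` {q \<in> I \<times> UNIV. mcoeff (case q of (i, S') \<Rightarrow> ent (f i) S S') m \<noteq> 0})"
    by (intro finite_imageI locfinD lop_summableD assms)
  thus "finite {q \<in> I \<times> UNIV. mcoeff (case q of (i, U) \<Rightarrow> ent (lift1 (f i)) p U) m \<noteq> 0}"
    by (rule rev_finite_subset) (force simp: p ent_lift1 image_iff split: if_splits)
qed

lemma summable_lift2:
  assumes "lop_summable f I" shows "lop_summable (\<lambda>i. lift2 (f i)) I"
  unfolding lop_summable_def
proof (intro allI locfinI)
  fix p :: "'e \<times> 'b" and m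
  obtain S T where p: "p = (S, T)" by (metis surj_pair)
  have "finite ((\<lambda>(i, T'). (i, (S, T'))) ` {q \<in> I \<times> UNIV. mcoeff (case q of (i, T') \<Rightarrow> ent (f i) T T') m \<noteq> 0})"
    by (intro finite_imageI locfinD lop_summableD assms)
  thus "finite {q \<in> I \<times> UNIV. mcoeff (case q of (i, U) \<Rightarrow> ent (lift2 (f i)) p U) m \<noteq> 0}"
    by (rule rev_finite_subset) (force simp: p ent_lift2 image_iff split: if_splits)
qed

lemma lift1_lop_sum: "lop_summable f I \<Longrightarrow> lift1 (lop_sum f I) = lop_sum (\<lambda>i. lift1 (f i)) I"
  by (rule lop_pair_eqI) (simp add: ent_lift1 ent_lop_sum summable_lift1)

lemma lift2_lop_sum: "lop_summable f I \<Longrightarrow> lift2 (lop_sum f I) = lop_sum (\<lambda>i. lift2 (f i)) I"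
  by (rule lop_pair_eqI) (simp add: ent_lift2 ent_lop_sum summable_lift2)

lemma lift1_power: "lift1 (M ^ n) = lift1 M ^ n" by (induction n) (auto simp: lift1_mult)
lemma lift2_power: "lift2 (M ^ n) = lift2 M ^ n" by (induction n) (auto simp: lift2_mult)

lemma lift1_lexp: "op_ord UNIV (Suc 0) A \<Longrightarrow> lift1 (lexp A) = lexp (lift1 A)"
  unfolding lexp_def
  by (simp add: lift1_lop_sum summable_exp_term exp_term_def[abs_def] cs_def lift1_scal_mult lift1_power
      summable_exp_term[unfolded exp_term_def[abs_def] cs_def])

lemma lift2_lexp: "op_ord UNIV (Suc 0) A \<Longrightarrow> lift2 (lexp A) = lexp (lift2 A)"
  unfolding lexp_def
  by (simp add: lift2_lop_sum summable_exp_term exp_term_def[abs_def] cs_def lift2_scal_mult lift2_power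
      summable_exp_term[unfolded exp_term_def[abs_def] cs_def])

lemma op_ord_lift1: "op_ord V d A \<Longrightarrow> op_ord V d (lift1 A)"
  by (auto simp: op_ord_def ent_lift1)
lemma op_ord_lift2: "op_ord V d A \<Longrightarrow> op_ord V d (lift2 A)"
  by (auto simp: op_ord_def ent_lift2)

subsection \<open>The Casimir operator\<close>

type_synonym 'a wop2 = "(semi_inf \<times> semi_inf, nat + nat, 'a) lop"

text \<open>The Casimir operator is the case n = 0; the shifted families appear in its commutator
  with \<open>cur n\<close>.\<close>

definition cas_term :: "int \<Rightarrow> int \<Rightarrow> 'a::comm_ring_1 wop2" where
  "cas_term n k = lift1 (ann (k + n)) * lift2 (cre k)"

definition cas :: "'a::comm_ring_1 wop2" where "cas = lop_sum (cas_term 0) UNIV"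

lemma ent_cas_term: "ent (cas_term n k) (S, T) (S', T') = ent (ann (k + n)) S S' * ent (cre k) T T'"
  unfolding cas_term_def ent_lift_lift ..

text \<open>A nonzero term needs \<open>k + n\<close> empty in S, which bounds k below, and k
  occupied in T, which bounds k above.\<close>

lemma summable_cas_term: "lop_summable (cas_term n) UNIV"
proof (rule lop_summable_finite_rows)
  fix p :: "semi_inf \<times> semi_inf"
  obtain S T where p: "p = (S, T)" by (metis surj_pair)
  have "{k \<in> UNIV. \<exists>q. ent (cas_term n k) p q \<noteq> 0} \<subseteq> (\<lambda>k. k - n) ` {s. s < n \<and> s \<notin> occ S} \<union> {s \<in> occ T. - 1 < s}"
  proof (intro subsetI)
    fix k assume "k \<in> {k \<in> UNIV. \<exists>q. ent (cas_term n k) p q \<noteq> 0}"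
    hence "k + n \<notin> occ S" "k \<in> occ T"
      by (auto simp: p ent_cas_term ent_ann ent_cre split: if_splits)
    thus "k \<in> (\<lambda>k. k - n) ` {s. s < n \<and> s \<notin> occ S} \<union> {s \<in> occ T. - 1 < s}"
      by (cases "k < 0") (auto intro!: rev_image_eqI[of "k + n"])
  qed
  thus "finite {k \<in> UNIV. \<exists>q. ent (cas_term n k) p q \<noteq> 0}"
    by (rule finite_subset) (auto intro: finite_above finite_below)
qed

lemma cas_cre2: "cas * lift2 (cre a) = - (lift2 (cre a) * cas :: 'a::comm_ring_1 wop2)"
proof -
  have "cas_term 0 k * lift2 (cre a) = - (lift2 (cre a) * cas_term 0 k :: 'a wop2)" for k
    by (simp add: cas_term_def mult.assoc lift2_mult[symmetric] lift_left_commute cre_cre[of k a] lift2_uminus)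
  thus ?thesis
    unfolding cas_def by (simp add: lop_sum_left lop_sum_right summable_cas_term lop_sum_uminus[symmetric] lop_summable_left)
qed

text \<open>The contraction with the creator in \<open>cas\<close> transports the annihilator from
  the second factor to the first. These transported fermions become the entries in the expansion of
  the determinant.\<close>

lemma cas_ann2: "cas * lift2 (ann b) = (lift1 (ann b) - lift2 (ann b) * cas :: 'a::comm_ring_1 wop2)"
proof -
  have "cas_term 0 k * lift2 (ann b) + lift2 (ann b) * cas_term 0 k = (if k = b then lift1 (ann b) else 0 :: 'a wop2)" for k
    by (simp add: cas_term_def mult.assoc lift2_mult[symmetric] lift_left_commute ann_cre[of b k]
        distrib_left[symmetric] lift2_add[symmetric])
  hence "cas * lift2 (ann b) + lift2 (ann b) * cas = lop_sum (\<lambda>k. if k = b then lift1 (ann b) else 0 :: 'a wop2) UNIV"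
    unfolding cas_def
    by (simp add: lop_sum_left lop_sum_right summable_cas_term lop_sum_add[symmetric] lop_summable_left lop_summable_right)
  also have "\<dots> = lift1 (ann b)" by (subst lop_sum_single[of b]) auto
  finally show ?thesis by (simp add: eq_diff_eq)
qed

lemma cre1_cas: "lift1 (cre a) * cas = (lift2 (cre a) - cas * lift1 (cre a) :: 'a::comm_ring_1 wop2)"
proof -
  have "lift1 (cre a) * cas_term 0 k + cas_term 0 k * lift1 (cre a) = (if k = a then lift2 (cre a) else 0 :: 'a wop2)" for k
    by (simp add: cas_term_def mult.assoc lift_commute)
      (simp add: mult.assoc[symmetric] lift1_mult[symmetric] ann_cre distrib_right[symmetric] lift1_add[symmetric])
  hence "lift1 (cre a) * cas + cas * lift1 (cre a) = lop_sum (\<lambda>k. if k = a then lift2 (cre a) else 0 :: 'a wop2) UNIV"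
    unfolding cas_def
    by (simp add: lop_sum_left lop_sum_right summable_cas_term lop_sum_add[symmetric] lop_summable_left lop_summable_right)
  also have "\<dots> = lift2 (cre a)" by (subst lop_sum_single[of a]) auto
  finally show ?thesis by (simp add: eq_diff_eq)
qed

text \<open>The two factors contribute the same shifted family, once at k - n and once at k with the
  opposite sign.\<close>

lemma cas_cur:
  assumes "n \<noteq> 0"
  shows "(lift1 (cur n) + lift2 (cur n)) * cas = (cas * (lift1 (cur n) + lift2 (cur n)) :: 'a::comm_ring_1 wop2)"
proof -
  let ?K = "lift1 (cur n) + lift2 (cur n) :: 'a wop2"
  have "?K * cas_term 0 k - cas_term 0 k * ?K = cas_term n (k - n) - cas_term n k" for k
  proof -
    have "lift1 (cur n) * cas_term 0 k = cas_term 0 k * lift1 (cur n) - (cas_term n k :: 'a wop2)"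
    proof -
      have "lift1 (cur n) * cas_term 0 k = (lift1 (cur n * ann k) * lift2 (cre k) :: 'a wop2)"
        by (simp add: cas_term_def mult.assoc lift1_mult)
      thus ?thesis
        by (simp add: cur_ann[OF assms] lift1_diff left_diff_distrib cas_term_def lift1_mult mult.assoc lift_commute)
    qed
    moreover have "lift2 (cur n) * cas_term 0 k = cas_term 0 k * lift2 (cur n) + (cas_term n (k - n) :: 'a wop2)"
    proof -
      have "lift2 (cur n) * cas_term 0 k = (lift1 (ann k) * lift2 (cur n * cre k) :: 'a wop2)"
        by (simp add: cas_term_def lift2_mult lift_left_commute)
      thus ?thesis
        by (simp add: cur_cre[OF assms] lift2_add distrib_left cas_term_def lift2_mult mult.assoc)
    qed
    ultimately show ?thesis by (simp add: distrib_right distrib_left)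
  qed
  hence "?K * cas - cas * ?K = lop_sum (\<lambda>k. cas_term n (k - n) - cas_term n k :: 'a wop2) UNIV"
    unfolding cas_def
    by (simp add: lop_sum_left lop_sum_right summable_cas_term lop_sum_diff[symmetric] lop_summable_left lop_summable_right)
  \<comment> \<open>Each shifted family is summable on its own, so the telescoping difference may be
    split and one half reindexed.\<close>
  also have "\<dots> = lop_sum (\<lambda>k. cas_term n (k - n)) UNIV - lop_sum (cas_term n) UNIV"
  proof (rule lop_sum_diff)
    show "lop_summable (\<lambda>k. cas_term n (k - n) :: 'a wop2) UNIV"
      by (rule lop_summable_reindex) (auto simp: inj_on_def intro: lop_summable_subset[OF summable_cas_term])
  qed (rule summable_cas_term)
  also have "lop_sum (\<lambda>k. cas_term n (k - n)) UNIV = (lop_sum (cas_term n) UNIV :: 'a wop2)"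
    by (rule lop_sum_bij_betw[symmetric]) (rule bij_betwI[where g = "\<lambda>k. k + n"], auto)
  finally show ?thesis by simp
qed

text \<open>The summands H \<otimes> 1 and 1 \<otimes> H commute, so the exponential of their sum is
  exp(H) \<otimes> exp(H), and commutation need only be checked for the sum.\<close>

lemma cas_lexp_ham:
  assumes s: "time_seq s" and \<epsilon>: "\<epsilon> \<noteq> 0"
  shows "lift1 (lexp (ham \<epsilon> s)) * lift2 (lexp (ham \<epsilon> s)) * cas =
    cas * (lift1 (lexp (ham \<epsilon> s)) * lift2 (lexp (ham \<epsilon> s)))"
proof -
  let ?H = "ham \<epsilon> s" and ?f = "\<lambda>n. scal (s n) * cur (\<epsilon> * int n)"
  let ?K = "\<lambda>n. scal (s n) * (lift1 (cur (\<epsilon> * int n)) + lift2 (cur (\<epsilon> * int n)))"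
  have sum: "lop_summable ?K {1..}" by (rule summable_time_seq[OF s])
  have H: "lift1 ?H + lift2 ?H = lop_sum ?K {1..}"
    unfolding ham_def lift1_lop_sum[OF summable_time_seq[OF s]] lift2_lop_sum[OF summable_time_seq[OF s]]
    by (subst lop_sum_add[symmetric])
      (simp_all add: summable_lift1 summable_lift2 summable_time_seq s lift1_scal_mult lift2_scal_mult distrib_left)
  have "(lift1 ?H + lift2 ?H) * cas = cas * (lift1 ?H + lift2 ?H)"
    unfolding H lop_sum_left[OF sum] lop_sum_right[OF sum]
    by (rule lop_sum_cong) (use \<epsilon> in \<open>simp_all add: mult.assoc cas_cur scal_left_commute\<close>)
  hence "lexp (lift1 ?H + lift2 ?H) * cas = cas * lexp (lift1 ?H + lift2 ?H)"
    by (rule lexp_intertwine) (intro op_ord_add op_ord_lift1 op_ord_lift2 op_ord_ham s)+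
  moreover have "lexp (lift1 ?H + lift2 ?H) = lift1 (lexp ?H) * lift2 (lexp ?H)"
    unfolding lift1_lexp[OF op_ord_ham[OF s]] lift2_lexp[OF op_ord_ham[OF s]]
    by (rule lexp_add) (intro op_ord_lift1 op_ord_lift2 op_ord_ham s lift_commute[symmetric])+
  ultimately show ?thesis by simp
qed

text \<open>In every term the output has k empty in the first factor and occupied in the second,
  which cannot happen when both are the vacuum. On the vacuum column, \<open>ann k\<close> kills for
  k \<ge> 0 and \<open>cre k\<close> for k < 0.\<close>

lemma cas_vac_row: "ent cas (vac, vac) p = 0"
proof -
  obtain S T where p: "p = (S, T)" by (metis surj_pair)
  show ?thesis unfolding cas_def ent_lop_sum[OF summable_cas_term] p
    by (rule mfps_sum_zero') (simp add: ent_cas_term ent_ann ent_cre)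
qed

lemma cas_vac_column: "ent cas p (vac, vac) = 0"
proof -
  obtain S T where p: "p = (S, T)" by (metis surj_pair)
  have "ent (ann k) S vac * ent (cre k) T vac = 0" for k
  proof (cases "k < 0")
    case True
    hence "vac \<noteq> del k T" by (intro del_neq) simp
    thus ?thesis by (simp add: ent_cre)
  next
    case False
    hence "vac \<noteq> ins k S" by (intro ins_neq) simp
    thus ?thesis by (simp add: ent_ann)
  qed
  thus ?thesis unfolding cas_def ent_lop_sum[OF summable_cas_term] p
    by (intro mfps_sum_zero') (simp add: ent_cas_term)
qed

definition vev2 :: "'a::field_char_0 wop2 \<Rightarrow> 'a series" where
  "vev2 X = ent (lift1 gp * lift2 gp * X * (lift1 gm * lift2 gm)) (vac, vac) (vac, vac)"

lemma vev2_lift: "vev2 (lift1 M * lift2 N) = vev M * vev N"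
proof -
  have "lift1 gp * lift2 gp * (lift1 M * lift2 N) * (lift1 gm * lift2 gm) = lift1 (gp * M * gm) * lift2 (gp * N * gm)"
    by (simp add: mult.assoc lift1_mult lift2_mult lift_left_commute)
  thus ?thesis by (simp add: vev2_def vev_def ent_lift_lift)
qed

lemma vev2_cas_left: "vev2 (cas * X) = 0" for X :: "'a::field_char_0 wop2"
proof -
  have "lift1 gp * lift2 gp * (cas * X) * (lift1 gm * lift2 gm) = cas * (lift1 gp * lift2 gp * X * (lift1 gm * lift2 gm))"
    using cas_lexp_ham[where 'a = 'a, OF time_seq_tx, of 1] by (simp add: mult.assoc[symmetric])
  thus ?thesis unfolding vev2_def by (simp add: ent_mult[of cas] cas_vac_row)
qed

lemma vev2_cas_right: "vev2 (X * cas) = 0" for X :: "'a::field_char_0 wop2"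
proof -
  have "lift1 gp * lift2 gp * (X * cas) * (lift1 gm * lift2 gm) = (lift1 gp * lift2 gp * X * (lift1 gm * lift2 gm)) * cas"
    using cas_lexp_ham[where 'a = 'a, OF time_seq_ty, of "- 1"] by (simp add: mult.assoc)
  thus ?thesis unfolding vev2_def by (simp add: ent_mult[of _ cas] cas_vac_column)
qed

lemma vev2_add: "vev2 (X + Y) = vev2 X + vev2 Y" by (simp add: vev2_def distrib_left distrib_right)
lemma vev2_diff: "vev2 (X - Y) = vev2 X - vev2 Y" by (simp add: vev2_def right_diff_distrib left_diff_distrib)
lemma vev2_zero [simp]: "vev2 0 = 0" by (simp add: vev2_def)
lemma vev2_sum: "vev2 (sum f A) = (\<Sum>i\<in>A. vev2 (f i))"
  by (induction A rule: infinite_finite_induct) (auto simp: vev2_add)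
lemma vev2_scal: "vev2 (scal c * X) = c * vev2 X"
  by (simp add: vev2_def scal_left_commute mult.assoc)

section \<open>Products of fermions and the Laplace expansion\<close>

fun cres :: "int list \<Rightarrow> 'a::comm_ring_1 wop" where
  "cres [] = 1" | "cres (a # as) = cre a * cres as"

text \<open>The reversed order makes \<open>cres as * anns as\<close> nest as
  \<open>cre a * ... * ann a\<close>, a projection without sign.\<close>

fun anns :: "int list \<Rightarrow> 'a::comm_ring_1 wop" where
  "anns [] = 1" | "anns (b # bs) = anns bs * ann b"

definition omit :: "nat \<Rightarrow> 'b list \<Rightarrow> 'b list" where "omit i xs = take i xs @ drop (Suc i) xs"

lemma omit_0 [simp]: "omit 0 (x # xs) = xs" by (simp add: omit_def)
lemma omit_Suc [simp]: "omit (Suc i) (x # xs) = x # omit i xs" by (simp add: omit_def)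
lemma length_omit: "i < length xs \<Longrightarrow> length (omit i xs) = length xs - 1" by (simp add: omit_def)

lemma nth_omit: "i < length xs \<Longrightarrow> j < length xs - 1 \<Longrightarrow> omit i xs ! j = xs ! (if j < i then j else Suc j)"
  by (auto simp: omit_def nth_append min_def)

lemma cas_cres: "cas * lift2 (cres as) = scal ((- 1) ^ length as) * (lift2 (cres as) * cas :: 'a::comm_ring_1 wop2)"
proof (induction as)
  case (Cons a as)
  have "cas * lift2 (cres (a # as)) = - (lift2 (cre a) * (cas * lift2 (cres as)) :: 'a wop2)"
    by (simp add: lift2_mult mult.assoc[symmetric] cas_cre2)
  thus ?case by (simp add: Cons scal_left_commute scal_uminus lift2_mult mult.assoc)
qed simp

text \<open>In \<open>anns bs\<close> the last entry of \<open>bs\<close> stands leftmost, so the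
  Casimir operator passes \<open>length bs - 1 - i\<close> annihilators before it meets
  \<open>bs ! i\<close>.\<close>

lemma cas_anns:
  "cas * lift2 (anns bs) =
     (\<Sum>i<length bs. scal ((- 1) ^ (length bs - 1 - i)) * (lift1 (ann (bs ! i)) * lift2 (anns (omit i bs)))) +
     scal ((- 1) ^ length bs) * (lift2 (anns bs) * cas :: 'a::comm_ring_1 wop2)"
proof (induction bs)
  case (Cons b bs)
  let ?n = "length bs"
  have "cas * lift2 (anns (b # bs)) = (cas * lift2 (anns bs) * lift2 (ann b) :: 'a wop2)"
    by (simp add: lift2_mult mult.assoc)
  also have "\<dots> = (\<Sum>i<?n. scal ((- 1) ^ (?n - 1 - i)) * (lift1 (ann (bs ! i)) * lift2 (anns (omit i bs)))) * lift2 (ann b) +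
     scal ((- 1) ^ ?n) * (lift2 (anns bs) * (cas * lift2 (ann b)))"
    by (simp only: Cons distrib_right mult.assoc)
  also have "(\<Sum>i<?n. scal ((- 1) ^ (?n - 1 - i)) * (lift1 (ann (bs ! i)) * lift2 (anns (omit i bs)))) * (lift2 (ann b) :: 'a wop2) =
     (\<Sum>i<?n. scal ((- 1) ^ (Suc ?n - 1 - Suc i)) * (lift1 (ann ((b # bs) ! Suc i)) * lift2 (anns (omit (Suc i) (b # bs)))))"
    by (simp add: sum_distrib_right mult.assoc lift2_mult)
  also have "scal ((- 1) ^ ?n) * (lift2 (anns bs) * (cas * lift2 (ann b) :: 'a wop2)) =
     scal ((- 1) ^ (Suc ?n - 1 - 0)) * (lift1 (ann ((b # bs) ! 0)) * lift2 (anns (omit 0 (b # bs)))) +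
     scal ((- 1) ^ Suc ?n) * (lift2 (anns (b # bs)) * cas)"
    by (simp add: cas_ann2 right_diff_distrib lift_commute lift2_mult mult.assoc scal_uminus)
  finally show ?case
    by (simp only: length_Cons sum.lessThan_Suc_shift add.assoc add.left_commute)
qed simp

text \<open>Moved to the left, the Casimir operator leaves only its contraction with
  \<open>cre a\<close>, that is, \<open>vev 1\<close> times the full expectation. Moved to the
  right, it leaves one contraction for each annihilator.\<close>

lemma vev_wick:
  assumes "length bs = Suc (length as)"
  shows "vev 1 * vev (cres (a # as) * anns bs) =
    (\<Sum>i<length bs. (- 1) ^ i * (vev (cre a * ann (bs ! i)) * vev (cres as * anns (omit i bs)) :: 'a::field_char_0 series))"
proof -
  let ?N = "cres as * anns bs :: 'a wop"
  have "lift1 (cre a) * cas * lift2 ?N = lift1 1 * lift2 (cre a * ?N) - cas * (lift1 (cre a) * lift2 ?N)"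
    by (simp add: cre1_cas left_diff_distrib lift2_mult mult.assoc)
  hence "vev2 (lift1 (cre a) * cas * lift2 ?N) = vev 1 * vev (cres (a # as) * anns bs)"
    by (simp only: vev2_diff vev2_lift vev2_cas_left cres.simps mult.assoc diff_zero)
  moreover have "lift1 (cre a) * cas * lift2 ?N = scal ((- 1) ^ length as) * (lift1 (cre a) * lift2 (cres as) * (cas * lift2 (anns bs)))"
  proof -
    have "lift1 (cre a) * cas * lift2 ?N = lift1 (cre a) * (cas * lift2 (cres as)) * lift2 (anns bs)"
      by (simp add: lift2_mult mult.assoc)
    thus ?thesis unfolding cas_cres by (simp add: mult.assoc scal_left_commute)
  qed
  moreover have "lift1 (cre a) * lift2 (cres as) * (cas * lift2 (anns bs)) =
      (\<Sum>i<length bs. scal ((- 1) ^ (length bs - 1 - i)) * (lift1 (cre a * ann (bs ! i)) * lift2 (cres as * anns (omit i bs)) :: 'a wop2)) +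
      scal ((- 1) ^ length bs) * ((lift1 (cre a) * lift2 (cres as) * lift2 (anns bs)) * cas)"
    unfolding cas_anns distrib_left sum_distrib_left
    by (simp add: mult.assoc scal_left_commute lift1_mult lift2_mult lift_left_commute)
  ultimately have "vev 1 * (vev (cres (a # as) * anns bs) :: 'a series) = (- 1) ^ length as *
      (\<Sum>i<length bs. (- 1) ^ (length bs - 1 - i) * (vev (cre a * ann (bs ! i)) * vev (cres as * anns (omit i bs))))"
    by (simp only: vev2_scal vev2_add vev2_sum vev2_lift vev2_cas_right mult_zero_right add_0_right)
  also have "\<dots> = (\<Sum>i<length bs. (- 1) ^ i * (vev (cre a * ann (bs ! i)) * vev (cres as * anns (omit i bs))))"
    unfolding sum_distrib_left
  proof (rule sum.cong[OF refl])
    fix i assume "i \<in> {..<length bs}"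
    \<comment> \<open>Put k = \<open>length as - i\<close>, which is also
      \<open>length bs - 1 - i\<close>. The signs of passing the creators and then k annihilators
      multiply to (-1)^(i + 2k) = (-1)^i.\<close>
    hence "length as = i + (length as - i)" using assms by auto
    then obtain k where k: "length as = i + k" by blast
    have "(- 1) ^ length as * (- 1) ^ (length bs - 1 - i) = ((- 1) ^ i :: 'a series)"
      by (simp add: assms k power_add[symmetric] mult_2[symmetric] add.assoc) (simp add: power_add mult_2[symmetric])
    thus "(- 1) ^ length as * ((- 1) ^ (length bs - 1 - i) * (vev (cre a * ann (bs ! i)) * vev (cres as * anns (omit i bs)))) =
       (- 1) ^ i * (vev (cre a * ann (bs ! i)) * (vev (cres as * anns (omit i bs)) :: 'a series))"
      by (simp only: mult.assoc[symmetric])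
  qed
  finally show ?thesis .
qed

text \<open>Each row of the expansion brings one z from the entry and one from the smaller minor,
  while Wick's theorem brings \<open>vev 1\<close>, which cancels one of them. The empty determinant
  1 is z times \<open>vev 1\<close>.\<close>

lemma det_vev:
  fixes z :: "'a::field_char_0 series"
  assumes z: "vev 1 * z = 1" and K: "\<And>a b. K a b = z * vev (cre a * ann b)"
  shows "length as = length bs \<Longrightarrow>
    det (mat (length as) (length as) (\<lambda>(i, j). K (as ! i) (bs ! j))) = z * vev (cres as * anns bs)"
proof (induction as arbitrary: bs)
  case Nil
  thus ?case using z by (simp add: mult.commute)
next
  case (Cons a as)
  let ?n = "length bs"
  define A where "A = mat ?n ?n (\<lambda>(i, j). K ((a # as) ! i) (bs ! j))"
  have A: "A \<in> carrier_mat ?n ?n" by (simp add: A_def)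
  have n: "?n = Suc (length as)" using Cons.prems by simp
  have minor: "det (mat_delete A 0 j) = z * vev (cres as * anns (omit j bs))" if "j < ?n" for j
  proof -
    have "mat_delete A 0 j = mat (length as) (length as) (\<lambda>(i, k). K (as ! i) (omit j bs ! k))"
      unfolding A_def mat_delete_def
      by (rule eq_matI) (use that n in \<open>auto simp: nth_omit\<close>)
    thus ?thesis using Cons.IH[of "omit j bs"] that n by (simp add: length_omit)
  qed
  have "det A = (\<Sum>j<?n. A $$ (0, j) * cofactor A 0 j)"
    by (rule laplace_expansion_row[OF A]) (simp add: n)
  also have "\<dots> = (\<Sum>j<?n. z * z * ((- 1) ^ j * (vev (cre a * ann (bs ! j)) * vev (cres as * anns (omit j bs)))))"
    by (rule sum.cong[OF refl]) (simp add: cofactor_def minor, simp add: A_def n K mult_ac)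
  also have "\<dots> = z * z * (vev 1 * vev (cres (a # as) * anns bs))"
    by (simp only: vev_wick[OF n] sum_distrib_left)
  also have "\<dots> = vev 1 * z * (z * vev (cres (a # as) * anns bs))" by (simp only: mult_ac)
  also have "\<dots> = z * vev (cres (a # as) * anns bs)" unfolding z by simp
  finally show ?case unfolding A_def using Cons.prems by simp
qed

text \<open>This is the projection onto the states that contain \<open>as\<close>: the outer
  \<open>cre a\<close> and \<open>ann a\<close> contribute the sign of a twice, and equality of
  \<open>del a S\<close> and \<open>del a T\<close> forces S = T.\<close>

lemma ent_cres_anns:
  assumes "distinct as"
  shows "ent (cres as * anns as) S T = (if S = T \<and> set as \<subseteq> occ S then 1 else (0 :: 'a::comm_ring_1 series))"
  using assms
proof (induction as arbitrary: S T)
  case Nil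
  show ?case by (simp add: ent_one)
next
  case (Cons a as)
  have "ent (cres (a # as) * anns (a # as)) S T = (ent (cre a * ((cres as * anns as) * ann a)) S T :: 'a series)"
    by (simp add: mult.assoc)
  also have "\<dots> = (if a \<in> occ S \<and> a \<in> occ T then sg a S * (sg a T * ent (cres as * anns as) (del a S) (del a T)) else 0)"
    unfolding ent_cre_mult ent_mult_ann by simp
  also have "\<dots> = (if S = T \<and> set (a # as) \<subseteq> occ S then 1 else 0)"
  proof (cases "a \<in> occ S \<and> a \<in> occ T")
    case True
    hence "del a S = del a T \<longleftrightarrow> S = T" by (metis ins_del)
    thus ?thesis using True Cons by auto
  qed auto
  finally show ?case .
qed

lemma vev_cres_anns:
  assumes "distinct as"
  shows "vev (cres as * anns as) = mfps_sum (\<lambda>S. ent gp vac S * (ent gm S vac :: 'a::field_char_0 series)) {S. set as \<subseteq> occ S}"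
proof -
  have "ent (gp * (cres as * anns as)) vac S = (if set as \<subseteq> occ S then ent gp vac S else 0 :: 'a series)" for S
    unfolding ent_mult[of gp] ent_cres_anns[OF assms] by (subst mfps_sum_single[of S]) auto
  hence "vev (cres as * anns as) = mfps_sum (\<lambda>S. (if set as \<subseteq> occ S then ent gp vac S else 0) * (ent gm S vac :: 'a series)) UNIV"
    unfolding vev_def ent_mult[of "gp * _"] by simp
  also have "\<dots> = mfps_sum (\<lambda>S. (if set as \<subseteq> occ S then ent gp vac S else 0) * ent gm S vac) {S. set as \<subseteq> occ S}"
    by (rule mfps_sum_mono_neutral) auto
  also have "\<dots> = mfps_sum (\<lambda>S. ent gp vac S * ent gm S vac) {S. set as \<subseteq> occ S}"
    by (rule mfps_sum_cong) auto
  finally show ?thesis .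
qed

section \<open>Transposes and vertex operators in one variable\<close>

text \<open>A relation instead of an operation, since the transpose of a row-finite matrix need not
  be row-finite.\<close>

definition transposes :: "('i, 'v, 'a::comm_ring_1) lop \<Rightarrow> ('i, 'v, 'a) lop \<Rightarrow> bool" where
  "transposes M N \<longleftrightarrow> (\<forall>S T. ent M S T = ent N T S)"

lemma transposes_mult: "transposes A B \<Longrightarrow> transposes C D \<Longrightarrow> transposes (A * C) (D * B)"
  by (simp add: transposes_def ent_mult mult.commute)

lemma transposes_one: "transposes 1 1" by (auto simp: transposes_def ent_one)

lemma transposes_scal_mult: "transposes A B \<Longrightarrow> transposes (scal c * A) (scal c * B)"
  by (simp add: transposes_def)

lemma transposes_power:
  assumes "transposes A B" shows "transposes (A ^ n) (B ^ n)"
proof (induction n)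
  case (Suc n)
  show ?case using transposes_mult[OF assms Suc] by (simp add: power_commutes)
qed (simp add: transposes_one)

lemma transposes_lop_sum:
  assumes "\<And>i. i \<in> I \<Longrightarrow> transposes (f i) (g i)" "lop_summable f I" "lop_summable g I"
  shows "transposes (lop_sum f I) (lop_sum g I)"
  unfolding transposes_def
proof (intro allI)
  fix S T
  show "ent (lop_sum f I) S T = ent (lop_sum g I) T S"
    unfolding ent_lop_sum[OF assms(2)] ent_lop_sum[OF assms(3)]
    by (rule mfps_sum_cong) (use assms(1) in \<open>auto simp: transposes_def\<close>)
qed

lemma transposes_lexp:
  assumes "transposes A B" "op_ord UNIV (Suc 0) A" "op_ord UNIV (Suc 0) B"
  shows "transposes (lexp A) (lexp B)"
  unfolding lexp_def
  by (rule transposes_lop_sum) (auto simp: exp_term_def cs_def assms intro!: transposes_scal_mult transposes_power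
      summable_exp_term)

lemma transposes_cre_ann:
  "transposes (cre k) (ann k :: 'a::comm_ring_1 wop)" "transposes (ann k) (cre k :: 'a wop)"
proof -
  have "ent (cre k) S T = (ent (ann k) T S :: 'a series)" for S T
    by (cases "k \<in> occ S \<and> T = del k S") (auto simp: ent_cre ent_ann)
  thus "transposes (cre k) (ann k :: 'a wop)" "transposes (ann k) (cre k :: 'a wop)"
    by (simp_all add: transposes_def)
qed

text \<open>The transpose of \<open>cre (k + n) * ann k\<close> is
  \<open>cre k * ann (k + n)\<close>, the term of \<open>cur n\<close> at k + n; hence the shift of
  the index.\<close>

lemma transposes_cur:
  assumes "n \<noteq> 0" shows "transposes (cur (- n)) (cur n :: 'a::comm_ring_1 wop)"
proof -
  have bij: "bij_betw (\<lambda>k. k + n) UNIV UNIV" by (rule bij_betwI[where g = "\<lambda>k. k - n"]) auto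
  have eq: "cur n = (lop_sum (\<lambda>k. cur_term n (k + n)) UNIV :: 'a wop)"
    unfolding cur_def by (rule lop_sum_bij_betw[OF bij])
  show ?thesis
    unfolding eq cur_def[of "- n"]
  proof (rule transposes_lop_sum)
    show "transposes (cur_term (- n) k) (cur_term n (k + n) :: 'a wop)" for k
      by (simp add: cur_term_def transposes_mult transposes_cre_ann)
    show "lop_summable (cur_term (- n) :: int \<Rightarrow> 'a wop) UNIV"
      by (rule summable_cur_term) (simp add: assms)
    show "lop_summable (\<lambda>k. cur_term n (k + n) :: 'a wop) UNIV"
      by (rule lop_summable_bij_betw[OF bij summable_cur_term[OF assms]])
  qed
qed

lemma transposes_ham:
  assumes "time_seq s" shows "transposes (ham (- 1) s) (ham 1 s)"
  unfolding ham_def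
  by (rule transposes_lop_sum) (auto intro!: transposes_scal_mult transposes_cur summable_time_seq assms)

lemma ent_lexp_ham_minus:
  assumes "time_seq s" shows "ent (lexp (ham (- 1) s)) S T = ent (lexp (ham 1 s)) T S"
  using transposes_lexp[OF transposes_ham[OF assms] op_ord_ham[OF assms] op_ord_ham[OF assms]]
  by (simp add: transposes_def)

lemma lop_sum_remove:
  assumes "a \<in> I" "lop_summable f I" shows "lop_sum f I = f a + lop_sum f (I - {a})"
proof -
  let ?g = "\<lambda>i. if i = a then f a else 0" and ?h = "\<lambda>i. if i = a then 0 else f i"
  have f: "f = (\<lambda>i. ?g i + ?h i)" by auto
  have g: "lop_summable ?g I" by (rule lop_summable_finite_rows) (auto intro: finite_subset[of _ "{a}"])
  have "lop_summable (\<lambda>i. f i - ?g i) I" by (rule lop_summable_diff[OF assms(2) g])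
  moreover have "(\<lambda>i. f i - ?g i) = ?h" by auto
  ultimately have h: "lop_summable ?h I" by simp
  have "lop_sum f I = lop_sum ?g I + lop_sum ?h I"
    by (subst f) (rule lop_sum_add[OF g h])
  also have "lop_sum ?g I = f a" by (subst lop_sum_single[of a]) (use assms in auto)
  also have "lop_sum ?h I = lop_sum ?h (I - {a})" by (rule lop_sum_mono_neutral) auto
  also have "\<dots> = lop_sum f (I - {a})" by (rule lop_sum_cong) auto
  finally show ?thesis .
qed

text \<open>The exponential of A becomes the identity when the variables in V are set to
  zero.\<close>

lemma op_ord_lexp_minus_one:
  assumes "op_ord V (Suc 0) A" shows "op_ord V (Suc 0) (lexp A - 1)"
proof -
  have A: "op_ord UNIV (Suc 0) A" using assms by (rule op_ord_UNIV)
  have "lexp A - 1 = lop_sum (exp_term A) (UNIV - {0})"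
    unfolding lexp_def by (subst lop_sum_remove[of 0]) (auto simp: summable_exp_term A)
  also have "op_ord V (Suc 0) \<dots>"
    by (rule op_ord_lop_sum[OF summable_exp_term[OF A]])
      (auto intro: op_ord_mono[OF op_ord_exp_term[OF assms]])
  finally show ?thesis .
qed

lemma ham_pos_commute:
  assumes "time_seq s" "time_seq s'"
  shows "ham 1 s * ham 1 s' = (ham 1 s' * ham 1 s :: 'a::comm_ring_1 wop)"
proof -
  have 1: "ham 1 s * cur (int m) = (cur (int m) * ham 1 s :: 'a wop)" if "m \<ge> 1" for m
    unfolding ham_def lop_sum_left[OF summable_time_seq[OF assms(1)]] lop_sum_right[OF summable_time_seq[OF assms(1)]]
    by (rule lop_sum_cong) (use that in \<open>auto simp: mult.assoc scal_left_commute[of "cur _"] cur_pos_commute\<close>)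
  show ?thesis
    unfolding ham_def[of 1 s'] lop_sum_left[OF summable_time_seq[OF assms(2)]] lop_sum_right[OF summable_time_seq[OF assms(2)]]
    by (rule lop_sum_cong) (use 1 in \<open>auto simp: mult.assoc scal_left_commute[of "ham _ _"]\<close>)
qed

lemma ham_cre:
  assumes "time_seq s"
  shows "ham 1 s * cre k = (cre k * ham 1 s + lop_sum (\<lambda>n. scal (s n) * cre (k - int n)) {1..} :: 'a::comm_ring_1 wop)"
proof -
  note sum = summable_time_seq[OF assms]
  have "cre k * ham 1 s + lop_sum (\<lambda>n. scal (s n) * cre (k - int n)) {1..} =
      (lop_sum (\<lambda>n. cre k * (scal (s n) * cur (1 * int n)) + scal (s n) * cre (k - int n)) {1..} :: 'a wop)"
    unfolding ham_def lop_sum_left[OF sum]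
    by (rule lop_sum_add[symmetric]) (intro lop_summable_left sum)+
  also have "\<dots> = ham 1 s * cre k"
    unfolding ham_def lop_sum_right[OF sum]
    by (rule lop_sum_cong) (auto simp: mult.assoc scal_left_commute[of "cre _"] cur_cre distrib_left)
  finally show ?thesis by simp
qed

section \<open>The vertex operator of a single variable\<close>

lemma euler_one [simp]: "euler V 1 = 0"
  by (rule mfps_eqI) (auto simp: mcoeff_one)

lemma euler_var: "v \<in> V \<Longrightarrow> euler V (mfps_var v) = mfps_var v"
  by (rule mfps_eqI) (auto simp: mfps_var_def degv_single)

lemma euler_power: "euler V x = x \<Longrightarrow> euler V (x ^ n) = of_nat n * x ^ n"
  by (induction n) (auto simp: euler_mult algebra_simps)

lemma euler_sg [simp]: "euler V (sg k S) = 0"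
proof -
  have "euler V ((- 1) ^ n) = 0" for n
    by (cases "even n") (auto simp: euler_diff[of V 0 1, simplified])
  thus ?thesis by (simp add: sg_def)
qed

lemma leuler_cre: "leuler V (cre k) = 0"
  by (rule lop_eqI) (simp add: ent_cre)

definition one_var :: "('v, 'a::field_char_0) mfps \<Rightarrow> nat \<Rightarrow> ('v, 'a) mfps" where
  "one_var x n = mfps_const (1 / of_nat n) * x ^ n"

lemma time_seq_one_var: "ord_ge UNIV (Suc 0) x \<Longrightarrow> time_seq (one_var x)"
  unfolding time_seq_def one_var_def
  using ord_ge_mult[OF ord_ge_0 ord_ge_power[of UNIV "Suc 0" x]] by force

lemma time_seq_power: "ord_ge UNIV (Suc 0) x \<Longrightarrow> time_seq (\<lambda>n. x ^ n)"
  unfolding time_seq_def using ord_ge_power[of UNIV "Suc 0" x] by simp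

lemma euler_one_var:
  assumes "euler V x = x" "n \<noteq> 0" shows "euler V (one_var x n) = x ^ n"
proof -
  have "euler V (one_var x n) = mfps_const (1 / of_nat n) * (mfps_const (of_nat n) * x ^ n)"
    by (simp add: one_var_def euler_const_mult euler_power[OF assms(1)] mfps_of_nat)
  also have "\<dots> = x ^ n"
    by (simp add: mult.assoc[symmetric] mfps_const_mult[symmetric] assms(2))
  finally show ?thesis .
qed

text \<open>
  With \<open>D\<close> the Euler derivation in the variable \<open>x\<close> and \<open>g = exp (\<Sum>n. x ^ n / n * cur n)\<close>, the
  operators \<open>Y k = g * cre k * inverse g\<close> satisfy \<open>D (Y k) = (\<Sum>n\<ge>1. x ^ n * Y (k - n))\<close>; hence
  \<open>Y k - x * Y (k - 1)\<close> does not depend on \<open>x\<close>, and at \<open>x = 0\<close> it is \<open>cre k\<close>.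
\<close>

lemma one_var_cre:
  fixes x :: "'a::field_char_0 series"
  assumes x: "x = mfps_var w"
  shows "lexp (ham 1 (one_var x)) * cre k =
    cre k * lexp (ham 1 (one_var x)) + scal x * (lexp (ham 1 (one_var x)) * cre (k - 1))"
proof -
  define V where "V = {w}"
  have ordV: "ord_ge V (Suc 0) x" unfolding x V_def by (rule ord_ge_var) simp
  hence ordx: "ord_ge UNIV (Suc 0) x" by (rule ord_ge_UNIV)
  have eul: "euler V x = x" unfolding x V_def by (rule euler_var) simp
  define H where "H = ham 1 (one_var x)"
  define P where "P = ham 1 (\<lambda>n. x ^ n)"
  define g where "g = lexp H"
  define g' where "g' = lexp (- H)"
  note t1 = time_seq_one_var[OF ordx] and t2 = time_seq_power[OF ordx]
  have H: "op_ord UNIV (Suc 0) H" unfolding H_def by (rule op_ord_ham[OF t1])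
  have P: "op_ord UNIV (Suc 0) P" unfolding P_def by (rule op_ord_ham[OF t2])
  have HV: "op_ord V (Suc 0) H"
    unfolding H_def ham_def
  proof (rule op_ord_lop_sum[OF summable_time_seq[OF t1]])
    fix n :: nat assume "n \<in> {1..}"
    hence "ord_ge V (Suc 0) (x ^ n)"
      using ord_ge_power[OF ordV, of n] by (auto intro: ord_ge_mono)
    hence "ord_ge V (Suc 0) (one_var x n)"
      unfolding one_var_def using ord_ge_mult[OF ord_ge_0] by fastforce
    thus "op_ord V (Suc 0) (scal (one_var x n) * cur (1 * int n))"
      by (intro op_ord_right op_ord_scal)
  qed
  have HP: "P * H = H * P" unfolding H_def P_def by (rule ham_pos_commute[OF t2 t1])
  have DH: "leuler V H = P"
    unfolding H_def P_def ham_def leuler_lop_sum[OF summable_time_seq[OF t1]]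
  proof (rule lop_sum_cong[OF refl])
    fix n :: nat assume "n \<in> {1..}"
    moreover have "leuler V (cur m) = (0 :: 'a wop)" if "m \<noteq> 0" for m
    proof -
      have ann0: "leuler V (ann k) = (0 :: 'a wop)" for k by (rule lop_eqI) (simp add: ent_ann)
      show ?thesis unfolding cur_def leuler_lop_sum[OF summable_cur_term[OF that]]
        by (subst lop_sum_mono_neutral[of "{}"]) (auto simp: cur_term_def leuler_mult leuler_cre ann0 lop_sum_finite)
    qed
    ultimately show "leuler V (scal (one_var x n) * cur (1 * int n)) = scal (x ^ n) * cur (1 * int n)"
      by (simp add: leuler_mult leuler_scal euler_one_var[OF eul])
  qed
  have Dg: "leuler V g = P * g"
    unfolding g_def DH[symmetric] by (rule leuler_lexp[OF H]) (simp add: DH HP)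
  have "leuler V (- H) = - P" using leuler_diff[of V 0 H] DH leuler_diff[of V 0 0] by simp
  moreover have "leuler V (lexp (- H)) = leuler V (- H) * lexp (- H)"
    by (rule leuler_lexp) (simp_all add: calculation HP op_ord_uminus H)
  ultimately have Dg': "leuler V g' = - (P * g')" by (simp add: g'_def)
  have gg': "g * g' = 1" "g' * g = 1" unfolding g_def g'_def by (rule lexp_minus[OF H])+
  have Pg: "P * g = g * P" unfolding g_def
    by (rule lexp_intertwine[OF HP[symmetric] H H, symmetric])
  define Y where "Y k = g * cre k * g'" for k
  define Q where "Q k = lop_sum (\<lambda>n. scal (x ^ n) * Y (k - int n)) {1..}" for k
  have DY: "leuler V (Y k) = Q k" for k
  proof -
    have "leuler V (Y k) = g * (P * cre k - cre k * P) * g'"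
      by (simp add: Y_def leuler_mult Dg Dg' leuler_cre Pg algebra_simps)
    also have "P * cre k - cre k * P = lop_sum (\<lambda>n. scal (x ^ n) * cre (k - int n)) {1..}"
      unfolding P_def ham_cre[OF t2] by simp
    also have "g * \<dots> * g' = Q k"
      unfolding Q_def Y_def
      by (simp add: lop_sum_left lop_sum_right summable_time_seq[OF t2] lop_summable_left mult.assoc scal_left_commute[of g])
    finally show ?thesis .
  qed
  \<comment> \<open>The series is geometric in x: after the term n = 1 is split off, the shift from
    n to n + 1 gives back the same series at k - 1.\<close>
  have Q: "Q k = scal x * Y (k - 1) + scal x * Q (k - 1)" for k
  proof -
    have s: "lop_summable (\<lambda>n. scal (x ^ n) * Y (k - int n)) {1..}" for k
      by (rule summable_time_seq[OF t2])
    have "Q k = scal x * Y (k - 1) + lop_sum (\<lambda>n. scal (x ^ n) * Y (k - int n)) ({1..} - {1})"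
      unfolding Q_def by (subst lop_sum_remove[OF _ s, of 1]) auto
    also have "lop_sum (\<lambda>n. scal (x ^ n) * Y (k - int n)) ({1..} - {1}) =
        lop_sum (\<lambda>n. scal (x ^ Suc n) * Y (k - int (Suc n))) {1..}"
      by (rule lop_sum_bij_betw) (rule bij_betwI[where g = "\<lambda>n. n - 1"], auto)
    also have "\<dots> = scal x * Q (k - 1)"
      unfolding Q_def lop_sum_left[OF s]
      by (rule lop_sum_cong) (auto simp: scal_mult mult.assoc algebra_simps)
    finally show ?thesis .
  qed
  have "Y k - scal x * Y (k - 1) - cre k = 0"
  proof (rule leuler_zero_imp)
    show "leuler V (Y k - scal x * Y (k - 1) - cre k) = 0"
      by (simp add: leuler_diff leuler_mult leuler_scal eul DY leuler_cre Q[of k])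
    \<comment> \<open>This is the initial condition at x = 0, where \<open>g\<close> and
      \<open>g'\<close> are the identity, so the constant of integration is
      \<open>cre k\<close>.\<close>
    have 1: "op_ord V (Suc 0) (g - 1)" "op_ord V (Suc 0) (g' - 1)"
      unfolding g_def g'_def by (intro op_ord_lexp_minus_one op_ord_uminus HV)+
    have "Y k - cre k = (g - 1) * (cre k * g') + cre k * (g' - 1)"
      by (simp add: Y_def algebra_simps)
    also have "op_ord V (Suc 0) \<dots>" by (intro op_ord_add op_ord_left[OF 1(2)] op_ord_right[OF 1(1)])
    finally have "op_ord V (Suc 0) (Y k - cre k - scal x * Y (k - 1))"
      by (rule op_ord_diff[OF _ op_ord_right[OF op_ord_scal[OF ordV]]])
    thus "op_ord V (Suc 0) (Y k - scal x * Y (k - 1) - cre k)" by (simp add: algebra_simps)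
  qed
  hence "Y k * g = (cre k + scal x * Y (k - 1)) * g" by (simp add: algebra_simps)
  thus ?thesis by (simp add: Y_def mult.assoc gg' distrib_right g_def[symmetric] H_def[symmetric])
qed

section \<open>Charged partitions and horizontal strips\<close>

text \<open>With rows counted from 0, the point lam_i - i + 1/2 of the configuration carries the
  integer label \<open>lam i - i - 1\<close>; c is the charge.\<close>

definition row_pos :: "int \<Rightarrow> (nat \<Rightarrow> nat) \<Rightarrow> nat \<Rightarrow> int" where
  "row_pos c lam i = int (lam i) - int i - 1 + c"

text \<open>The charge is carried along because deleting the top particle turns the pair of c and
  \<open>lam\<close> into c - 1 and \<open>tail lam\<close>, the recursion used for the matrix
  entries.\<close>

definition conf :: "int \<Rightarrow> (nat \<Rightarrow> nat) \<Rightarrow> semi_inf" where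
  "conf c lam = of_occ (range (row_pos c lam))"

abbreviation tail :: "(nat \<Rightarrow> nat) \<Rightarrow> nat \<Rightarrow> nat" where "tail lam \<equiv> \<lambda>i. lam (Suc i)"

lemma partitionsD: "lam \<in> partitions \<Longrightarrow> i \<le> j \<Longrightarrow> lam j \<le> lam i"
  by (auto simp: partitions_def antimono_def)

lemma partitionsI: "(\<And>i. lam (Suc i) \<le> lam i) \<Longrightarrow> finite {i. lam i \<noteq> 0} \<Longrightarrow> lam \<in> partitions"
  by (auto simp: partitions_def intro: decseq_SucI)

lemma finite_diagram: "lam \<in> partitions \<Longrightarrow> finite (diagram lam)"
proof -
  assume lam: "lam \<in> partitions"
  have "diagram lam \<subseteq> {i. lam i \<noteq> 0} \<times> {..<lam 0}"
    using partitionsD[OF lam, of 0] by (auto simp: diagram_def) (meson less_le_trans zero_le)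
  thus ?thesis by (rule finite_subset) (use lam in \<open>auto simp: partitions_def\<close>)
qed

lemma zero_partition: "(\<lambda>_. 0) \<in> partitions" by (auto intro: partitionsI)

lemma tail_partition:
  assumes "lam \<in> partitions" shows "tail lam \<in> partitions"
proof (rule partitionsI)
  have "finite (Suc ` {i. lam (Suc i) \<noteq> 0})"
    by (rule finite_subset[of _ "{i. lam i \<noteq> 0}"]) (use assms in \<open>auto simp: partitions_def\<close>)
  thus "finite {i. lam (Suc i) \<noteq> 0}" by (rule finite_imageD) simp
qed (use partitionsD[OF assms] in simp)

lemma partition_eventually_zero:
  assumes "lam \<in> partitions" obtains N where "\<And>i. i \<ge> N \<Longrightarrow> lam i = 0"
proof -
  have "finite {i. lam i \<noteq> 0}" using assms by (simp add: partitions_def)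
  then obtain N where "\<And>i. i \<in> {i. lam i \<noteq> 0} \<Longrightarrow> i < N" by (meson finite_nat_set_iff_bounded)
  thus ?thesis by (intro that[of N]) force
qed

lemma occ_conf:
  assumes "lam \<in> partitions" shows "occ (conf c lam) = range (row_pos c lam)"
  unfolding conf_def
proof (rule occ_of_occ)
  have "range (row_pos c lam) \<inter> {0..} \<subseteq> {0..int (lam 0) + c}"
  proof
    fix j assume "j \<in> range (row_pos c lam) \<inter> {0..}"
    then obtain i where "j = row_pos c lam i" "0 \<le> j" by auto
    moreover have "lam i \<le> lam 0" using partitionsD[OF assms, of 0 i] by simp
    ultimately show "j \<in> {0..int (lam 0) + c}" by (simp add: row_pos_def)
  qed
  thus "finite (range (row_pos c lam) \<inter> {0..})" by (rule finite_subset) simp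
  obtain N where N: "\<And>i. i \<ge> N \<Longrightarrow> lam i = 0" using partition_eventually_zero[OF assms] by blast
  have "{..<0} - range (row_pos c lam) \<subseteq> {c - int N..0}"
  proof
    fix j assume j: "j \<in> {..<0} - range (row_pos c lam)"
    show "j \<in> {c - int N..0}"
    proof (rule ccontr)
      assume "j \<notin> {c - int N..0}"
      hence "j < c - int N" using j by auto
      hence "j = row_pos c lam (nat (c - 1 - j))" using N[of "nat (c - 1 - j)"] by (simp add: row_pos_def)
      thus False using j by blast
    qed
  qed
  thus "finite ({..<0} - range (row_pos c lam))" by (rule finite_subset) simp
qed

lemma row_pos_mono: "lam \<in> partitions \<Longrightarrow> i < j \<Longrightarrow> row_pos c lam j < row_pos c lam i"
  using partitionsD[of lam i j] by (simp add: row_pos_def)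

text \<open>The value f i equals some g j. If j < i, then g j = f j > f i by induction, so j \<ge> i
  and f i \<le> g i; exchanging f and g gives equality.\<close>

lemma decreasing_enumeration_unique:
  fixes f g :: "nat \<Rightarrow> 'b::linorder"
  assumes f: "\<And>i j. i < j \<Longrightarrow> f j < f i" and g: "\<And>i j. i < j \<Longrightarrow> g j < g i" and eq: "range f = range g"
  shows "f i = g i"
proof (induction i rule: less_induct)
  case (less i)
  have le: "f' i \<le> g' i" if "range f' = range g'" "\<And>j. j < i \<Longrightarrow> f' j = g' j"
    "\<And>i j. i < j \<Longrightarrow> f' j < f' i" "\<And>i j. i < j \<Longrightarrow> g' j < g' i" for f' g' :: "nat \<Rightarrow> 'b"
  proof -
    have "f' i \<in> range g'" unfolding that(1)[symmetric] by (rule rangeI)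
    then obtain j where j: "f' i = g' j" by (rule rangeE)
    have "\<not> j < i"
    proof
      assume "j < i"
      from that(2)[OF this] that(3)[OF this] j show False by simp
    qed
    hence "i = j \<or> i < j" by auto
    thus ?thesis using that(4)[of i j] j by auto
  qed
  show ?case
    by (rule antisym; rule le; (rule eq eq[symmetric] f g less less[symmetric])?)
qed

lemma conf_inject:
  assumes "lam \<in> partitions" "mu \<in> partitions" "conf c lam = conf d mu"
  shows "c = d" "lam = mu"
proof -
  have "range (row_pos c lam) = range (row_pos d mu)"
    using assms(3) occ_conf[OF assms(1)] occ_conf[OF assms(2)] by metis
  hence eq: "row_pos c lam i = row_pos d mu i" for i
    by (intro decreasing_enumeration_unique row_pos_mono assms)
  obtain N where N: "\<And>i. i \<ge> N \<Longrightarrow> lam i = 0" using partition_eventually_zero[OF assms(1)] by blast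
  obtain M where M: "\<And>i. i \<ge> M \<Longrightarrow> mu i = 0" using partition_eventually_zero[OF assms(2)] by blast
  \<comment> \<open>Beyond the last nonzero rows of both partitions, the position of a row depends
    on the charge alone.\<close>
  show "c = d" using eq[of "max N M"] N[of "max N M"] M[of "max N M"] by (simp add: row_pos_def)
  thus "lam = mu" using eq by (simp add: row_pos_def fun_eq_iff)
qed

lemma row_pos_range: "range (row_pos c lam) = insert (int (lam 0) - 1 + c) (range (row_pos (c - 1) (tail lam)))"
proof -
  have "row_pos c lam (Suc i) = row_pos (c - 1) (tail lam) i" for i by (simp add: row_pos_def)
  moreover have "range (row_pos c lam) = insert (row_pos c lam 0) (range (\<lambda>i. row_pos c lam (Suc i)))"
  proof -
    have "range f = insert (f 0) (range (\<lambda>i. f (Suc i)))" for f :: "nat \<Rightarrow> int"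
    proof (rule Set.set_eqI)
      fix s
      have "(\<exists>i. s = f i) \<longleftrightarrow> s = f 0 \<or> (\<exists>i. s = f (Suc i))" by (metis not0_implies_Suc)
      thus "s \<in> range f \<longleftrightarrow> s \<in> insert (f 0) (range (\<lambda>i. f (Suc i)))" by (auto simp: image_iff)
    qed
    thus ?thesis .
  qed
  moreover have "row_pos c lam 0 = int (lam 0) - 1 + c" by (simp add: row_pos_def)
  ultimately show ?thesis by simp
qed

lemma conf_ins:
  assumes "lam \<in> partitions"
  shows "conf c lam = ins (int (lam 0) - 1 + c) (conf (c - 1) (tail lam))"
  by (rule semi_inf_eqI) (simp add: occ_conf assms tail_partition row_pos_range[of c lam])

lemma occ_conf_le:
  assumes "lam \<in> partitions" "s \<in> occ (conf c lam)" shows "s \<le> int (lam 0) - 1 + c"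
proof -
  obtain i where "s = row_pos c lam i" using assms by (auto simp: occ_conf)
  moreover have "lam i \<le> lam 0" using partitionsD[OF assms(1), of 0 i] by simp
  ultimately show ?thesis by (simp add: row_pos_def)
qed

lemma top_in_occ_conf: "lam \<in> partitions \<Longrightarrow> int (lam 0) - 1 + c \<in> occ (conf c lam)"
  by (simp add: occ_conf row_pos_range[of c lam])

lemma conf_zero: "occ (conf c (\<lambda>_. 0)) = {..<c}"
proof -
  have "j \<in> range (row_pos c (\<lambda>_. 0))" if "j < c" for j
    by (rule range_eqI[of _ _ "nat (c - 1 - j)"]) (use that in \<open>simp add: row_pos_def\<close>)
  thus ?thesis by (auto simp: occ_conf[OF zero_partition] row_pos_def)
qed

lemma conf_vac: "conf 0 (\<lambda>_. 0) = vac"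
  by (rule semi_inf_eqI) (simp add: conf_zero)

lemma cons_partition:
  assumes "mu \<in> partitions" "mu 0 \<le> l" shows "case_nat l mu \<in> partitions"
proof (rule partitionsI)
  show "case_nat l mu (Suc i) \<le> case_nat l mu i" for i
    using assms partitionsD[OF assms(1), of "i - 1" i] by (cases i) auto
  have "{i. case_nat l mu i \<noteq> 0} \<subseteq> insert 0 (Suc ` {i. mu i \<noteq> 0})"
  proof
    fix i assume "i \<in> {i. case_nat l mu i \<noteq> 0}"
    thus "i \<in> insert 0 (Suc ` {i. mu i \<noteq> 0})" by (cases i) auto
  qed
  thus "finite {i. case_nat l mu i \<noteq> 0}"
    by (rule finite_subset) (use assms in \<open>auto simp: partitions_def\<close>)
qed

lemma conf_cons:
  assumes "mu \<in> partitions" "mu 0 \<le> l"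
  shows "conf c (case_nat l mu) = ins (int l - 1 + c) (conf (c - 1) mu)"
  using conf_ins[OF cons_partition[OF assms], of c] by simp

text \<open>Below some level n all levels are occupied. The finitely many occupied levels from n
  upwards are added in increasing order, each as a new first row with the charge raised by
  one.\<close>

lemma conf_surj: "\<exists>c. \<exists>lam\<in>partitions. S = conf c lam"
proof -
  obtain n where n: "\<And>s. s < n \<Longrightarrow> s \<in> occ S"
  proof -
    have fin: "finite ({s. s < 0 \<and> s \<notin> occ S})" by (rule finite_below)
    define n where "n = Min (insert 0 {s. s < 0 \<and> s \<notin> occ S})"
    have "s \<in> occ S" if "s < n" for s
      using that fin unfolding n_def by (subst (asm) Min_gr_iff) auto
    thus ?thesis by (rule that)
  qed
  have "\<exists>c. \<exists>lam\<in>partitions. S = conf c lam"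
    if "finite F" "{s \<in> occ S. n \<le> s} = F" "{..<n} \<subseteq> occ S" for F S
    using that
  proof (induction F arbitrary: S rule: finite_linorder_max_induct)
    case empty
    hence "occ S = {..<n}" by force
    hence "S = conf n (\<lambda>_. 0)" by (intro semi_inf_eqI) (simp add: conf_zero)
    thus ?case using zero_partition by blast
  next
    case (insert k F)
    have k: "k \<in> occ S" "n \<le> k" using insert.prems by auto
    have "{s \<in> occ (del k S). n \<le> s} = F" using insert.prems insert.hyps by auto
    moreover have "{..<n} \<subseteq> occ (del k S)" using insert.prems k by auto
    ultimately obtain c lam where lam: "lam \<in> partitions" "del k S = conf c lam"
      using insert.IH by blast
    have "int (lam 0) - 1 + c \<in> occ (del k S)" using top_in_occ_conf[OF lam(1)] lam(2) by simp
    hence "int (lam 0) - 1 + c < k"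
      using insert.prems insert.hyps k by (cases "int (lam 0) - 1 + c < n") force+
    \<comment> \<open>The new row has length k - c: in charge c + 1 it then occupies the level (k -
      c) - 1 + (c + 1) = k.\<close>
    hence le: "lam 0 \<le> nat (k - c)" and nn: "int (nat (k - c)) = k - c" by linarith+
    have "conf (c + 1) (case_nat (nat (k - c)) lam) = ins k (del k S)"
      using conf_cons[OF lam(1) le, of "c + 1", unfolded nn] by (simp add: lam(2))
    also have "\<dots> = S" using k by simp
    finally show ?case using cons_partition[OF lam(1) le] by metis
  qed
  moreover have "{s \<in> occ S. n \<le> s} \<subseteq> {s \<in> occ S. n - 1 < s}" by auto
  hence "finite {s \<in> occ S. n \<le> s}" by (rule finite_subset) (rule finite_above)
  ultimately show ?thesis using n by blast
qed

section \<open>Horizontal strips\<close>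

definition interlaces :: "(nat \<Rightarrow> nat) \<Rightarrow> (nat \<Rightarrow> nat) \<Rightarrow> bool" where
  "interlaces mu lam \<longleftrightarrow> (\<forall>i. lam (Suc i) \<le> mu i \<and> mu i \<le> lam i)"

text \<open>The mu for which the skew shape lam/mu is a horizontal strip, that is, has no two boxes
  in one column.\<close>

definition strips :: "(nat \<Rightarrow> nat) \<Rightarrow> (nat \<Rightarrow> nat) set" where
  "strips lam = {mu \<in> partitions. interlaces mu lam}"

text \<open>The sum has at most one term, as \<open>conf c\<close> is injective on partitions;
  written as a sum it needs no choice of mu and vanishes when none exists.\<close>

definition strip_weight :: "'r::comm_ring_1 \<Rightarrow> semi_inf \<Rightarrow> int \<Rightarrow> (nat \<Rightarrow> nat) \<Rightarrow> 'r" where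
  "strip_weight x R c lam = (\<Sum>mu\<in>{mu \<in> strips lam. R = conf c mu}. x ^ card (diagram lam - diagram mu))"

lemma strip_weight_conf:
  assumes "mu \<in> strips lam" shows "strip_weight x (conf c mu) c lam = x ^ card (diagram lam - diagram mu)"
proof -
  have "{mu' \<in> strips lam. conf c mu = conf c mu'} = {mu}"
    using assms conf_inject(2) by (auto simp: strips_def)
  thus ?thesis by (simp add: strip_weight_def)
qed

lemma strip_weight_zero:
  assumes "\<And>mu. mu \<in> strips lam \<Longrightarrow> R \<noteq> conf c mu" shows "strip_weight x R c lam = 0"
proof -
  have "{mu' \<in> strips lam. R = conf c mu'} = {}" using assms by auto
  thus ?thesis by (simp only: strip_weight_def) simp
qed

text \<open>The combinatorial counterpart of \<open>one_var_cre\<close>. Either the first row of mu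
  is full, so k is the top particle of R and can be removed, or the last box of the first row
  belongs to the strip and is removed with weight x.\<close>

lemma strip_weight_rec:
  fixes x :: "'r::comm_ring_1" and c :: int
  assumes lam: "lam \<in> partitions" and pos: "lam 0 > 0"
  defines "k \<equiv> int (lam 0) - 1 + c" and "lam' \<equiv> lam(0 := lam 0 - 1)"
  shows "strip_weight x R c lam =
    (if k \<in> occ R then sg k R * strip_weight x (del k R) (c - 1) (tail lam) else 0) +
    (if lam 1 < lam 0 then x * strip_weight x R c lam' else 0)"
proof (cases "\<exists>mu\<in>strips lam. R = conf c mu")
  case True
  then obtain mu where mu: "mu \<in> partitions" "interlaces mu lam" and R: "R = conf c mu"
    by (auto simp: strips_def)
  have w: "strip_weight x R c lam = x ^ card (diagram lam - diagram mu)"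
    using mu unfolding R by (intro strip_weight_conf) (simp add: strips_def)
  show ?thesis
  proof (cases "mu 0 = lam 0")
    case True
    have k: "k \<in> occ R" using top_in_occ_conf[OF mu(1), of c] by (simp add: R k_def True)
    have "s < k" if "s \<in> occ (conf (c - 1) (tail mu))" for s
      using occ_conf_le[OF tail_partition[OF mu(1)] that] partitionsD[OF mu(1), of 0 1] by (simp add: k_def True)
    hence d: "del k R = conf (c - 1) (tail mu)"
      unfolding R conf_ins[OF mu(1)] by (subst True, fold k_def, subst del_ins) auto
    have "tail mu \<in> strips (tail lam)"
      using mu tail_partition by (auto simp: strips_def interlaces_def)
    hence w1: "strip_weight x (del k R) (c - 1) (tail lam) = x ^ card (diagram (tail lam) - diagram (tail mu))"
      unfolding d by (rule strip_weight_conf)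
    have s: "sg k R = (1 :: 'r)"
      by (rule sg_top) (use occ_conf_le[OF mu(1)] True in \<open>simp add: R k_def\<close>)
    have "diagram lam - diagram mu = (\<lambda>(i, j). (Suc i, j)) ` (diagram (tail lam) - diagram (tail mu))"
    proof (intro Set.set_eqI iffI)
      fix p assume p: "p \<in> diagram lam - diagram mu"
      obtain i j where ij: "p = (i, j)" by (metis surj_pair)
      have "i \<noteq> 0" using p True by (auto simp: ij diagram_def intro!: Nat.gr0I)
      then obtain i' where "i = Suc i'" by (cases i) auto
      thus "p \<in> (\<lambda>(i, j). (Suc i, j)) ` (diagram (tail lam) - diagram (tail mu))"
        using p by (auto simp: ij diagram_def)
    qed (auto simp: diagram_def)
    hence "card (diagram lam - diagram mu) = card (diagram (tail lam) - diagram (tail mu))"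
      by (simp add: card_image inj_on_def case_prod_unfold prod_eq_iff)
    moreover have "strip_weight x R c lam' = 0"
    proof (rule strip_weight_zero)
      fix nu assume nu: "nu \<in> strips lam'"
      show "R \<noteq> conf c nu"
      proof
        assume "R = conf c nu"
        hence "nu = mu" using conf_inject(2)[OF mu(1), of nu c c] nu by (auto simp: R strips_def)
        hence "mu 0 \<le> lam' 0" using nu by (auto simp: strips_def interlaces_def)
        thus False using True pos by (simp add: lam'_def)
      qed
    qed
    ultimately show ?thesis using w w1 s k by simp
  next
    case False
    hence less: "mu 0 < lam 0" using mu(2) by (metis interlaces_def order.not_eq_order_implies_strict)
    have k: "k \<notin> occ R"
      using occ_conf_le[OF mu(1), of k c] less by (auto simp: R k_def)
    have le: "lam 1 \<le> mu 0" using mu(2) by (simp add: interlaces_def)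
    have "interlaces mu lam'"
      unfolding interlaces_def
    proof
      fix i show "lam' (Suc i) \<le> mu i \<and> mu i \<le> lam' i"
        using mu(2) less by (cases i) (auto simp: interlaces_def lam'_def)
    qed
    hence st: "mu \<in> strips lam'" using mu by (simp add: strips_def)
    have "diagram lam - diagram mu = insert (0, lam 0 - 1) (diagram lam' - diagram mu)"
      using less by (auto simp: diagram_def lam'_def split: if_splits)
    moreover have "(0, lam 0 - 1) \<notin> diagram lam' - diagram mu" by (simp add: diagram_def lam'_def)
    moreover have "finite (diagram lam' - diagram mu)"
      by (rule finite_subset[OF _ finite_diagram[OF lam]]) (auto simp: diagram_def lam'_def split: if_splits)
    ultimately have "card (diagram lam - diagram mu) = Suc (card (diagram lam' - diagram mu))" by simp
    thus ?thesis using w k less le strip_weight_conf[OF st, of x c] by (simp add: R)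
  qed
next
  \<comment> \<open>When R arises from no strip, both terms vanish: a strip counted by either of
    them would extend to a strip of \<open>lam\<close> that gives R.\<close>
  case False
  have "strip_weight x R c lam = 0" using False by (intro strip_weight_zero) auto
  moreover have "strip_weight x (del k R) (c - 1) (tail lam) = 0" if k: "k \<in> occ R"
  proof (rule strip_weight_zero)
    fix nu assume "nu \<in> strips (tail lam)"
    hence nu: "nu \<in> partitions" "interlaces nu (tail lam)" by (auto simp: strips_def)
    show "del k R \<noteq> conf (c - 1) nu"
    proof
      assume d: "del k R = conf (c - 1) nu"
      have "nu 0 \<le> lam 1" using nu(2) by (simp add: interlaces_def)
      also have "\<dots> \<le> lam 0" using partitionsD[OF lam, of 0 1] by simp
      finally have le: "nu 0 \<le> lam 0" .
      have "R = conf c (case_nat (lam 0) nu)"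
        using conf_cons[OF nu(1) le, of c] d k by (simp add: k_def[symmetric]) (metis ins_del)
      moreover have "interlaces (case_nat (lam 0) nu) lam"
        unfolding interlaces_def
      proof
        fix i show "lam (Suc i) \<le> case_nat (lam 0) nu i \<and> case_nat (lam 0) nu i \<le> lam i"
          using nu(2) partitionsD[OF lam, of 0 1] by (cases i) (auto simp: interlaces_def)
      qed
      ultimately show False using False cons_partition[OF nu(1) le] by (auto simp: strips_def)
    qed
  qed
  moreover have "strip_weight x R c lam' = 0" if "lam 1 < lam 0"
  proof (rule strip_weight_zero)
    fix nu assume nu: "nu \<in> strips lam'"
    have "interlaces nu lam"
      unfolding interlaces_def
    proof
      fix i
      have "lam' (Suc i) \<le> nu i" "nu i \<le> lam' i" using nu by (auto simp: strips_def interlaces_def)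
      moreover have "lam' i \<le> lam i" by (simp add: lam'_def)
      ultimately show "lam (Suc i) \<le> nu i \<and> nu i \<le> lam i" by (auto simp: lam'_def split: if_splits)
    qed
    thus "R \<noteq> conf c nu" using False nu by (auto simp: strips_def)
  qed
  ultimately show ?thesis by simp
qed

text \<open>The top particle k is created last, with sign 1, from the state of
  \<open>tail lam\<close>. Commuting \<open>cre k\<close> through the vertex operator leaves either
  this state or the state with the particle at k - 1; both belong to diagrams with fewer
  boxes.\<close>

lemma one_var_strip:
  fixes x :: "'a::field_char_0 series"
  assumes x: "x = mfps_var w" and lam: "lam \<in> partitions"
  shows "ent (lexp (ham 1 (one_var x))) R (conf c lam) = strip_weight x R c lam"
  using lam
proof (induction "card (diagram lam)" arbitrary: lam c R rule: less_induct)
  case (less lam)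
  define g where "g = lexp (ham 1 (one_var x))"
  have t: "time_seq (one_var x)"
    unfolding x by (intro time_seq_one_var ord_ge_var) simp
  show ?case
  proof (cases "lam 0 = 0")
    case True
    hence lam0: "lam = (\<lambda>_. 0)" using partitionsD[OF less.prems, of 0] by (auto simp: fun_eq_iff)
    have "ent (lexp (ham 1 (one_var x))) R (conf c lam) = ent 1 R (conf c lam)"
      by (rule ent_lexp_column) (simp_all add: op_ord_ham[OF t] ham_vacuum_column[OF t, of _ c] lam0 conf_zero)
    moreover have "strips lam = {lam}"
      using zero_partition by (auto simp: strips_def interlaces_def lam0 fun_eq_iff)
    moreover have "strip_weight x R c lam = (if R = conf c lam then 1 else 0)"
      using strip_weight_conf[of lam lam x c] strip_weight_zero[of lam R c x] calculation(2) by auto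
    ultimately show ?thesis by (simp add: ent_one)
  next
    case False
    define k where "k = int (lam 0) - 1 + c"
    define S where "S = conf (c - 1) (tail lam)"
    define lam' where "lam' = lam(0 := lam 0 - 1)"
    note tl = tail_partition[OF less.prems]
    have le: "lam 1 \<le> lam 0" using partitionsD[OF less.prems, of 0 1] by simp
    have Sk: "s < k" if "s \<in> occ S" for s
      using occ_conf_le[OF tl that[unfolded S_def]] le by (simp add: k_def)
    have conf: "conf c lam = ins k S" unfolding k_def S_def by (rule conf_ins[OF less.prems])
    have sgk: "sg k S = (1 :: 'a series)" by (rule sg_top) (use Sk in force)
    have sgk1: "sg (k - 1) S = (1 :: 'a series)" by (rule sg_top) (use Sk in force)
    have fin: "finite (diagram lam)" by (rule finite_diagram[OF less.prems])
    have "ent g R (conf c lam) = ent (g * cre k) R S"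
      using Sk sgk by (auto simp: ent_mult_cre conf)
    also have "\<dots> = ent (cre k * g) R S + x * ent (g * cre (k - 1)) R S"
      unfolding g_def one_var_cre[OF x, of k] by simp
    also have "ent (cre k * g) R S = (if k \<in> occ R then sg k R * strip_weight x (del k R) (c - 1) (tail lam) else 0)"
    proof -
      have "card (diagram (tail lam)) < card (diagram lam)"
      proof -
        have "(\<lambda>(i, j). (Suc i, j)) ` diagram (tail lam) \<subseteq> diagram lam - {(0, 0)}" by (auto simp: diagram_def)
        moreover have "card ((\<lambda>(i, j). (Suc i, j)) ` diagram (tail lam)) = card (diagram (tail lam))"
          by (simp add: card_image inj_on_def case_prod_unfold prod_eq_iff)
        moreover have "(0, 0) \<in> diagram lam" using False by (simp add: diagram_def)
        ultimately show ?thesis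
          using fin by (metis card_Diff1_less card_mono finite_Diff le_less_trans)
      qed
      from less.hyps[OF this tl] show ?thesis by (simp add: ent_cre_mult g_def S_def)
    qed
    also have "ent (g * cre (k - 1)) R S = (if lam 1 < lam 0 then strip_weight x R c lam' else 0)"
    proof (cases "lam 1 < lam 0")
      case True
      have p: "lam' \<in> partitions"
      proof (rule partitionsI)
        show "lam' (Suc i) \<le> lam' i" for i
          using True partitionsD[OF less.prems, of i "Suc i"] by (auto simp: lam'_def)
        show "finite {i. lam' i \<noteq> 0}"
          by (rule finite_subset[of _ "{i. lam i \<noteq> 0}"])
            (use less.prems in \<open>auto simp: lam'_def partitions_def split: if_splits\<close>)
      qed
      have "k - 1 \<notin> occ S"
        using occ_conf_le[OF tl, of "k - 1" "c - 1"] True by (auto simp: S_def k_def)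
      moreover have "ins (k - 1) S = conf c lam'"
      proof -
        have tl': "tail lam' = tail lam" and k': "int (lam' 0) - 1 + c = k - 1"
          using False by (auto simp: lam'_def k_def)
        show ?thesis unfolding conf_ins[OF p] k' tl' S_def ..
      qed
      moreover have "card (diagram lam') < card (diagram lam)"
      proof (rule psubset_card_mono[OF fin])
        have "(0, lam 0 - 1) \<in> diagram lam - diagram lam'" using False by (simp add: diagram_def lam'_def)
        moreover have "diagram lam' \<subseteq> diagram lam" by (auto simp: diagram_def lam'_def split: if_splits)
        ultimately show "diagram lam' \<subset> diagram lam" by blast
      qed
      ultimately show ?thesis
        using True sgk1 less.hyps[of lam' R c] p by (simp add: ent_mult_cre g_def)
    next
      case notless: False
      hence "lam 1 = lam 0" using le by simp
      \<comment> \<open>With equal first rows the second row already occupies level k - 1, and the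
        term vanishes by exclusion; removing the box would not leave a partition.\<close>
      hence "k - 1 \<in> occ S" using top_in_occ_conf[OF tl, of "c - 1"] by (simp add: S_def k_def)
      thus ?thesis using notless by (simp add: ent_mult_cre)
    qed
    also have "x * (if lam 1 < lam 0 then strip_weight x R c lam' else 0) =
        (if lam 1 < lam 0 then x * strip_weight x R c lam' else 0)" by simp
    also have "(if k \<in> occ R then sg k R * strip_weight x (del k R) (c - 1) (tail lam) else 0) + \<dots> =
        strip_weight x R c lam"
      using strip_weight_rec[OF less.prems, of x R c, folded k_def lam'_def] False by (simp only: neq0_conv)
    finally show ?thesis by (simp only: g_def)
  qed
qed

section \<open>Schur functions and the correlation function\<close>

subsection \<open>Semistandard tableaux\<close>

definition bounded_ssyt :: "nat \<Rightarrow> (nat \<Rightarrow> nat) \<Rightarrow> (nat \<times> nat \<Rightarrow> nat) set" where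
  "bounded_ssyt N lam = {T \<in> ssyt lam. \<forall>c\<in>diagram lam. T c < N}"

definition schur_poly :: "(nat \<Rightarrow> 'r::comm_ring_1) \<Rightarrow> nat \<Rightarrow> (nat \<Rightarrow> nat) \<Rightarrow> 'r" where
  "schur_poly v N lam = (\<Sum>T\<in>bounded_ssyt N lam. \<Prod>c\<in>diagram lam. v (T c))"

lemma finite_bounded_ssyt:
  assumes "lam \<in> partitions" shows "finite (bounded_ssyt N lam)"
proof (rule finite_subset)
  show "bounded_ssyt N lam \<subseteq> {T. \<forall>c. (c \<in> diagram lam \<longrightarrow> T c \<in> {..<N}) \<and> (c \<notin> diagram lam \<longrightarrow> T c = 0)}"
    by (auto simp: bounded_ssyt_def ssyt_def)
  show "finite {T. \<forall>c. (c \<in> diagram lam \<longrightarrow> T c \<in> {..<N}) \<and> (c \<notin> diagram lam \<longrightarrow> T c = 0)}"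
    by (rule finite_set_of_finite_funs) (simp_all add: finite_diagram assms)
qed

lemma finite_strips:
  assumes "lam \<in> partitions" shows "finite (strips lam)"
proof (rule finite_subset)
  let ?F = "{mu. \<forall>i. (i \<in> {i. lam i \<noteq> 0} \<longrightarrow> mu i \<in> {..lam 0}) \<and> (i \<notin> {i. lam i \<noteq> 0} \<longrightarrow> mu i = (0 :: nat))}"
  show "strips lam \<subseteq> ?F"
  proof (intro subsetI CollectI allI conjI impI)
    fix mu i assume "mu \<in> strips lam"
    hence le: "mu i \<le> lam i" by (auto simp: strips_def interlaces_def)
    show "mu i \<in> {..lam 0}" using le partitionsD[OF assms, of 0 i] by simp
    show "mu i = 0" if "i \<notin> {i. lam i \<noteq> 0}" using le that by simp
  qed
  show "finite ?F"
    by (rule finite_set_of_finite_funs) (use assms in \<open>simp_all add: partitions_def\<close>)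
qed

lemma schur_poly_0: "schur_poly v 0 lam = (if lam = (\<lambda>_. 0) then 1 else 0)"
proof (cases "lam = (\<lambda>_. 0)")
  case True
  have d: "diagram lam = {}" by (simp add: diagram_def True)
  hence "bounded_ssyt 0 lam = {\<lambda>_. 0}" by (auto simp: bounded_ssyt_def ssyt_def fun_eq_iff)
  hence "schur_poly v 0 lam = 1" unfolding schur_poly_def d by simp
  thus ?thesis using True by simp
next
  case False
  then obtain i where "lam i \<noteq> 0" by (auto simp: fun_eq_iff)
  hence "(i, 0) \<in> diagram lam" by (simp add: diagram_def)
  hence "bounded_ssyt 0 lam = {}" by (auto simp: bounded_ssyt_def)
  thus ?thesis by (simp add: schur_poly_def False)
qed

lemma ssyt_row_mono:
  assumes "T \<in> ssyt lam" "j \<le> j'" "j' < lam i" shows "T (i, j) \<le> T (i, j')"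
  using assms(2,3)
proof (induction j' rule: dec_induct)
  case (step n)
  have "T (i, n) \<le> T (i, Suc n)" using assms(1) step.prems by (simp add: ssyt_def diagram_def)
  thus ?case using step by simp
qed simp

text \<open>Counting defines the row lengths before the cells with entries below N are known to form
  an initial segment of each row.\<close>

definition cut_shape :: "nat \<Rightarrow> (nat \<Rightarrow> nat) \<Rightarrow> (nat \<times> nat \<Rightarrow> nat) \<Rightarrow> nat \<Rightarrow> nat" where
  "cut_shape N lam T i = card {j. j < lam i \<and> T (i, j) < N}"

lemma cut_shape_iff:
  assumes "T \<in> ssyt lam" shows "j < cut_shape N lam T i \<longleftrightarrow> j < lam i \<and> T (i, j) < N"
proof -
  let ?J = "{j. j < lam i \<and> T (i, j) < N}"
  have down: "j' \<in> ?J" if "j \<in> ?J" "j' \<le> j" for j j'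
    using ssyt_row_mono[OF assms that(2), of i] that by auto
  have fin: "finite ?J" by simp
  have "?J = {..<card ?J}"
  proof (cases "?J = {}")
    case False
    have "?J = {..Max ?J}"
    proof
      show "?J \<subseteq> {..Max ?J}" using fin by (auto intro: Max_ge)
      show "{..Max ?J} \<subseteq> ?J" using down[OF Max_in[OF fin False]] by blast
    qed
    moreover from this have "card ?J = Suc (Max ?J)" by (metis card_atMost)
    ultimately show ?thesis by (simp add: lessThan_Suc_atMost)
  next
    case True
    show ?thesis unfolding True by simp
  qed
  thus ?thesis unfolding cut_shape_def by blast
qed

lemma diagram_strip: "mu \<in> strips lam \<Longrightarrow> diagram mu \<subseteq> diagram lam"
  by (auto simp: strips_def interlaces_def diagram_def intro: less_le_trans)

text \<open>Columns increase strictly and N is the largest possible entry, so every cell that lies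
  above another cell has an entry below N. This is the interlacing inequality.\<close>

lemma cut_shape_strip:
  assumes T: "T \<in> bounded_ssyt (Suc N) lam" and lam: "lam \<in> partitions"
  shows "cut_shape N lam T \<in> strips lam"
proof -
  have T': "T \<in> ssyt lam" using T by (simp add: bounded_ssyt_def)
  have le: "cut_shape N lam T i \<le> lam i" for i
    using cut_shape_iff[OF T', of "lam i" N i] by (simp add: not_less[symmetric])
  have ge: "lam (Suc i) \<le> cut_shape N lam T i" for i
  proof (rule ccontr)
    assume "\<not> lam (Suc i) \<le> cut_shape N lam T i"
    hence less: "cut_shape N lam T i < lam (Suc i)" by simp
    let ?j = "cut_shape N lam T i"
    have "(Suc i, ?j) \<in> diagram lam" using less by (simp add: diagram_def)
    hence "T (i, ?j) < T (Suc i, ?j)" "T (Suc i, ?j) < Suc N"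
      using T T' by (auto simp: ssyt_def bounded_ssyt_def)
    moreover have "?j < lam i" using less partitionsD[OF lam, of i "Suc i"] by simp
    ultimately have "?j < ?j" by (subst cut_shape_iff[OF T']) simp
    thus False by simp
  qed
  have "cut_shape N lam T \<in> partitions"
  proof (rule partitionsI)
    show "cut_shape N lam T (Suc i) \<le> cut_shape N lam T i" for i using le[of "Suc i"] ge[of i] by simp
    show "finite {i. cut_shape N lam T i \<noteq> 0}"
    proof (rule finite_subset)
      show "{i. cut_shape N lam T i \<noteq> 0} \<subseteq> {i. lam i \<noteq> 0}"
        using le by (metis (mono_tags, lifting) Collect_mono le_zero_eq)
      show "finite {i. lam i \<noteq> 0}" using lam by (simp add: partitions_def)
    qed
  qed
  thus ?thesis using le ge by (simp add: strips_def interlaces_def)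
qed

definition cut_tableau :: "(nat \<Rightarrow> nat) \<Rightarrow> (nat \<times> nat \<Rightarrow> nat) \<Rightarrow> nat \<times> nat \<Rightarrow> nat" where
  "cut_tableau mu T c = (if c \<in> diagram mu then T c else 0)"

definition fill_tableau :: "nat \<Rightarrow> (nat \<Rightarrow> nat) \<Rightarrow> (nat \<Rightarrow> nat) \<Rightarrow> (nat \<times> nat \<Rightarrow> nat) \<Rightarrow> nat \<times> nat \<Rightarrow> nat" where
  "fill_tableau N lam mu U c = (if c \<in> diagram lam - diagram mu then N else U c)"

lemma cut_tableau_ssyt:
  assumes T: "T \<in> bounded_ssyt (Suc N) lam" and lam: "lam \<in> partitions"
  shows "cut_tableau (cut_shape N lam T) T \<in> bounded_ssyt N (cut_shape N lam T)"
proof -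
  let ?mu = "cut_shape N lam T"
  have T': "T \<in> ssyt lam" using T by (simp add: bounded_ssyt_def)
  have mu: "?mu \<in> strips lam" by (rule cut_shape_strip[OF T lam])
  hence mup: "?mu \<in> partitions" by (simp add: strips_def)
  have d: "(i, j) \<in> diagram ?mu \<longleftrightarrow> j < lam i \<and> T (i, j) < N" for i j
    by (simp add: diagram_def cut_shape_iff[OF T'])
  show ?thesis
    unfolding bounded_ssyt_def ssyt_def
  proof (intro CollectI conjI allI impI ballI)
    fix i j assume "(i, Suc j) \<in> diagram ?mu"
    hence "(i, Suc j) \<in> diagram ?mu" "(i, j) \<in> diagram ?mu" "(i, Suc j) \<in> diagram lam"
      by (auto simp: diagram_def cut_shape_iff[OF T'] dest: Suc_lessD)
        (simp_all add: diagram_def[symmetric] ssyt_row_mono[OF T', of j "Suc j" i] le_less_trans[of "T (i, j)" "T (i, Suc j)" N])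
    thus "cut_tableau ?mu T (i, j) \<le> cut_tableau ?mu T (i, Suc j)"
      using T' by (simp add: cut_tableau_def ssyt_def)
  next
    fix i j assume a: "(Suc i, j) \<in> diagram ?mu"
    have "(i, j) \<in> diagram ?mu" using a partitionsD[OF mup, of i "Suc i"] by (simp add: diagram_def)
    moreover have "(Suc i, j) \<in> diagram lam" using a diagram_strip[OF mu] by blast
    ultimately show "cut_tableau ?mu T (i, j) < cut_tableau ?mu T (Suc i, j)"
      using T' a by (simp add: cut_tableau_def ssyt_def)
  next
    fix c assume "c \<in> diagram ?mu"
    thus "cut_tableau ?mu T c < N" using d by (cases c) (simp add: cut_tableau_def)
  qed (simp add: cut_tableau_def)
qed

lemma fill_tableau_ssyt:
  assumes mu: "mu \<in> strips lam" and U: "U \<in> bounded_ssyt N mu"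
  shows "fill_tableau N lam mu U \<in> bounded_ssyt (Suc N) lam"
proof -
  have mup: "mu \<in> partitions" using mu by (simp add: strips_def)
  have UN: "U c < N" if "c \<in> diagram mu" for c using U that by (auto simp: bounded_ssyt_def)
  have le: "fill_tableau N lam mu U c \<le> N" if "c \<in> diagram lam" for c
    using UN[of c] that by (auto simp: fill_tableau_def)
  show ?thesis
    unfolding bounded_ssyt_def ssyt_def
  proof (intro CollectI conjI allI impI ballI)
    fix i j assume a: "(i, Suc j) \<in> diagram lam"
    show "fill_tableau N lam mu U (i, j) \<le> fill_tableau N lam mu U (i, Suc j)"
    proof (cases "(i, Suc j) \<in> diagram mu")
      case True
      hence "(i, j) \<in> diagram mu" by (auto simp: diagram_def)
      thus ?thesis using True U by (simp add: fill_tableau_def bounded_ssyt_def ssyt_def)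
    next
      case False
      have "(i, j) \<in> diagram lam" using a by (auto simp: diagram_def)
      thus ?thesis using le[of "(i, j)"] a False by (simp add: fill_tableau_def[of N lam mu U "(i, Suc j)"])
    qed
  next
    fix i j assume a: "(Suc i, j) \<in> diagram lam"
    \<comment> \<open>By interlacing, the cell above any cell of \<open>lam\<close> lies in
      \<open>mu\<close>; its entry is below N, which gives strictness even when the lower cell is
      newly filled.\<close>
    have b: "(i, j) \<in> diagram mu"
    proof -
      have "lam (Suc i) \<le> mu i" using mu by (simp add: strips_def interlaces_def)
      thus ?thesis using a by (simp add: diagram_def)
    qed
    show "fill_tableau N lam mu U (i, j) < fill_tableau N lam mu U (Suc i, j)"
    proof (cases "(Suc i, j) \<in> diagram mu")
      case True
      thus ?thesis using b U by (simp add: fill_tableau_def bounded_ssyt_def ssyt_def)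
    next
      case False
      thus ?thesis using a b UN[OF b] by (simp add: fill_tableau_def)
    qed
  next
    fix c assume c: "c \<notin> diagram lam"
    moreover have "c \<notin> diagram mu" using c diagram_strip[OF mu] by blast
    ultimately show "fill_tableau N lam mu U c = 0"
      using U by (cases c) (auto simp: fill_tableau_def bounded_ssyt_def ssyt_def)
  next
    fix c assume "c \<in> diagram lam"
    thus "fill_tableau N lam mu U c < Suc N" using le by (simp add: less_Suc_eq_le)
  qed
qed

text \<open>A tableau is the same as the horizontal strip of its cells with entry N together with
  the tableau on the remaining shape.\<close>

lemma schur_poly_branching:
  assumes lam: "lam \<in> partitions"
  shows "schur_poly v (Suc N) lam =
    (\<Sum>mu\<in>strips lam. schur_poly v N mu * v N ^ card (diagram lam - diagram mu))"
proof -
  have fin: "finite (diagram lam)" by (rule finite_diagram[OF lam])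
  have part: "mu \<in> partitions" if "mu \<in> strips lam" for mu using that by (simp add: strips_def)
  have "(\<Sum>mu\<in>strips lam. schur_poly v N mu * v N ^ card (diagram lam - diagram mu)) =
    (\<Sum>mu\<in>strips lam. \<Sum>U\<in>bounded_ssyt N mu. (\<Prod>c\<in>diagram mu. v (U c)) * v N ^ card (diagram lam - diagram mu))"
    by (simp add: schur_poly_def sum_distrib_right)
  also have "\<dots> = (\<Sum>(mu, U)\<in>Sigma (strips lam) (bounded_ssyt N).
      (\<Prod>c\<in>diagram mu. v (U c)) * v N ^ card (diagram lam - diagram mu))"
    by (rule sum.Sigma) (auto simp: finite_strips lam finite_bounded_ssyt part)
  also have "\<dots> = (\<Sum>T\<in>bounded_ssyt (Suc N) lam. \<Prod>c\<in>diagram lam. v (T c))"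
  proof (rule sum.reindex_bij_witness[of _ "\<lambda>T. (cut_shape N lam T, cut_tableau (cut_shape N lam T) T)"
        "\<lambda>(mu, U). fill_tableau N lam mu U"])
    fix T assume T: "T \<in> bounded_ssyt (Suc N) lam"
    have T': "T \<in> ssyt lam" using T by (simp add: bounded_ssyt_def)
    show "(cut_shape N lam T, cut_tableau (cut_shape N lam T) T) \<in> Sigma (strips lam) (bounded_ssyt N)"
      using cut_shape_strip[OF T lam] cut_tableau_ssyt[OF T lam] by simp
    show "(case (cut_shape N lam T, cut_tableau (cut_shape N lam T) T) of (mu, U) \<Rightarrow> fill_tableau N lam mu U) = T"
    proof (unfold prod.case, rule ext)
      fix c :: "nat \<times> nat"
      obtain i j where c: "c = (i, j)" by (metis surj_pair)
      have d: "(i, j) \<in> diagram (cut_shape N lam T) \<longleftrightarrow> j < lam i \<and> T (i, j) < N"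
        by (simp add: diagram_def cut_shape_iff[OF T'])
      show "fill_tableau N lam (cut_shape N lam T) (cut_tableau (cut_shape N lam T) T) c = T c"
      proof (cases "c \<in> diagram lam")
        case True
        hence "j < lam i" "T (i, j) < Suc N" using T by (auto simp: c diagram_def bounded_ssyt_def)
        thus ?thesis using True d by (auto simp: c fill_tableau_def cut_tableau_def)
      next
        case False
        hence "T c = 0" using T' by (cases c) (auto simp: ssyt_def)
        thus ?thesis using False by (simp add: fill_tableau_def cut_tableau_def)
      qed
    qed
  next
    fix p assume p: "p \<in> Sigma (strips lam) (bounded_ssyt N)"
    obtain mu U where pe: "p = (mu, U)" by (metis surj_pair)
    have mu: "mu \<in> strips lam" and U: "U \<in> bounded_ssyt N mu" using p pe by auto
    note sub = diagram_strip[OF mu]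
    have UN: "U c < N" if "c \<in> diagram mu" for c using U that by (auto simp: bounded_ssyt_def)
    have F: "fill_tableau N lam mu U \<in> bounded_ssyt (Suc N) lam" by (rule fill_tableau_ssyt[OF mu U])
    hence F': "fill_tableau N lam mu U \<in> ssyt lam" by (simp add: bounded_ssyt_def)
    show "(case p of (mu, U) \<Rightarrow> fill_tableau N lam mu U) \<in> bounded_ssyt (Suc N) lam" using F by (simp add: pe)
    have cs: "cut_shape N lam (fill_tableau N lam mu U) = mu"
    proof
      fix i
      have "j < cut_shape N lam (fill_tableau N lam mu U) i \<longleftrightarrow> j < mu i" for j
      proof -
        have "(i, j) \<in> diagram lam" if "j < mu i" using that sub by (auto simp: diagram_def)
        thus ?thesis
          unfolding cut_shape_iff[OF F'] using UN[of "(i, j)"] by (auto simp: fill_tableau_def diagram_def)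
      qed
      thus "cut_shape N lam (fill_tableau N lam mu U) i = mu i" by (meson linorder_neqE_nat less_irrefl)
    qed
    have "cut_tableau mu (fill_tableau N lam mu U) = U"
    proof
      fix c show "cut_tableau mu (fill_tableau N lam mu U) c = U c"
        using U by (cases c) (auto simp: cut_tableau_def fill_tableau_def bounded_ssyt_def ssyt_def)
    qed
    thus "(cut_shape N lam (case p of (mu, U) \<Rightarrow> fill_tableau N lam mu U),
        cut_tableau (cut_shape N lam (case p of (mu, U) \<Rightarrow> fill_tableau N lam mu U)) (case p of (mu, U) \<Rightarrow> fill_tableau N lam mu U)) = p"
      by (simp add: pe cs)
    have "(\<Prod>c\<in>diagram lam. v (fill_tableau N lam mu U c)) =
        (\<Prod>c\<in>diagram lam - diagram mu. v (fill_tableau N lam mu U c)) * (\<Prod>c\<in>diagram mu. v (fill_tableau N lam mu U c))"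
      by (rule prod.subset_diff[OF sub fin])
    also have "\<dots> = v N ^ card (diagram lam - diagram mu) * (\<Prod>c\<in>diagram mu. v (U c))"
      by (simp add: fill_tableau_def)
    finally show "(\<Prod>c\<in>diagram lam. v ((case p of (mu, U) \<Rightarrow> fill_tableau N lam mu U) c)) =
        (case p of (mu, U) \<Rightarrow> (\<Prod>c\<in>diagram mu. v (U c)) * v N ^ card (diagram lam - diagram mu))"
      by (simp add: pe mult.commute)
  qed
  finally show ?thesis by (simp add: schur_poly_def)
qed

subsection \<open>Vacuum expectations of exponentials are Schur functions\<close>

lemma ham_add:
  assumes "time_seq s" "time_seq s'" "\<And>n. n \<ge> 1 \<Longrightarrow> r n = s n + s' n"
  shows "ham \<epsilon> r = ham \<epsilon> s + ham \<epsilon> s'"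
  unfolding ham_def
  by (subst lop_sum_add[symmetric])
    (auto simp: summable_time_seq assms scal_add distrib_right intro!: lop_sum_cong)

text \<open>The times of the variables indexed by I alone: singletons give one vertex operator each,
  initial segments the finite products, and tails the remainder that a fixed monomial cannot
  see.\<close>

definition partial_time :: "(nat \<Rightarrow> ('v, 'a::field_char_0) mfps) \<Rightarrow> nat set \<Rightarrow> nat \<Rightarrow> ('v, 'a) mfps" where
  "partial_time v I n = mfps_const (1 / of_nat n) * mfps_sum (\<lambda>i. v i ^ n) I"

lemma ord_ge_partial_time:
  assumes "\<And>i. i \<in> I \<Longrightarrow> ord_ge V (Suc 0) (v i)" shows "ord_ge V n (partial_time v I n)"
proof -
  have "ord_ge V n (mfps_sum (\<lambda>i. v i ^ n) I)"
  proof (rule ord_ge_mfps_sum)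
    fix i assume "i \<in> I"
    from ord_ge_power[OF assms[OF this], of n] show "ord_ge V n (v i ^ n)" by simp
  qed
  from ord_ge_mult[OF ord_ge_0 this] show ?thesis by (simp add: partial_time_def)
qed

text \<open>Both alphabets are treated at once: \<open>emb\<close> is \<open>Inl\<close> for x and
  \<open>Inr\<close> for y.\<close>

context
  fixes emb :: "nat \<Rightarrow> nat + nat" and v :: "nat \<Rightarrow> 'a::field_char_0 series"
  assumes emb: "inj emb" and v: "\<And>i. v i = mfps_var (emb i)"
begin

lemma ord_ge_v: "emb i \<in> V \<Longrightarrow> ord_ge V (Suc 0) (v i)"
  by (simp add: v ord_ge_var)

lemma time_seq_partial: "time_seq (partial_time v I)"
  unfolding time_seq_def by (intro allI ord_ge_partial_time ord_ge_v) simp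

text \<open>For n \<ge> 1 a monomial can only occur in powers of the variables that it contains; for
  n = 0 every power is 1.\<close>

lemma locfin_v_power: "n \<ge> 1 \<Longrightarrow> locfin (\<lambda>i. v i ^ n) I"
proof
  fix m assume n: "n \<ge> 1"
  have "{i \<in> I. mcoeff (v i ^ n) m \<noteq> 0} \<subseteq> emb -` Poly_Mapping.keys m"
  proof
    fix i assume "i \<in> {i \<in> I. mcoeff (v i ^ n) m \<noteq> 0}"
    hence "n \<le> degv {emb i} m"
      using ord_geD[OF ord_ge_power[OF ord_ge_v[of i "{emb i}"], of n]] by simp
    hence "degv {emb i} m \<noteq> 0" using n by simp
    hence "Poly_Mapping.keys m \<inter> {emb i} \<noteq> {}" unfolding degv_def by (metis sum.empty)
    thus "i \<in> emb -` Poly_Mapping.keys m" by auto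
  qed
  thus "finite {i \<in> I. mcoeff (v i ^ n) m \<noteq> 0}"
    by (rule finite_subset) (simp add: finite_vimageI emb)
qed

lemma partial_time_union:
  assumes "n \<ge> 1" "I \<inter> J = {}"
  shows "partial_time v (I \<union> J) n = partial_time v I n + partial_time v J n"
proof -
  let ?f = "\<lambda>K i. if i \<in> K then v i ^ n else 0"
  have lf: "locfin (?f K) (I \<union> J)" for K
    by (rule locfin_image_dom[OF locfin_v_power[OF assms(1)]]) (auto split: if_splits)
  have r: "mfps_sum (?f K) (I \<union> J) = mfps_sum (\<lambda>i. v i ^ n) K" if "K \<subseteq> I \<union> J" for K
  proof -
    have "mfps_sum (?f K) (I \<union> J) = mfps_sum (?f K) K"
      by (rule mfps_sum_mono_neutral) (use that in auto)
    also have "\<dots> = mfps_sum (\<lambda>i. v i ^ n) K" by (rule mfps_sum_cong) auto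
    finally show ?thesis .
  qed
  have "mfps_sum (\<lambda>i. v i ^ n) (I \<union> J) = mfps_sum (\<lambda>i. ?f I i + ?f J i) (I \<union> J)"
    by (rule mfps_sum_cong) (use assms(2) in auto)
  also have "\<dots> = mfps_sum (\<lambda>i. v i ^ n) I + mfps_sum (\<lambda>i. v i ^ n) J"
    by (simp add: mfps_sum_add lf r)
  finally show ?thesis by (simp add: partial_time_def distrib_left)
qed

lemma lexp_ham_union:
  assumes "I \<inter> J = {}"
  shows "lexp (ham 1 (partial_time v (I \<union> J))) = lexp (ham 1 (partial_time v I)) * lexp (ham 1 (partial_time v J))"
proof -
  have "ham 1 (partial_time v (I \<union> J)) = ham 1 (partial_time v I) + ham 1 (partial_time v J)"
    by (rule ham_add) (simp_all add: time_seq_partial partial_time_union assms)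
  thus ?thesis
    by (simp add: lexp_add ham_pos_commute time_seq_partial op_ord_ham)
qed

text \<open>The operator of the last variable stands rightmost and acts first: it removes the strip
  of cells with entry N, and the other variables treat the remaining shape. Summation over that
  shape is the branching rule.\<close>

lemma lexp_ham_schur_poly:
  assumes "lam \<in> partitions"
  shows "ent (lexp (ham 1 (partial_time v {..<N}))) vac (conf c lam) = (if c = 0 then schur_poly v N lam else 0)"
  using assms
proof (induction N arbitrary: lam)
  case 0
  have "ham 1 (partial_time v {..<0}) = 0"
    unfolding ham_def
    by (subst lop_sum_mono_neutral[of "{}"]) (auto simp: partial_time_def mfps_sum_finite lop_sum_finite)
  hence "ent (lexp (ham 1 (partial_time v {..<0}))) vac (conf c lam) = ent 1 vac (conf c lam)" by simp
  \<comment> \<open>With no variables the operator is the identity, so only the empty partition in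
    charge 0 meets the vacuum; the charge condition then persists through the induction.\<close>
  moreover have "vac = conf c lam \<longleftrightarrow> c = 0 \<and> lam = (\<lambda>_. 0)"
    using conf_inject[OF zero_partition 0, of 0 c] conf_vac by auto
  ultimately show ?case by (auto simp: ent_one schur_poly_0)
next
  case (Suc N)
  let ?g = "lexp (ham 1 (partial_time v {..<N}))" and ?h = "lexp (ham 1 (one_var (v N)))"
  have one: "partial_time v {N} = one_var (v N)"
    by (rule ext) (simp add: partial_time_def one_var_def mfps_sum_finite)
  have "{..<Suc N} = {..<N} \<union> {N}" by auto
  hence "ent (lexp (ham 1 (partial_time v {..<Suc N}))) vac (conf c lam) = ent (?g * ?h) vac (conf c lam)"
    using lexp_ham_union[of "{..<N}" "{N}"] by (simp add: one)
  also have "\<dots> = mfps_sum (\<lambda>R. ent ?g vac R * strip_weight (v N) R c lam) UNIV"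
    by (simp add: ent_mult one_var_strip[OF v Suc.prems])
  also have "\<dots> = mfps_sum (\<lambda>R. ent ?g vac R * strip_weight (v N) R c lam) (conf c ` strips lam)"
  proof (rule mfps_sum_mono_neutral)
    fix R assume "R \<in> UNIV - conf c ` strips lam"
    hence "strip_weight (v N) R c lam = 0" by (intro strip_weight_zero) auto
    thus "ent ?g vac R * strip_weight (v N) R c lam = 0" by simp
  qed simp
  also have "\<dots> = mfps_sum (\<lambda>mu. ent ?g vac (conf c mu) * strip_weight (v N) (conf c mu) c lam) (strips lam)"
    by (subst mfps_sum_reindex) (auto simp: inj_on_def strips_def o_def dest: conf_inject)
  also have "\<dots> = (\<Sum>mu\<in>strips lam. ent ?g vac (conf c mu) * strip_weight (v N) (conf c mu) c lam)"
    by (rule mfps_sum_finite[OF finite_strips[OF Suc.prems]])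
  also have "\<dots> = (\<Sum>mu\<in>strips lam. (if c = 0 then schur_poly v N mu else 0) * v N ^ card (diagram lam - diagram mu))"
    by (rule sum.cong[OF refl]) (auto simp: strip_weight_conf Suc.IH strips_def)
  also have "\<dots> = (if c = 0 then schur_poly v (Suc N) lam else 0)"
    by (simp add: schur_poly_branching[OF Suc.prems])
  finally show ?case .
qed

lemma eventually_absent: "\<exists>N. degv (emb ` {N..}) m = 0"
proof -
  have "finite (emb -` Poly_Mapping.keys m)" by (simp add: finite_vimageI emb)
  then obtain N where N: "\<And>i. i \<in> emb -` Poly_Mapping.keys m \<Longrightarrow> i < N" by (meson finite_nat_set_iff_bounded)
  have "Poly_Mapping.keys m \<inter> emb ` {N..} = {}" using N by force
  thus ?thesis unfolding degv_def by (metis sum.empty)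
qed

text \<open>A tableau with an entry at least N has a weight divisible by a variable that does not
  occur in m.\<close>

lemma mcoeff_schur:
  assumes lam: "lam \<in> partitions" and m: "degv (emb ` {N..}) m = 0"
  shows "mcoeff (schur v lam) m = mcoeff (schur_poly v N lam) m"
proof -
  let ?V = "emb ` {N..}"
  have "T \<in> bounded_ssyt N lam" if T: "T \<in> ssyt lam" and nz: "mcoeff (\<Prod>c\<in>diagram lam. v (T c)) m \<noteq> 0" for T
  proof (rule ccontr)
    assume "T \<notin> bounded_ssyt N lam"
    then obtain c where c: "c \<in> diagram lam" "N \<le> T c" using T by (auto simp: bounded_ssyt_def not_less)
    have "(\<Prod>c\<in>diagram lam. v (T c)) = v (T c) * (\<Prod>c\<in>diagram lam - {c}. v (T c))"
      by (rule prod.remove[OF finite_diagram[OF lam] c(1)])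
    moreover have "ord_ge ?V (Suc 0 + 0) (v (T c) * (\<Prod>c\<in>diagram lam - {c}. v (T c)))"
      by (rule ord_ge_mult[OF ord_ge_v ord_ge_0]) (use c(2) in auto)
    ultimately show False using nz m by (auto simp: ord_ge_def)
  qed
  hence "mcoeff (schur v lam) m = (\<Sum>T\<in>bounded_ssyt N lam. mcoeff (\<Prod>c\<in>diagram lam. v (T c)) m)"
    unfolding schur_def
    by (intro mcoeff_mfps_sum_superset finite_bounded_ssyt lam) (auto simp: bounded_ssyt_def)
  thus ?thesis by (simp add: schur_poly_def mcoeff_sum)
qed

text \<open>The passage to infinitely many variables is exact for each monomial: once N exceeds the
  indices of all its variables, the tail factor differs from 1 only by terms that contain absent
  variables.\<close>

lemma lexp_ham_schur:
  assumes lam: "lam \<in> partitions"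
  shows "ent (lexp (ham 1 (power_sum_time v))) vac (conf c lam) = (if c = 0 then schur v lam else 0)"
proof (rule mfps_eqI)
  fix m
  obtain N where N: "degv (emb ` {N..}) m = 0" using eventually_absent by blast
  let ?V = "emb ` {N..}" and ?g = "lexp (ham 1 (partial_time v {..<N}))" and ?h = "lexp (ham 1 (partial_time v {N..}))"
  have "power_sum_time v = partial_time v ({..<N} \<union> {N..})"
  proof
    fix n
    have "{..<N} \<union> {N..} = UNIV" by auto
    thus "power_sum_time v n = partial_time v ({..<N} \<union> {N..}) n"
      by (simp only: power_sum_time_def partial_time_def)
  qed
  moreover have "{..<N} \<inter> {N..} = {}" by auto
  ultimately have "lexp (ham 1 (power_sum_time v)) = ?g * ?h" by (simp only: lexp_ham_union)
  also have "\<dots> = ?g + ?g * (?h - 1)" by (simp add: right_diff_distrib)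
  finally have eq: "lexp (ham 1 (power_sum_time v)) = ?g + ?g * (?h - 1)" .
  have "op_ord ?V (Suc 0) (ham 1 (partial_time v {N..}))"
    unfolding ham_def
  proof (rule op_ord_lop_sum[OF summable_time_seq[OF time_seq_partial]])
    fix n :: nat assume "n \<in> {1..}"
    hence "ord_ge ?V (Suc 0) (partial_time v {N..} n)"
      by (intro ord_ge_mono[OF ord_ge_partial_time[of "{N..}" ?V v n]] ord_ge_v) auto
    thus "op_ord ?V (Suc 0) (scal (partial_time v {N..} n) * cur (1 * int n))"
      by (intro op_ord_right op_ord_scal)
  qed
  hence "ord_ge ?V (Suc 0) (ent (?g * (?h - 1)) vac (conf c lam))"
    by (intro op_ordD op_ord_left op_ord_lexp_minus_one)
  hence "mcoeff (ent (?g * (?h - 1)) vac (conf c lam)) m = 0"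
    using N by (auto simp: ord_ge_def)
  thus "mcoeff (ent (lexp (ham 1 (power_sum_time v))) vac (conf c lam)) m = mcoeff (if c = 0 then schur v lam else 0) m"
    unfolding eq by (simp add: lexp_ham_schur_poly[OF lam] mcoeff_schur[OF lam N])
qed

end

subsection \<open>The correlation function\<close>

lemma gp_schur:
  assumes "lam \<in> partitions"
  shows "ent gp vac (conf c lam) = (if c = 0 then schur xvar lam else (0 :: 'a::field_char_0 series))"
  by (rule lexp_ham_schur[of Inl, OF _ _ assms]) (simp_all add: xvar_def)

lemma gm_schur:
  assumes "lam \<in> partitions"
  shows "ent gm (conf c lam) vac = (if c = 0 then schur yvar lam else (0 :: 'a::field_char_0 series))"
  unfolding ent_lexp_ham_minus[OF time_seq_ty]
  by (rule lexp_ham_schur[of Inr, OF _ _ assms]) (simp_all add: yvar_def)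

lemma point_config_eq:
  assumes "lam \<in> partitions" shows "point_config lam = half ` occ (conf 0 lam)"
proof -
  have "point_config lam = range (\<lambda>i. of_nat (lam i) - of_nat (Suc i) + 1 / 2)"
  proof (intro equalityI subsetI)
    fix q assume "q \<in> point_config lam"
    then obtain i where i: "i \<ge> 1" "q = of_nat (lam (i - 1)) - of_nat i + 1 / 2" by (auto simp: point_config_def)
    thus "q \<in> range (\<lambda>i. of_nat (lam i) - of_nat (Suc i) + 1 / 2)"
      by (intro range_eqI[of _ _ "i - 1"]) simp
  next
    fix q assume "q \<in> range (\<lambda>i. of_nat (lam i) - of_nat (Suc i) + 1 / 2 :: rat)"
    then obtain i where "q = of_nat (lam (Suc i - 1)) - of_nat (Suc i) + 1 / 2" by auto
    thus "q \<in> point_config lam" unfolding point_config_def by (intro CollectI exI[of _ "Suc i"]) simp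
  qed
  also have "\<dots> = range (\<lambda>i. half (row_pos 0 lam i))"
    by (rule image_cong[OF refl]) (simp add: half_def row_pos_def)
  finally show ?thesis by (simp add: occ_conf[OF assms] image_image)
qed

text \<open>States are partitions together with a charge, and the vacuum entries vanish for nonzero
  charge, so the sum over states becomes one over partitions. Local finiteness is the row-finiteness
  of \<open>gp\<close> at the vacuum.\<close>

lemma vev_cres_anns_schur:
  assumes "distinct as"
  shows "vev (cres as * anns as) =
      mfps_sum (\<lambda>lam. schur xvar lam * (schur yvar lam :: 'a::field_char_0 series))
        {lam \<in> partitions. half ` set as \<subseteq> point_config lam}"
    and "locfin (\<lambda>lam. schur xvar lam * (schur yvar lam :: 'a series)) partitions"
proof -
  let ?P = "{lam \<in> partitions. half ` set as \<subseteq> point_config lam}"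
  have sub: "half ` set as \<subseteq> point_config lam \<longleftrightarrow> set as \<subseteq> occ (conf 0 lam)" if "lam \<in> partitions" for lam
    unfolding point_config_eq[OF that] by (rule inj_image_subset_iff[OF inj_half])
  have inj: "inj_on (conf 0) partitions" by (rule inj_onI) (rule conf_inject(2))
  have "ent gp vac S * ent gm S vac = (0 :: 'a series)" if S: "S \<notin> conf 0 ` partitions" for S
  proof -
    obtain c lam where cl: "lam \<in> partitions" "S = conf c lam" using conf_surj by blast
    hence "c \<noteq> 0" using S by auto
    thus ?thesis using cl by (simp add: gp_schur)
  qed
  note zero = this
  have "vev (cres as * anns as) = mfps_sum (\<lambda>S. ent gp vac S * (ent gm S vac :: 'a series)) {S. set as \<subseteq> occ S}"
    by (rule vev_cres_anns[OF assms])
  also have "\<dots> = mfps_sum (\<lambda>S. ent gp vac S * ent gm S vac) (conf 0 ` ?P)"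
  proof (rule mfps_sum_mono_neutral)
    show "conf 0 ` ?P \<subseteq> {S. set as \<subseteq> occ S}" using sub by auto
    fix S assume S: "S \<in> {S. set as \<subseteq> occ S} - conf 0 ` ?P"
    have "S \<notin> conf 0 ` partitions"
    proof
      assume "S \<in> conf 0 ` partitions"
      then obtain lam where "lam \<in> partitions" "S = conf 0 lam" by blast
      thus False using S sub by blast
    qed
    thus "ent gp vac S * ent gm S vac = (0 :: 'a series)" by (rule zero)
  qed
  also have "\<dots> = mfps_sum (\<lambda>lam. ent gp vac (conf 0 lam) * ent gm (conf 0 lam) vac) ?P"
    by (subst mfps_sum_reindex) (auto simp: o_def intro: inj_on_subset[OF inj])
  also have "\<dots> = mfps_sum (\<lambda>lam. schur xvar lam * schur yvar lam) ?P"
    by (rule mfps_sum_cong) (simp_all add: gp_schur gm_schur)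
  finally show "vev (cres as * anns as) = mfps_sum (\<lambda>lam. schur xvar lam * (schur yvar lam :: 'a series)) ?P" .
  have "locfin (\<lambda>S. ent gp vac S * (ent gm S vac :: 'a series)) (conf 0 ` partitions)"
    by (rule locfin_mult_right[OF locfin_ent])
  from locfin_reindex[OF inj this]
  show "locfin (\<lambda>lam. schur xvar lam * (schur yvar lam :: 'a series)) partitions"
    by (subst (asm) locfin_cong[OF refl]) (auto simp: gp_schur gm_schur)
qed

lemma mfps_inverse_unique: "f * g = 1 \<Longrightarrow> mfps_inverse f = g"
  unfolding mfps_inverse_def
proof (rule the_equality)
  fix h assume "f * g = 1" "f * h = 1"
  hence "h = (f * g) * h" by simp
  also have "\<dots> = (f * h) * g" by (simp only: mult_ac)
  finally show "h = g" using \<open>f * h = 1\<close> by simp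
qed

theorem theorem1:
  fixes X :: "rat set"
  assumes "finite X" and "X \<subseteq> half_ints"
  shows "(correlation X :: 'a::field_char_0 series) =
    det (mat (card X) (card X)
      (\<lambda>(i, j). corr_kernel (sorted_list_of_set X ! i) (sorted_list_of_set X ! j)))"
proof -
  obtain z :: "'a series" where z: "vev 1 * z = 1"
    and K: "\<And>i j. corr_kernel (half i) (half j) = z * vev (cre i * ann j)"
    using corr_kernel_vev by blast
  have "X \<subseteq> range half" using assms(2) by (simp add: half_ints_eq)
  \<comment> \<open>Passing from the points to their integer labels makes the fermion identities
    applicable; the sorted order fixes the order of rows and columns on both sides alike.\<close>
  define as where "as = map (inv_into UNIV half) (sorted_list_of_set X)"
  have as: "map half as = sorted_list_of_set X"
  proof -
    have "map (\<lambda>x. half (inv_into UNIV half x)) (sorted_list_of_set X) = map (\<lambda>x. x) (sorted_list_of_set X)"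
      by (rule map_cong[OF refl]) (use \<open>X \<subseteq> range half\<close> assms(1) in \<open>auto simp: f_inv_into_f\<close>)
    thus ?thesis by (simp add: as_def o_def)
  qed
  have "distinct (map half as)" unfolding as by simp
  hence dist: "distinct as" by (simp add: distinct_map)
  have X: "half ` set as = X" using arg_cong[OF as, of set] assms(1) by simp
  have len: "length as = card X" using arg_cong[OF as, of length] by simp
  have "det (mat (card X) (card X)
      (\<lambda>(i, j). corr_kernel (sorted_list_of_set X ! i) (sorted_list_of_set X ! j))) =
    det (mat (length as) (length as) (\<lambda>(i, j). corr_kernel (half (as ! i)) (half (as ! j)) :: 'a series))"
    unfolding as[symmetric] len[symmetric] by (intro arg_cong[where f = det] eq_matI) auto
  also have "\<dots> = z * vev (cres as * anns as)"
    by (rule det_vev[where K = "\<lambda>a b. corr_kernel (half a) (half b)", OF z K refl])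
  also have "\<dots> = z * mfps_sum (\<lambda>lam. schur xvar lam * schur yvar lam) {lam \<in> partitions. X \<subseteq> point_config lam}"
    by (simp only: vev_cres_anns_schur(1)[OF dist] X)
  also have "\<dots> = mfps_sum (\<lambda>lam. z * (schur xvar lam * schur yvar lam)) {lam \<in> partitions. X \<subseteq> point_config lam}"
    by (rule mfps_sum_cmult[symmetric], rule locfin_subset[OF vev_cres_anns_schur(2)[OF dist]]) auto
  also have "\<dots> = correlation X"
  proof -
    \<comment> \<open>The empty list imposes no condition on the partition, so the same formula
      yields the partition function, and z is its inverse.\<close>
    have "schur_Z = (vev 1 :: 'a series)"
      using vev_cres_anns_schur(1)[where 'a = 'a, of "[]"] by (simp add: schur_Z_def)
    hence "mfps_inverse schur_Z = z" using mfps_inverse_unique[OF z] by simp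
    thus ?thesis unfolding correlation_def schur_measure_def by simp
  qed
  finally show ?thesis by simp
qed

end
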